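(* Let $G_1(s)$ and $G_2(s)$ be real rational proper $m\times m$ transfer function matrices with minimal state space realizations $(A_1,B_1,C_1,D_1)$ and $(A_2,B_2,C_2,D_2)$ respectively, i.e. $G_i(s)=C_i(sI-A_i)^{-1}B_i+D_i$ for $i=1,2$. Suppose that $G_1(s)$ is strictly proper (so $D_1=0$) and negative imaginary (NI), and that $G_2(s)$ is strictly negative imaginary (SNI). Then the closed-loop positive feedback interconnection between $G_1(s)$ and $G_2(s)$ is internally stable if $G_2(0)<0$ and the matrix $A_1+B_1G_2(0)C_1$ is nonsingular.
   Context: All realizations are real: $A_i\in\mathbb{R}^{n_i\times n_i}$, $B_i\in\mathbb{R}^{n_i\times m}$, $C_i\in\mathbb{R}^{m\times n_i}$, $D_i\in\mathbb{R}^{m\times m}$. For a complex matrix $X$, $X^*$ is its conjugate transpose; $X\ge 0$, $X>0$, $X<0$ mean that the Hermitian (or real symmetric) matrix $X$ is positive semidefinite, positive definite, negative definite respectively. $j$ is the imaginary unit. NI: A square transfer function matrix $G(s)$ is negative imaginary (NI) if (1) $G(s)$ has no pole in $\mathrm{Re}[s]>0$; (2) for all $\omega\ge 0$ such that $j\omega$ is not a pole of $G(s)$, $j\left(G(j\omega)-G(j\omega)^*\right)\ge 0$; (3) if $s=j\omega_0$ is a pole of $G(s)$ then it is a simple pole; furthermore, if $\omega_0>0$, the residual matrix $K_0=\lim_{s\to j\omega_0}(s-j\omega_0)\,jG(s)$ is positive semidefinite Hermitian. (In particular, a simple pole at the origin is allowed.) SNI: A square transfer function matrix $G(s)$ is strictly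 negative imaginary (SNI) if (1) $G(s)$ has no pole in $\mathrm{Re}[s]\ge 0$; (2) for all $\omega>0$, $j\left(G(j\omega)-G(j\omega)^*\right)>0$. Internal stability: the positive feedback interconnection of $G_1$ and $G_2$ is internally stable if the closed-loop state matrix $$\breve{A}=\begin{bmatrix}A_1 & B_1C_2\\ 0 & A_2\end{bmatrix}+\begin{bmatrix}B_1D_2\\ B_2\end{bmatrix}(I-D_1D_2)^{-1}\begin{bmatrix}C_1 & D_1C_2\end{bmatrix}$$ of $(I-G_1(s)G_2(s))^{-1}$ is Hurwitz, i.e. all its eigenvalues lie in the open left half of the complex plane. When $D_1=0$ this matrix is $$\breve{A}=\begin{bmatrix}A_1+B_1D_2C_1 & B_1C_2\\ B_2C_1 & A_2\end{bmatrix}.$$ *)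

theory Defs
  imports
    "HOL-Complex_Analysis.Complex_Analysis"
    "Jordan_Normal_Form.Gauss_Jordan_Elimination"
    "Jordan_Normal_Form.Schur_Decomposition"
begin

abbreviation cmat :: "real mat \<Rightarrow> complex mat" where
  "cmat \<equiv> map_mat complex_of_real"

text \<open>Unspecified when \<open>M\<close> is singular.\<close>
definition mat_inv :: "'a::field mat \<Rightarrow> 'a mat" where
  "mat_inv M = the (mat_inverse M)"

definition hermitian_mat :: "nat \<Rightarrow> complex mat \<Rightarrow> bool" where
  "hermitian_mat m X \<longleftrightarrow> X \<in> carrier_mat m m \<and> mat_adjoint X = X"

text \<open>The number \<open>(X *\<^sub>v v) \<bullet>c v\<close> is the quadratic form of \<open>X\<close> at \<open>v\<close>; it is real for
  Hermitian \<open>X\<close>.\<close>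
definition pos_semidef :: "nat \<Rightarrow> complex mat \<Rightarrow> bool" where
  "pos_semidef m X \<longleftrightarrow> hermitian_mat m X \<and>
     (\<forall>v \<in> carrier_vec m. Re ((X *\<^sub>v v) \<bullet>c v) \<ge> 0)"

definition pos_def :: "nat \<Rightarrow> complex mat \<Rightarrow> bool" where
  "pos_def m X \<longleftrightarrow> hermitian_mat m X \<and>
     (\<forall>v \<in> carrier_vec m. v \<noteq> 0\<^sub>v m \<longrightarrow> Re ((X *\<^sub>v v) \<bullet>c v) > 0)"

definition neg_def :: "nat \<Rightarrow> complex mat \<Rightarrow> bool" where
  "neg_def m X \<longleftrightarrow> hermitian_mat m X \<and>
     (\<forall>v \<in> carrier_vec m. v \<noteq> 0\<^sub>v m \<longrightarrow> Re ((X *\<^sub>v v) \<bullet>c v) < 0)"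

definition realization ::
    "nat \<Rightarrow> nat \<Rightarrow> real mat \<Rightarrow> real mat \<Rightarrow> real mat \<Rightarrow> real mat \<Rightarrow> bool" where
  "realization n m A B C D \<longleftrightarrow>
     A \<in> carrier_mat n n \<and> B \<in> carrier_mat n m \<and> C \<in> carrier_mat m n \<and> D \<in> carrier_mat m m"

text \<open>The value at an eigenvalue of \<open>A\<close> is unspecified.\<close>
definition transfer_function ::
    "real mat \<Rightarrow> real mat \<Rightarrow> real mat \<Rightarrow> real mat \<Rightarrow> complex \<Rightarrow> complex mat" where
  "transfer_function A B C D s =
     cmat C * mat_inv (s \<cdot>\<^sub>m 1\<^sub>m (dim_row A) - cmat A) * cmat B + cmat D"

text \<open>Least state dimension among all real realizations of the same transfer function.
  Two rational functions are equal iff they agree at all but finitely many points; this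
  formulation disregards the unspecified values at the eigenvalues of \<open>A\<close> and \<open>A'\<close>.\<close>
definition minimal_realization ::
    "nat \<Rightarrow> nat \<Rightarrow> real mat \<Rightarrow> real mat \<Rightarrow> real mat \<Rightarrow> real mat \<Rightarrow> bool" where
  "minimal_realization n m A B C D \<longleftrightarrow> realization n m A B C D \<and>
     (\<forall>n' A' B' C' D'. realization n' m A' B' C' D' \<and>
        (\<forall>\<^sub>F s in cofinite. transfer_function A' B' C' D' s = transfer_function A B C D s)
        \<longrightarrow> n \<le> n')"

definition strictly_proper :: "nat \<Rightarrow> (complex \<Rightarrow> complex mat) \<Rightarrow> bool" where
  "strictly_proper m G \<longleftrightarrow>
     (\<forall>i<m. \<forall>k<m. ((\<lambda>s. G s $$ (i, k)) \<longlongrightarrow> 0) at_infinity)"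

definition tf_pole :: "nat \<Rightarrow> (complex \<Rightarrow> complex mat) \<Rightarrow> complex \<Rightarrow> bool" where
  "tf_pole m G z \<longleftrightarrow> (\<exists>i<m. \<exists>k<m. is_pole (\<lambda>s. G s $$ (i, k)) z)"

definition tf_simple_pole :: "nat \<Rightarrow> (complex \<Rightarrow> complex mat) \<Rightarrow> complex \<Rightarrow> bool" where
  "tf_simple_pole m G z \<longleftrightarrow> tf_pole m G z \<and>
     (\<forall>i<m. \<forall>k<m. is_pole (\<lambda>s. G s $$ (i, k)) z \<longrightarrow> zorder (\<lambda>s. G s $$ (i, k)) z = -1)"

definition negative_imaginary :: "nat \<Rightarrow> (complex \<Rightarrow> complex mat) \<Rightarrow> bool" where
  "negative_imaginary m G \<longleftrightarrow>
     (\<forall>s. Re s > 0 \<longrightarrow> \<not> tf_pole m G s) \<and>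
     (\<forall>\<omega>::real. \<omega> \<ge> 0 \<longrightarrow> \<not> tf_pole m G (\<i> * of_real \<omega>) \<longrightarrow>
        pos_semidef m (\<i> \<cdot>\<^sub>m (G (\<i> * of_real \<omega>) - mat_adjoint (G (\<i> * of_real \<omega>))))) \<and>
     (\<forall>\<omega>\<^sub>0::real. tf_pole m G (\<i> * of_real \<omega>\<^sub>0) \<longrightarrow>
        tf_simple_pole m G (\<i> * of_real \<omega>\<^sub>0) \<and>
        (\<omega>\<^sub>0 > 0 \<longrightarrow>
          (\<exists>K\<^sub>0. pos_semidef m K\<^sub>0 \<and>
             (\<forall>i<m. \<forall>k<m.
                ((\<lambda>s. (s - \<i> * of_real \<omega>\<^sub>0) * (\<i> * G s $$ (i, k))) \<longlongrightarrow> K\<^sub>0 $$ (i, k))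
                  (at (\<i> * of_real \<omega>\<^sub>0))))))"

definition strictly_negative_imaginary :: "nat \<Rightarrow> (complex \<Rightarrow> complex mat) \<Rightarrow> bool" where
  "strictly_negative_imaginary m G \<longleftrightarrow>
     (\<forall>s. Re s \<ge> 0 \<longrightarrow> \<not> tf_pole m G s) \<and>
     (\<forall>\<omega>::real. \<omega> > 0 \<longrightarrow>
        pos_def m (\<i> \<cdot>\<^sub>m (G (\<i> * of_real \<omega>) - mat_adjoint (G (\<i> * of_real \<omega>)))))"

definition hurwitz :: "real mat \<Rightarrow> bool" where
  "hurwitz A \<longleftrightarrow> (\<forall>z. eigenvalue (cmat A) z \<longrightarrow> Re z < 0)"

definition append_cols :: "'a::zero mat \<Rightarrow> 'a mat \<Rightarrow> 'a mat" where
  "append_cols X Y = four_block_mat X Y (0\<^sub>m 0 (dim_col X)) (0\<^sub>m 0 (dim_col Y))"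

definition closed_loop_matrix ::
    "real mat \<Rightarrow> real mat \<Rightarrow> real mat \<Rightarrow> real mat \<Rightarrow>
     real mat \<Rightarrow> real mat \<Rightarrow> real mat \<Rightarrow> real mat \<Rightarrow> real mat" where
  "closed_loop_matrix A\<^sub>1 B\<^sub>1 C\<^sub>1 D\<^sub>1 A\<^sub>2 B\<^sub>2 C\<^sub>2 D\<^sub>2 =
     four_block_mat A\<^sub>1 (B\<^sub>1 * C\<^sub>2) (0\<^sub>m (dim_row A\<^sub>2) (dim_col A\<^sub>1)) A\<^sub>2
     + ((B\<^sub>1 * D\<^sub>2) @\<^sub>r B\<^sub>2) * mat_inv (1\<^sub>m (dim_row D\<^sub>1) - D\<^sub>1 * D\<^sub>2)
       * append_cols C\<^sub>1 (D\<^sub>1 * C\<^sub>2)"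

text \<open>The invertibility conjunct (well-posedness) is what makes the inverse in
  \<^const>\<open>closed_loop_matrix\<close> meaningful.\<close>
definition internally_stable ::
    "real mat \<Rightarrow> real mat \<Rightarrow> real mat \<Rightarrow> real mat \<Rightarrow>
     real mat \<Rightarrow> real mat \<Rightarrow> real mat \<Rightarrow> real mat \<Rightarrow> bool" where
  "internally_stable A\<^sub>1 B\<^sub>1 C\<^sub>1 D\<^sub>1 A\<^sub>2 B\<^sub>2 C\<^sub>2 D\<^sub>2 \<longleftrightarrow>
     invertible_mat (1\<^sub>m (dim_row D\<^sub>1) - D\<^sub>1 * D\<^sub>2) \<and>
     hurwitz (closed_loop_matrix A\<^sub>1 B\<^sub>1 C\<^sub>1 D\<^sub>1 A\<^sub>2 B\<^sub>2 C\<^sub>2 D\<^sub>2)"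

end

theory Submission
  imports Defs "Jordan_Normal_Form.Matrix_Kernel"
begin

text \<open>
  The proof translates both frequency domain conditions into positive realness. On the imaginary
  axis, \<open>\<i> (G\<^sub>1 - G\<^sub>1\<^sup>*) \<ge> 0\<close> says that \<open>s G\<^sub>1(s)\<close> has a positive semidefinite Hermitian part;
  its poles on the axis are simple with positive semidefinite residues, since the factor \<open>s\<close>
  cancels a simple pole at the origin, and it is bounded at infinity. A minimum principle on the
  half-plane then gives \<open>Re (s u\<^sup>* G\<^sub>1(s) u) \<ge> 0\<close> for \<open>Re s > 0\<close>
  (\<open>negative_imaginary_imp_positive_real\<close>). In the same way \<open>- G\<^sub>2(s) / s\<close> is strictly positive
  real: its only singularity on the axis is the pole at the origin, and its residue
  \<open>- G\<^sub>2(0)\<close> is positive definite by hypothesis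
  (\<open>strictly_negative_imaginary_imp_strictly_positive_real\<close>). Both facts rest on
  \<open>Re_nonneg_from_imaginary_axis\<close>, a statement about scalar functions.

  An eigenvector of the closed loop for an eigenvalue \<open>s\<close> with \<open>Re s \<ge> 0\<close> carries signals with
  \<open>y = C\<^sub>1 x\<^sub>1\<close> and \<open>u = G\<^sub>2(s) y\<close>, where \<open>u\<close> drives the first system and \<open>y \<noteq> 0\<close> by observability.
  If \<open>Re s > 0\<close>, the first system gives \<open>Re (s u\<^sup>* y) \<ge> 0\<close>, the second one gives
  \<open>Re (cnj s y\<^sup>* u) < 0\<close>, and these two real parts are equal. If \<open>s = \<i> \<omega>\<close> with \<open>\<omega> > 0\<close>, the
  same contradiction arises, the strict inequality being the definition of a strictly negative
  imaginary system. Here \<open>s\<close> may be a pole of \<open>G\<^sub>1\<close>, so the inequality for the first system is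
  stated for pairs \<open>(x, u)\<close> with \<open>(s - A\<^sub>1) x = B\<^sub>1 u\<close> instead of for \<open>G\<^sub>1(s)\<close>: controllability lets
  such a pair be approximated by pairs in the open half-plane (\<open>input_state_approximation\<close>).
  For \<open>s = 0\<close> the eigenvector equation puts \<open>x\<^sub>1\<close> into the kernel of \<open>A\<^sub>1 + B\<^sub>1 G\<^sub>2(0) C\<^sub>1\<close>. The lower
  half-plane follows by conjugation.

  Minimality links the poles of the transfer functions to the eigenvalues of the state matrices:
  a minimal realization has no left eigenvector annihilated by \<open>B\<close> and no right eigenvector
  annihilated by \<open>C\<close>, and therefore every eigenvalue is a pole
  (\<open>minimal_realization_eigenvalue_is_pole\<close>).
\<close>

unbundle no vec_syntax and no inner_syntax
no_notation fps_nth (infixl \<open>$\<close> 75)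

section \<open>Matrices and vectors\<close>

text \<open>Coordinates on a proper subspace of the state space that is given by linear equations; the number
  \<open>r\<close> becomes the state dimension of a reduced realization.\<close>

lemma kernel_as_column_space:
  fixes M :: "'a::field mat"
  assumes M: "M \<in> carrier_mat k n" and "M \<noteq> 0\<^sub>m k n"
  obtains r N where "r < n" "N \<in> carrier_mat n r"
    "\<And>j. j < r \<Longrightarrow> M *\<^sub>v col N j = 0\<^sub>v k"
    "\<And>v. v \<in> carrier_vec n \<Longrightarrow> M *\<^sub>v v = 0\<^sub>v k \<Longrightarrow> \<exists>c \<in> carrier_vec r. v = N *\<^sub>v c"
proof -
  interpret K: kernel k n M by unfold_locales (rule M)
  define E where "E = gauss_jordan_single M"
  note E = gauss_jordan_single[OF M E_def[symmetric]]
  interpret KE: kernel k n E by unfold_locales (rule E(2))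
  define S where "S = set (find_base_vectors E)"
  note S = find_base_vectors[OF E(3) E(2), folded S_def]
  obtain P Q where PQ: "E = P * M" "P \<in> carrier_mat k k" "Q \<in> carrier_mat k k" "Q * P = 1\<^sub>m k"
    using E(4) by blast
  have "E \<noteq> 0\<^sub>m k n"
  proof
    assume "E = 0\<^sub>m k n"
    hence "Q * (P * M) = 0\<^sub>m k n" using PQ by simp
    hence "M = 0\<^sub>m k n" using PQ M by (simp flip: assoc_mult_mat[OF PQ(3,2) M])
    thus False using assms by simp
  qed
  hence "\<exists>i<k. row E i \<noteq> 0\<^sub>v n" using E(2)
    by (metis eq_matI index_row(1) index_zero_mat index_zero_vec(1) carrier_matD)
  hence "card { i. i < k \<and> row E i \<noteq> 0\<^sub>v n} > 0" by (auto simp: card_gt_0_iff)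
  moreover have "n > 0" using \<open>E \<noteq> 0\<^sub>m k n\<close> E(2) by (cases n) auto
  ultimately have card: "card S < n" using S(4) by linarith
  obtain xs where xs: "set xs = S" "distinct xs" "length xs = card S"
    using finite_distinct_list[of S] distinct_card by (force simp: S_def)
  define N where "N = mat_of_cols n xs"
  have S_carrier: "S \<subseteq> carrier_vec n" using S(1) mat_kernel_carrier[OF E(2)] by auto
  show ?thesis
  proof
    show "card S < n" by (rule card)
    show "N \<in> carrier_mat n (card S)" by (simp add: N_def xs(3)[symmetric])
    show "M *\<^sub>v col N j = 0\<^sub>v k" if "j < card S" for j
    proof -
      have "xs ! j \<in> mat_kernel E" using that S(1) xs by (metis nth_mem subsetD)
      moreover have "col N j = xs ! j" using that xs S_carrier unfolding N_def
        by (metis nth_mem subsetD col_mat_of_cols)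
      ultimately show ?thesis using E(1)[of "col N j"] mat_kernelD[OF E(2)] by auto
    qed
    fix v assume v: "v \<in> carrier_vec n" "M *\<^sub>v v = 0\<^sub>v k"
    hence "v \<in> mat_kernel E" using E by (auto intro!: mat_kernelI)
    moreover have "KE.Ker.span S = mat_kernel E"
      using S(3) by (auto simp: KE.Ker.basis_def)
    ultimately have "v \<in> KE.Ker.span S" by simp
    then obtain a where a: "v = KE.Ker.lincomb a S"
      using KE.Ker.finite_in_span[of S v] S(1) by (auto simp: S_def)
    have "v = N *\<^sub>v vec (card S) (\<lambda>i. a (xs ! i))"
    proof (rule eq_vecI)
      fix i assume "i < dim_vec (N *\<^sub>v vec (card S) (\<lambda>i. a (xs ! i)))"
      hence i: "i < n" by (simp add: N_def)
      have "v $ i = (\<Sum>x\<in>S. a x * x $ i)" using KE.lincomb_index[OF i S(1)] a by simp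
      also have "\<dots> = (\<Sum>j<length xs. a (xs ! j) * xs ! j $ i)"
        using sum.reindex_bij_betw[OF bij_betw_nth[OF xs(2) refl xs(1)[symmetric]], of "\<lambda>x. a x * x $ i"] by simp
      also have "\<dots> = (N *\<^sub>v vec (card S) (\<lambda>i. a (xs ! i))) $ i"
        using i xs by (auto simp: N_def scalar_prod_def mat_of_cols_def lessThan_atLeast0 mult.commute intro!: sum.cong)
      finally show "v $ i = (N *\<^sub>v vec (card S) (\<lambda>i. a (xs ! i))) $ i" .
    qed (use v in \<open>simp add: N_def\<close>)
    thus "\<exists>c\<in>carrier_vec (card S). v = N *\<^sub>v c" by (intro bexI[of _ "vec (card S) (\<lambda>i. a (xs ! i))"]) auto
  qed
qed

lemma factor_through_columns:
  fixes N :: "'a::field mat"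
  assumes N: "N \<in> carrier_mat n r" and X: "X \<in> carrier_mat n m"
    and cols: "\<And>j. j < m \<Longrightarrow> \<exists>c \<in> carrier_vec r. col X j = N *\<^sub>v c"
  obtains Y where "Y \<in> carrier_mat r m" "X = N * Y"
proof -
  obtain c where c: "\<And>j. j < m \<Longrightarrow> c j \<in> carrier_vec r \<and> col X j = N *\<^sub>v c j"
    using cols by metis
  define Y where "Y = mat r m (\<lambda>(i, j). c j $ i)"
  have Y: "Y \<in> carrier_mat r m" by (simp add: Y_def)
  have "X = N * Y"
  proof (rule mat_col_eqI)
    fix j assume "j < dim_col (N * Y)"
    hence j: "j < m" by (simp add: Y_def)
    have "col Y j = c j" using c[OF j] j by (auto simp: Y_def)
    thus "col X j = col (N * Y) j" using c[OF j] N Y j by (simp add: col_mult2[OF N Y j])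
  qed (use N X Y in auto)
  with Y show ?thesis by (rule that)
qed

lemma zero_mat_mult_vec [simp]:
  "v \<in> carrier_vec n \<Longrightarrow> 0\<^sub>m k n *\<^sub>v v = 0\<^sub>v k" for v :: "'a::comm_ring_1 vec"
  by (intro eq_vecI) auto

lemma minus_vec_eq_zero_iff:
  "v \<in> carrier_vec n \<Longrightarrow> w \<in> carrier_vec n \<Longrightarrow> v - w = 0\<^sub>v n \<longleftrightarrow> v = w"
  for v w :: "'a::ab_group_add vec"
proof -
  assume vw: "v \<in> carrier_vec n" "w \<in> carrier_vec n"
  have "v = w" if "v - w = 0\<^sub>v n"
  proof (rule eq_vecI)
    fix i assume "i < dim_vec w"
    thus "v $ i = w $ i" using arg_cong[OF that, of "\<lambda>u. vec_index u i"] vw by simp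
  qed (use vw in simp)
  thus "v - w = 0\<^sub>v n \<longleftrightarrow> v = w" using vw by auto
qed

lemma mult_sum_mat_vec:
  fixes P :: "'a::comm_ring_1 mat"
  assumes "P \<in> carrier_mat a b" "Q \<in> carrier_mat b c" "R \<in> carrier_mat a d" "S \<in> carrier_mat d c"
    and "w \<in> carrier_vec c"
  shows "(P * Q + R * S) *\<^sub>v w = P *\<^sub>v (Q *\<^sub>v w) + R *\<^sub>v (S *\<^sub>v w)"
  using add_mult_distrib_mat_vec[OF mult_carrier_mat[OF assms(1,2)] mult_carrier_mat[OF assms(3,4)] assms(5)]
    assoc_mult_mat_vec[OF assms(1,2,5)] assoc_mult_mat_vec[OF assms(3,4,5)] by simp

lemma mult_mat_vec_index_sum:
  "X \<in> carrier_mat a b \<Longrightarrow> v \<in> carrier_vec b \<Longrightarrow> i < a \<Longrightarrow> (X *\<^sub>v v) $ i = (\<Sum>k<b. X $$ (i, k) * v $ k)"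
  by (auto simp: scalar_prod_def lessThan_atLeast0)

section \<open>Resolvents and transfer functions as rational functions\<close>

definition pencil :: "real mat \<Rightarrow> complex \<Rightarrow> complex mat" where
  "pencil A s = s \<cdot>\<^sub>m 1\<^sub>m (dim_row A) - cmat A"

lemma pencil_carrier [simp, intro]:
  "A \<in> carrier_mat n n \<Longrightarrow> pencil A s \<in> carrier_mat n n"
  by (auto simp: pencil_def)

lemma pencil_dim [simp]: "dim_row (pencil A s) = dim_row A" "dim_col (pencil A s) = dim_col A"
  by (simp_all add: pencil_def)

lemma transfer_function_pencil:
  "transfer_function A B C D s = cmat C * mat_inv (pencil A s) * cmat B + cmat D"
  by (simp add: transfer_function_def pencil_def)

lemma pencil_mult_vec:
  assumes "A \<in> carrier_mat n n" "v \<in> carrier_vec n"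
  shows "pencil A s *\<^sub>v v = s \<cdot>\<^sub>v v - cmat A *\<^sub>v v"
  using assms by (auto simp: pencil_def minus_mult_distrib_mat_vec[of _ n n])

abbreviation eval_mat :: "complex \<Rightarrow> complex poly mat \<Rightarrow> complex mat" where
  "eval_mat s \<equiv> map_mat (\<lambda>p. poly p s)"

lemma eval_char_poly_matrix:
  assumes "A \<in> carrier_mat n n"
  shows "eval_mat s (char_poly_matrix (cmat A)) = pencil A s"
  using assms by (intro eq_matI) (auto simp: char_poly_matrix_def pencil_def)

lemma
  shows eval_mat_mult: "X \<in> carrier_mat a b \<Longrightarrow> Y \<in> carrier_mat b c \<Longrightarrow>
      eval_mat s (X * Y) = eval_mat s X * eval_mat s Y"
    and eval_mat_add: "X \<in> carrier_mat a b \<Longrightarrow> Y \<in> carrier_mat a b \<Longrightarrow>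
      eval_mat s (X + Y) = eval_mat s X + eval_mat s Y"
    and det_eval_mat: "det (eval_mat s X) = poly (det X) s"
proof -
  have h: "comm_ring_hom (\<lambda>p :: complex poly. poly p s)" "semiring_hom (\<lambda>p :: complex poly. poly p s)"
    by unfold_locales auto
  show "X \<in> carrier_mat a b \<Longrightarrow> Y \<in> carrier_mat b c \<Longrightarrow> eval_mat s (X * Y) = eval_mat s X * eval_mat s Y"
    by (rule semiring_hom.mat_hom_mult[OF h(2)])
  show "X \<in> carrier_mat a b \<Longrightarrow> Y \<in> carrier_mat a b \<Longrightarrow> eval_mat s (X + Y) = eval_mat s X + eval_mat s Y"
    by (auto intro!: eq_matI)
  show "det (eval_mat s X) = poly (det X) s"
    by (rule comm_ring_hom.hom_det[OF h(1)])
qed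

lemma det_pencil:
  assumes "A \<in> carrier_mat n n"
  shows "det (pencil A s) = poly (char_poly (cmat A)) s"
  unfolding char_poly_def eval_char_poly_matrix[OF assms, symmetric]
  by (rule det_eval_mat)

lemma eigenvalue_iff_det_pencil:
  assumes "A \<in> carrier_mat n n"
  shows "eigenvalue (cmat A) s \<longleftrightarrow> det (pencil A s) = 0"
  using eigenvalue_root_char_poly[of "cmat A" n s] assms by (simp add: det_pencil)

lemma finite_eigenvalues:
  assumes "A \<in> carrier_mat n n"
  shows "finite {s. eigenvalue (cmat A) s}"
proof -
  have "char_poly (cmat A) \<noteq> 0" using degree_monic_char_poly[of "cmat A" n] assms by auto
  thus ?thesis using eigenvalue_root_char_poly[of "cmat A" n] assms by (simp add: poly_roots_finite)
qed

lemma mat_inv_inverse: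
  fixes M :: "'a::field mat"
  assumes M: "M \<in> carrier_mat n n" and "det M \<noteq> 0"
  shows "mat_inv M \<in> carrier_mat n n" "M * mat_inv M = 1\<^sub>m n" "mat_inv M * M = 1\<^sub>m n"
proof -
  have "mat_inverse M \<noteq> None" using mat_inverse(1)[OF M, of undefined] det_non_zero_imp_unit[OF assms, of undefined] by blast
  thus "mat_inv M \<in> carrier_mat n n" "M * mat_inv M = 1\<^sub>m n" "mat_inv M * M = 1\<^sub>m n"
    using mat_inverse(2)[OF M] by (auto simp: mat_inv_def)
qed

lemma left_inverse_imp_det_nonzero:
  fixes M :: "'a::field mat"
  assumes "M \<in> carrier_mat n n" "X \<in> carrier_mat n n" "X * M = 1\<^sub>m n"
  shows "det M \<noteq> 0"
  using det_mult[OF assms(2,1)] assms(3) by auto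

lemma mat_inv_unique:
  fixes M :: "'a::field mat"
  assumes M: "M \<in> carrier_mat n n" and X: "X \<in> carrier_mat n n" and "X * M = 1\<^sub>m n"
  shows "mat_inv M = X"
proof -
  note I = mat_inv_inverse[OF M left_inverse_imp_det_nonzero[OF assms]]
  have "X * M * mat_inv M = X" using M X I by (simp add: assoc_mult_mat[OF X M])
  thus ?thesis using assms I by simp
qed

lemma mult_smult_mult_mat:
  fixes X :: "'a::comm_ring_1 mat"
  assumes "C \<in> carrier_mat a b" "X \<in> carrier_mat b c" "B \<in> carrier_mat c d"
  shows "C * (k \<cdot>\<^sub>m X) * B = k \<cdot>\<^sub>m (C * X * B)"
  by (simp only: mult_smult_distrib[OF assms(1,2)]
      mult_smult_assoc_mat[OF mult_carrier_mat[OF assms(1,2)] assms(3)])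

lemma eventually_not_eigenvalue:
  assumes "A \<in> carrier_mat n n"
  shows "\<forall>\<^sub>F s in cofinite. \<not> eigenvalue (cmat A) s"
  using finite_eigenvalues[OF assms] by (simp add: eventually_cofinite)

lemma eventually_cofinite_at:
  fixes z :: "'a::t1_space"
  assumes "eventually P cofinite" shows "eventually P (at z)"
proof -
  have "finite {x. \<not> P x}" using assms by (simp add: eventually_cofinite)
  hence "open (- ({x. \<not> P x} - {z}))" by (intro open_Compl finite_imp_closed) simp
  thus ?thesis unfolding eventually_at_topological by (intro exI[of _ "- ({x. \<not> P x} - {z})"]) auto
qed

text \<open>Cramer's rule: the adjugate of \<open>s - A\<close> is polynomial in \<open>s\<close>, and all entries of the transfer
  function share the characteristic polynomial as a denominator.\<close>

lemma transfer_function_as_ratio: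
  assumes "realization n m A B C D"
  obtains q where "\<And>s i k. \<not> eigenvalue (cmat A) s \<Longrightarrow> i < m \<Longrightarrow> k < m \<Longrightarrow>
    transfer_function A B C D s $$ (i, k) = poly (q i k) s / poly (char_poly (cmat A)) s"
proof -
  have [simp]: "A \<in> carrier_mat n n" "B \<in> carrier_mat n m" "C \<in> carrier_mat m n" "D \<in> carrier_mat m m"
    using assms by (auto simp: realization_def)
  define P where "P = adj_mat (char_poly_matrix (cmat A))"
  define K where "K = map_mat (\<lambda>c :: complex. [:c:])"
  define \<chi> where "\<chi> = char_poly (cmat A)"
  have ac: "char_poly_matrix (cmat A) \<in> carrier_mat n n" by simp
  note adj = adj_mat[OF ac, folded P_def]
  define Q where "Q = K (cmat C) * P * K (cmat B) + \<chi> \<cdot>\<^sub>m K (cmat D)"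
  have [simp]: "P \<in> carrier_mat n n" by (rule adj)
  have Kc [simp]: "X \<in> carrier_mat a b \<Longrightarrow> K X \<in> carrier_mat a b" for X a b by (simp add: K_def)
  have EK [simp]: "eval_mat s (K X) = X" for X s by (auto simp: K_def)
  show ?thesis
  proof
    fix s i k assume s: "\<not> eigenvalue (cmat A) s" and ik: "i < m" "k < m"
    have \<chi>: "poly \<chi> s \<noteq> 0" using s eigenvalue_root_char_poly[of "cmat A" n s] by (simp add: \<chi>_def)
    have "eval_mat s P * pencil A s = eval_mat s (\<chi> \<cdot>\<^sub>m 1\<^sub>m n)"
      using arg_cong[OF adj(3), of "eval_mat s"]
      by (simp add: eval_mat_mult[OF adj(1) ac] eval_char_poly_matrix[of A n] \<chi>_def char_poly_def)
    also have "\<dots> = poly \<chi> s \<cdot>\<^sub>m 1\<^sub>m n" by (intro eq_matI) auto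
    finally have EP: "eval_mat s P * pencil A s = poly \<chi> s \<cdot>\<^sub>m 1\<^sub>m n" .
    have "(1 / poly \<chi> s) \<cdot>\<^sub>m eval_mat s P * pencil A s = (1 / poly \<chi> s) \<cdot>\<^sub>m (eval_mat s P * pencil A s)"
      by (rule mult_smult_assoc_mat[of _ n n _ n]) auto
    also have "\<dots> = 1\<^sub>m n" using \<chi> by (simp add: EP) (auto intro!: eq_matI)
    finally have R: "mat_inv (pencil A s) = (1 / poly \<chi> s) \<cdot>\<^sub>m eval_mat s P"
      by (intro mat_inv_unique[of _ n]) auto
    have "eval_mat s Q = cmat C * eval_mat s P * cmat B + eval_mat s (\<chi> \<cdot>\<^sub>m K (cmat D))"
    proof -
      have KC: "K (cmat C) * P \<in> carrier_mat m n" by (rule mult_carrier_mat[of _ _ n]) auto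
      have KB: "K (cmat B) \<in> carrier_mat n m" "K (cmat C) \<in> carrier_mat m n" by auto
      have CPB: "K (cmat C) * P * K (cmat B) \<in> carrier_mat m m" by (rule mult_carrier_mat[OF KC KB(1)])
      have D': "\<chi> \<cdot>\<^sub>m K (cmat D) \<in> carrier_mat m m" by simp
      show ?thesis
        by (simp only: Q_def eval_mat_add[OF CPB D'] eval_mat_mult[OF KC KB(1)] eval_mat_mult[OF KB(2) adj(1)] EK)
    qed
    also have "eval_mat s (\<chi> \<cdot>\<^sub>m K (cmat D)) = poly \<chi> s \<cdot>\<^sub>m cmat D"
      by (auto intro!: eq_matI simp: K_def)
    finally have E: "eval_mat s Q = cmat C * eval_mat s P * cmat B + poly \<chi> s \<cdot>\<^sub>m cmat D" .
    have T: "cmat C * ((1 / poly \<chi> s) \<cdot>\<^sub>m eval_mat s P) * cmat B = (1 / poly \<chi> s) \<cdot>\<^sub>m (cmat C * eval_mat s P * cmat B)"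
      by (rule mult_smult_mult_mat[of _ m n _ n _ m]) auto
    have "transfer_function A B C D s = (1 / poly \<chi> s) \<cdot>\<^sub>m eval_mat s Q"
    proof -
      have W: "cmat C * eval_mat s P * cmat B \<in> carrier_mat m m"
        by (rule mult_carrier_mat[OF mult_carrier_mat[of _ m n _ n]]) auto
      have "(1 / c) \<cdot>\<^sub>m X + Y = (1 / c) \<cdot>\<^sub>m (X + c \<cdot>\<^sub>m Y)"
        if "X \<in> carrier_mat m m" "Y \<in> carrier_mat m m" "c \<noteq> 0" for c and X Y :: "complex mat"
        using that by (intro eq_matI) (simp_all add: add_divide_distrib)
      from this[OF W _ \<chi>, of "cmat D"]
      have "(1 / poly \<chi> s) \<cdot>\<^sub>m (cmat C * eval_mat s P * cmat B) + cmat D =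
        (1 / poly \<chi> s) \<cdot>\<^sub>m (cmat C * eval_mat s P * cmat B + poly \<chi> s \<cdot>\<^sub>m cmat D)"
        by (simp only: map_carrier_mat \<open>D \<in> carrier_mat m m\<close>)
      thus ?thesis
        by (simp only: transfer_function_pencil R T E)
    qed
    moreover have "Q \<in> carrier_mat m m" by (auto simp: Q_def)
    ultimately show "transfer_function A B C D s $$ (i, k) = poly (Q $$ (i, k)) s / poly (char_poly (cmat A)) s"
      using ik by (simp add: \<chi>_def)
  qed
qed

section \<open>Minimal realizations\<close>

text \<open>The range of \<open>N\<close> is an \<open>A\<close>-invariant subspace that contains the range of \<open>B\<close>. Since \<open>N\<close>
  intertwines the pencils of \<open>A\<close> and \<open>A'\<close>, it intertwines their resolvents, and the system
  restricted to that subspace has the same transfer function.\<close>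

lemma transfer_function_reduce:
  assumes R: "realization n m A B C D" and N: "N \<in> carrier_mat n r"
    and A': "A' \<in> carrier_mat r r" and B': "B' \<in> carrier_mat r m"
    and AN: "A * N = N * A'" and BN: "B = N * B'"
    and s: "\<not> eigenvalue (cmat A) s" "\<not> eigenvalue (cmat A') s"
  shows "transfer_function A' B' (C * N) D s = transfer_function A B C D s"
proof -
  have A: "A \<in> carrier_mat n n" and B: "B \<in> carrier_mat n m" and C: "C \<in> carrier_mat m n"
    using R by (auto simp: realization_def)
  define R where "R = mat_inv (pencil A s)"
  define R' where "R' = mat_inv (pencil A' s)"
  note I = mat_inv_inverse[OF pencil_carrier[OF A], of s, folded R_def]
  note I' = mat_inv_inverse[OF pencil_carrier[OF A'], of s, folded R'_def]
  have I: "R \<in> carrier_mat n n" "R * pencil A s = 1\<^sub>m n"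
    using I s by (auto simp: eigenvalue_iff_det_pencil[OF A])
  have I': "R' \<in> carrier_mat r r" "pencil A' s * R' = 1\<^sub>m r"
    using I' s by (auto simp: eigenvalue_iff_det_pencil[OF A'])
  define M where "M = cmat N"
  have M: "M \<in> carrier_mat n r" using N by (simp add: M_def)
  have cAN: "cmat A * M = M * cmat A'"
    using arg_cong[OF AN, of cmat] by (simp add: M_def of_real_hom.mat_hom_mult[OF A N] of_real_hom.mat_hom_mult[OF N A'])
  have cB: "cmat B = M * cmat B'" by (simp add: M_def BN of_real_hom.mat_hom_mult[OF N B'])
  have cC: "cmat (C * N) = cmat C * M" by (simp add: M_def of_real_hom.mat_hom_mult[OF C N])
  have PM: "pencil A s * M = M * pencil A' s"
    using A A' M cAN
    by (simp add: pencil_def minus_mult_distrib_mat[of _ n n] mult_minus_distrib_mat[of _ n r _ r]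
        mult_smult_assoc_mat[of _ n n _ r] mult_smult_distrib[of _ n r _ r])
  have "M * R' = R * pencil A s * (M * R')" unfolding I(2) using M I'(1) by simp
  also have "\<dots> = R * ((pencil A s * M) * R')"
    using I(1) M I'(1) A by (simp add: assoc_mult_mat[of _ n n _ n _ r] assoc_mult_mat[of _ n n _ r _ r])
  also have "\<dots> = R * (M * (pencil A' s * R'))"
    unfolding PM using M I' A' by (simp add: assoc_mult_mat[of _ n r _ r _ r])
  also have "\<dots> = R * M" using M I' by simp
  finally have MR: "M * R' = R * M" .
  have "cmat C * M * R' * cmat B' = cmat C * (M * R') * cmat B'"
    using C M I' by (simp add: assoc_mult_mat[of _ m n _ r _ r])
  also have "\<dots> = cmat C * R * cmat B"
    unfolding MR cB using C M I B' by (simp add: assoc_mult_mat[of _ m n _ n _ r] assoc_mult_mat[of _ m n _ r _ m] assoc_mult_mat[of _ m n _ n _ m] assoc_mult_mat[of _ n n _ r _ m])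
  finally show ?thesis by (simp add: transfer_function_pencil cC R_def R'_def)
qed

lemma minimal_realization_irreducible:
  assumes min: "minimal_realization n m A B C D" and N: "N \<in> carrier_mat n r"
    and A': "A' \<in> carrier_mat r r" and B': "B' \<in> carrier_mat r m"
    and AN: "A * N = N * A'" and BN: "B = N * B'"
  shows "n \<le> r"
proof -
  have R: "realization n m A B C D" using min by (simp add: minimal_realization_def)
  hence A: "A \<in> carrier_mat n n" by (simp add: realization_def)
  have "realization r m A' B' (C * N) D" using R N A' B' by (auto simp: realization_def)
  moreover have "\<forall>\<^sub>F s in cofinite. transfer_function A' B' (C * N) D s = transfer_function A B C D s"
    using eventually_not_eigenvalue[OF A] eventually_not_eigenvalue[OF A']
    by eventually_elim (rule transfer_function_reduce[OF R N A' B' AN BN])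
  ultimately show ?thesis using min unfolding minimal_realization_def by blast
qed

lemma transpose_pencil:
  "A \<in> carrier_mat n n \<Longrightarrow> transpose_mat (pencil A s) = pencil (transpose_mat A) s"
  by (intro eq_matI) (auto simp: pencil_def)

lemma transfer_function_transpose:
  assumes R: "realization n m A B C D" and s: "\<not> eigenvalue (cmat A) s"
  shows "transfer_function (transpose_mat A) (transpose_mat C) (transpose_mat B) (transpose_mat D) s
    = transpose_mat (transfer_function A B C D s)"
proof -
  have A: "A \<in> carrier_mat n n" and B: "B \<in> carrier_mat n m" and C: "C \<in> carrier_mat m n"
    and D: "D \<in> carrier_mat m m"
    using R by (auto simp: realization_def)
  define R where "R = mat_inv (pencil A s)"
  have I: "R \<in> carrier_mat n n" "pencil A s * R = 1\<^sub>m n"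
    using mat_inv_inverse[OF pencil_carrier[OF A], of s, folded R_def] s
    by (auto simp: eigenvalue_iff_det_pencil[OF A])
  have "transpose_mat R * transpose_mat (pencil A s) = 1\<^sub>m n"
    using transpose_mult[OF pencil_carrier[OF A] I(1), of s] I by simp
  hence RT: "mat_inv (pencil (transpose_mat A) s) = transpose_mat R"
    using I A by (intro mat_inv_unique[of _ n]) (auto simp: transpose_pencil)
  have cT: "cmat (transpose_mat X) = transpose_mat (cmat X)" for X by (intro eq_matI) auto
  show ?thesis
    unfolding transfer_function_pencil RT cT R_def[symmetric]
    using A B C D I
    by (simp add: transpose_add[of _ m m] transpose_mult[of _ m n _ m] transpose_mult[of _ n n _ m]
        assoc_mult_mat[of _ m n _ n _ m])
qed

lemma realization_transpose:
  "realization n m A B C D \<Longrightarrow>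
    realization n m (transpose_mat A) (transpose_mat C) (transpose_mat B) (transpose_mat D)"
  by (auto simp: realization_def)

text \<open>Transposition exchanges controllability and observability, so that each statement about \<open>B\<close>
  yields one about \<open>C\<close>.\<close>

lemma minimal_realization_transpose:
  assumes min: "minimal_realization n m A B C D"
  shows "minimal_realization n m (transpose_mat A) (transpose_mat C) (transpose_mat B) (transpose_mat D)"
  unfolding minimal_realization_def
proof (intro conjI allI impI; (elim conjE)?)
  have R: "realization n m A B C D" using min by (simp add: minimal_realization_def)
  thus "realization n m (transpose_mat A) (transpose_mat C) (transpose_mat B) (transpose_mat D)"
    by (rule realization_transpose)
  fix r A' B' C' D'
  assume R': "realization r m A' B' C' D'"
    and eq: "\<forall>\<^sub>F s in cofinite. transfer_function A' B' C' D' s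
      = transfer_function (transpose_mat A) (transpose_mat C) (transpose_mat B) (transpose_mat D) s"
  have A: "A \<in> carrier_mat n n" "A' \<in> carrier_mat r r" using R R' by (auto simp: realization_def)
  have "\<forall>\<^sub>F s in cofinite. transfer_function (transpose_mat A') (transpose_mat C') (transpose_mat B') (transpose_mat D') s
      = transfer_function A B C D s"
    using eq eventually_not_eigenvalue[OF A(1)] eventually_not_eigenvalue[OF A(2)]
    by eventually_elim (simp add: transfer_function_transpose[OF R] transfer_function_transpose[OF R'])
  thus "n \<le> r" using min realization_transpose[OF R'] unfolding minimal_realization_def by blast
qed

text \<open>Suppose \<open>w \<noteq> 0\<close>. The real vectors orthogonal to both \<open>Re w\<close> and \<open>Im w\<close> form a proper
  \<open>A\<close>-invariant subspace containing the range of \<open>B\<close>, and restricting the state to it contradicts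
  minimality. Real and imaginary part occur together because the reduced realization has to be
  real, and the real hyperplanes orthogonal to only one of them need not be invariant.\<close>

lemma minimal_realization_controllable:
  assumes min: "minimal_realization n m A B C D" and w: "w \<in> carrier_vec n"
    and wA: "transpose_mat (cmat A) *\<^sub>v w = z \<cdot>\<^sub>v w" and wB: "transpose_mat (cmat B) *\<^sub>v w = 0\<^sub>v m"
  shows "w = 0\<^sub>v n"
proof (rule ccontr)
  assume "w \<noteq> 0\<^sub>v n"
  have A: "A \<in> carrier_mat n n" and B: "B \<in> carrier_mat n m"
    using min by (auto simp: minimal_realization_def realization_def)
  define M where "M = mat_of_rows n [map_vec Re w, map_vec Im w]"
  have M: "M \<in> carrier_mat 2 n" by (intro carrier_matI) (simp_all add: M_def)
  have kernel: "M *\<^sub>v v = 0\<^sub>v 2 \<longleftrightarrow> map_vec complex_of_real v \<bullet> w = 0" if v: "v \<in> carrier_vec n" for v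
  proof -
    have "map_vec Re w \<bullet> v = Re (map_vec complex_of_real v \<bullet> w)"
         "map_vec Im w \<bullet> v = Im (map_vec complex_of_real v \<bullet> w)"
      using v w by (auto simp: scalar_prod_def Re_sum Im_sum mult.commute intro!: sum.cong)
    moreover have "M *\<^sub>v v = vec_of_list [map_vec Re w \<bullet> v, map_vec Im w \<bullet> v]"
      using w v by (intro eq_vecI) (auto simp: M_def less_2_cases_iff numeral_2_eq_2 less_Suc_eq)
    ultimately show ?thesis
      by (auto simp: complex_eq_iff vec_eq_iff numeral_2_eq_2 less_Suc_eq)
  qed
  have "M \<noteq> 0\<^sub>m 2 n"
  proof
    assume 0: "M = 0\<^sub>m 2 n"
    have "w $ i = 0" if i: "i < n" for i
    proof -
      have "M $$ (0, i) = Re (w $ i)" "M $$ (1, i) = Im (w $ i)"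
        using i w by (auto simp: M_def mat_of_rows_def)
      thus ?thesis using i by (simp add: 0 complex_eq_iff)
    qed
    hence "w = 0\<^sub>v n" using w by (intro eq_vecI) auto
    thus False using \<open>w \<noteq> 0\<^sub>v n\<close> by contradiction
  qed
  then obtain r N where r: "r < n" and N: "N \<in> carrier_mat n r"
    and NM: "\<And>j. j < r \<Longrightarrow> M *\<^sub>v col N j = 0\<^sub>v 2"
    and MN: "\<And>v. v \<in> carrier_vec n \<Longrightarrow> M *\<^sub>v v = 0\<^sub>v 2 \<Longrightarrow> \<exists>c \<in> carrier_vec r. v = N *\<^sub>v c"
    using kernel_as_column_space[OF M] by metis
  have "\<exists>c\<in>carrier_vec r. col B j = N *\<^sub>v c" if j: "j < m" for j
  proof (rule MN)
    have "(transpose_mat (cmat B) *\<^sub>v w) $ j = map_vec complex_of_real (col B j) \<bullet> w"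
      using j B w by (simp add: row_transpose)
    thus "M *\<^sub>v col B j = 0\<^sub>v 2" using kernel[of "col B j"] wB B j by simp
  qed (use B in auto)
  then obtain B' where B': "B' \<in> carrier_mat r m" "B = N * B'" using factor_through_columns[OF N B] by metis
  have AN: "A * N \<in> carrier_mat n r" using A N by simp
  have "\<exists>c\<in>carrier_vec r. col (A * N) j = N *\<^sub>v c" if j: "j < r" for j
  proof (rule MN)
    let ?v = "map_vec complex_of_real (col N j)"
    have v: "?v \<in> carrier_vec n" "col N j \<in> carrier_vec n" using N j by auto
    have "map_vec complex_of_real (col (A * N) j) = cmat A *\<^sub>v ?v"
      by (simp add: col_mult2[OF A N j] of_real_hom.mult_mat_vec_hom[OF A v(2)])
    hence "map_vec complex_of_real (col (A * N) j) \<bullet> w = ?v \<bullet> (transpose_mat (cmat A) *\<^sub>v w)"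
      using transpose_vec_mult_scalar[of "transpose_mat (cmat A)" n n w ?v] A w v by simp
    also have "\<dots> = z * (?v \<bullet> w)" using w v by (simp add: wA)
    also have "\<dots> = 0" using kernel[of "col N j"] NM[OF j] v by simp
    finally show "M *\<^sub>v col (A * N) j = 0\<^sub>v 2" using kernel[of "col (A * N) j"] AN j by auto
  qed (use AN j in auto)
  then obtain A' where "A' \<in> carrier_mat r r" "A * N = N * A'" using factor_through_columns[OF N AN] by metis
  from minimal_realization_irreducible[OF min N this(1) B'(1) this(2) B'(2)] r show False by simp
qed

lemma minimal_realization_observable:
  assumes min: "minimal_realization n m A B C D" and v: "v \<in> carrier_vec n"
    and "cmat A *\<^sub>v v = z \<cdot>\<^sub>v v" and "cmat C *\<^sub>v v = 0\<^sub>v m"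
  shows "v = 0\<^sub>v n"
proof -
  have "transpose_mat (cmat (transpose_mat X)) = cmat X" for X by (intro eq_matI) auto
  thus ?thesis
    using minimal_realization_controllable[OF minimal_realization_transpose[OF min] v, of z] assms by simp
qed

text \<open>The leading Laurent coefficient of the resolvent at an eigenvalue, in polynomial form:
  \<open>P s = (s - z) ^ k * p s * inverse (s - A)\<close> where \<open>k\<close> is the order of the pole. Such a
  representation exists with \<open>P\<close> the adjugate and \<open>k\<close> the multiplicity of \<open>z\<close> in the characteristic
  polynomial. If \<open>P z\<close> were zero for the least possible \<open>k\<close>, then all entries of \<open>P\<close> would be
  divisible by \<open>s - z\<close> and a smaller \<open>k\<close> would do.\<close>

lemma leading_coefficient_of_resolvent:
  assumes A: "A \<in> carrier_mat n n" and z: "eigenvalue (cmat A) z"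
  obtains P :: "complex \<Rightarrow> complex mat" and p k where
    "\<And>s. P s \<in> carrier_mat n n" "\<And>s i j. i < n \<Longrightarrow> j < n \<Longrightarrow> isCont (\<lambda>s. P s $$ (i, j)) s"
    "poly p z \<noteq> 0" "k > 0" "P z \<noteq> 0\<^sub>m n n"
    "\<And>s. P s * pencil A s = ((s - z) ^ k * poly p s) \<cdot>\<^sub>m 1\<^sub>m n"
    "\<And>s. pencil A s * P s = ((s - z) ^ k * poly p s) \<cdot>\<^sub>m 1\<^sub>m n"
proof -
  define S where "S = char_poly_matrix (cmat A)"
  have S: "S \<in> carrier_mat n n" using A by (simp add: S_def)
  have ES: "eval_mat s S = pencil A s" for s using A by (simp add: S_def eval_char_poly_matrix)
  define Q where "Q = (\<lambda>k. \<exists>p P. poly p z \<noteq> 0 \<and> P \<in> carrier_mat n n \<and>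
    P * S = ([:-z, 1:] ^ k * p) \<cdot>\<^sub>m 1\<^sub>m n \<and> S * P = ([:-z, 1:] ^ k * p) \<cdot>\<^sub>m 1\<^sub>m n)"
  have "\<exists>k. Q k"
  proof -
    have "det S \<noteq> 0" unfolding S_def char_poly_def[symmetric]
      using degree_monic_char_poly[of "cmat A" n] A by auto
    from order_decomp[OF this, of z] obtain q where q: "det S = [:-z, 1:] ^ Polynomial.order z (det S) * q" "\<not> [:-z, 1:] dvd q"
      by blast
    hence "poly q z \<noteq> 0" by (simp add: poly_eq_0_iff_dvd)
    with q adj_mat[OF S] have "Q (Polynomial.order z (det S))" unfolding Q_def by metis
    thus ?thesis by blast
  qed
  define k where "k = (LEAST k. Q k)"
  have "Q k" using \<open>\<exists>k. Q k\<close> unfolding k_def by (rule LeastI_ex)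
  then obtain p P where p: "poly p z \<noteq> 0" and P: "P \<in> carrier_mat n n"
    and PS: "P * S = ([:-z, 1:] ^ k * p) \<cdot>\<^sub>m 1\<^sub>m n" and SP: "S * P = ([:-z, 1:] ^ k * p) \<cdot>\<^sub>m 1\<^sub>m n"
    unfolding Q_def by blast
  have ev: "eval_mat s (q \<cdot>\<^sub>m 1\<^sub>m n) = poly q s \<cdot>\<^sub>m 1\<^sub>m n" for q s by (intro eq_matI) auto
  have EPS: "eval_mat s P * pencil A s = ((s - z) ^ k * poly p s) \<cdot>\<^sub>m 1\<^sub>m n" for s
    using arg_cong[OF PS, of "eval_mat s"] by (simp add: eval_mat_mult[OF P S] ES ev)
  have ESP: "pencil A s * eval_mat s P = ((s - z) ^ k * poly p s) \<cdot>\<^sub>m 1\<^sub>m n" for s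
    using arg_cong[OF SP, of "eval_mat s"] by (simp add: eval_mat_mult[OF S P] ES ev)
  obtain v where v: "v \<in> carrier_vec n" "v \<noteq> 0\<^sub>v n" "pencil A z *\<^sub>v v = 0\<^sub>v n"
    using z det_0_iff_vec_prod_zero[OF pencil_carrier[OF A], of z] by (auto simp: eigenvalue_iff_det_pencil[OF A])
  have "k > 0"
  proof (rule ccontr)
    assume "\<not> k > 0"
    hence "(eval_mat z P * pencil A z) *\<^sub>v v = poly p z \<cdot>\<^sub>v v" using v by (auto simp: EPS)
    moreover have "(eval_mat z P * pencil A z) *\<^sub>v v = eval_mat z P *\<^sub>v (pencil A z *\<^sub>v v)"
      using P A v by (intro assoc_mult_mat_vec[of _ n n _ n]) auto
    moreover have "eval_mat z P *\<^sub>v 0\<^sub>v n = 0\<^sub>v n" using P by (intro eq_vecI) auto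
    ultimately have "poly p z \<cdot>\<^sub>v v = 0\<^sub>v n" using v by simp
    hence "v $ i = 0" if "i < n" for i using that p v by (auto simp: vec_eq_iff)
    hence "v = 0\<^sub>v n" using v by (intro eq_vecI) auto
    thus False using v by simp
  qed
  have "eval_mat z P \<noteq> 0\<^sub>m n n"
  proof
    assume 0: "eval_mat z P = 0\<^sub>m n n"
    have "\<exists>q. P $$ (i, j) = [:-z, 1:] * q" if ij: "i < n" "j < n" for i j
    proof -
      have "poly (P $$ (i, j)) z = eval_mat z P $$ (i, j)" using P ij by simp
      hence "poly (P $$ (i, j)) z = 0" using 0 ij by simp
      thus ?thesis by (simp add: poly_eq_0_iff_dvd dvd_def)
    qed
    then obtain q where q: "\<And>i j. i < n \<Longrightarrow> j < n \<Longrightarrow> P $$ (i, j) = [:-z, 1:] * q i j" by metis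
    define P' where "P' = mat n n (\<lambda>(i, j). q i j)"
    have P': "P' \<in> carrier_mat n n" by (simp add: P'_def)
    have PP: "P = [:-z, 1:] \<cdot>\<^sub>m P'" using P q by (intro eq_matI) (auto simp: P'_def)
    have cancel: "X = Y" if "[:-z, 1:] \<cdot>\<^sub>m X = [:-z, 1:] \<cdot>\<^sub>m Y" "X \<in> carrier_mat n n" "Y \<in> carrier_mat n n"
      for X Y :: "complex poly mat"
    proof (rule eq_matI)
      fix i j assume "i < dim_row Y" "j < dim_col Y"
      with arg_cong[OF that(1), of "\<lambda>M. M $$ (i, j)"] that(2,3) show "X $$ (i, j) = Y $$ (i, j)"
        by (simp del: mult_pCons_left)
    qed (use that in auto)
    have pow: "([:-z, 1:] ^ k * p) \<cdot>\<^sub>m 1\<^sub>m n = [:-z, 1:] \<cdot>\<^sub>m (([:-z, 1:] ^ (k - 1) * p) \<cdot>\<^sub>m 1\<^sub>m n)"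
      using \<open>k > 0\<close> by (cases k) (auto simp: mult.assoc simp del: mult_pCons_left intro!: eq_matI)
    have "P' * S = ([:-z, 1:] ^ (k - 1) * p) \<cdot>\<^sub>m 1\<^sub>m n"
    proof (rule cancel)
      show "[:-z, 1:] \<cdot>\<^sub>m (P' * S) = [:-z, 1:] \<cdot>\<^sub>m (([:-z, 1:] ^ (k - 1) * p) \<cdot>\<^sub>m 1\<^sub>m n)"
        using PS unfolding PP pow by (simp only: mult_smult_assoc_mat[OF P' S])
    qed (use P' S in auto)
    moreover have "S * P' = ([:-z, 1:] ^ (k - 1) * p) \<cdot>\<^sub>m 1\<^sub>m n"
    proof (rule cancel)
      show "[:-z, 1:] \<cdot>\<^sub>m (S * P') = [:-z, 1:] \<cdot>\<^sub>m (([:-z, 1:] ^ (k - 1) * p) \<cdot>\<^sub>m 1\<^sub>m n)"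
        using SP unfolding PP pow by (simp only: mult_smult_distrib[OF S P'])
    qed (use P' S in auto)
    ultimately have "Q (k - 1)" unfolding Q_def using p P' by blast
    hence "k \<le> k - 1" unfolding k_def by (rule Least_le)
    thus False using \<open>k > 0\<close> by simp
  qed
  show ?thesis
    by (rule that[of "\<lambda>s. eval_mat s P" p k])
      (use P p \<open>k > 0\<close> \<open>eval_mat z P \<noteq> 0\<^sub>m n n\<close> EPS ESP in \<open>auto intro!: continuous_intros\<close>)
qed

lemma mat_inv_eq_of_multiple:
  assumes A: "A \<in> carrier_mat n n" and P: "P \<in> carrier_mat n n" and "P * pencil A s = c \<cdot>\<^sub>m 1\<^sub>m n"
    and s: "\<not> eigenvalue (cmat A) s"
  shows "P = c \<cdot>\<^sub>m mat_inv (pencil A s)"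
proof -
  define R where "R = mat_inv (pencil A s)"
  have R: "R \<in> carrier_mat n n" "pencil A s * R = 1\<^sub>m n"
    using mat_inv_inverse[OF pencil_carrier[OF A], of s] s by (auto simp: eigenvalue_iff_det_pencil[OF A] R_def)
  have "P = P * (pencil A s * R)" using P by (simp add: R(2))
  also have "\<dots> = P * pencil A s * R" using A P R(1) by (simp add: assoc_mult_mat[of _ n n _ n _ n])
  also have "\<dots> = c \<cdot>\<^sub>m R" unfolding assms(3) using R(1) by (simp add: mult_smult_assoc_mat[of _ n n _ n])
  finally show ?thesis by (simp add: R_def)
qed

text \<open>Let \<open>P z\<close> be the leading coefficient of the resolvent at \<open>z\<close>. If no entry of the transfer
  function has a pole at \<open>z\<close>, then \<open>C * P z * B = 0\<close>. The columns of \<open>P z * B\<close> are eigenvectors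
  of \<open>A\<close> for \<open>z\<close>, so they vanish by observability. The rows of \<open>P z\<close> are left eigenvectors, so
  they vanish by controllability, in contradiction to \<open>P z \<noteq> 0\<close>.\<close>

lemma minimal_realization_eigenvalue_is_pole:
  assumes min: "minimal_realization n m A B C D" and z: "eigenvalue (cmat A) z"
  shows "tf_pole m (transfer_function A B C D) z"
proof (rule ccontr)
  assume np: "\<not> tf_pole m (transfer_function A B C D) z"
  have A: "A \<in> carrier_mat n n" and B: "B \<in> carrier_mat n m" and C: "C \<in> carrier_mat m n"
    and D: "D \<in> carrier_mat m m"
    using min by (auto simp: minimal_realization_def realization_def)
  obtain P p k where P: "\<And>s. P s \<in> carrier_mat n n"
    and cont: "\<And>s i j. i < n \<Longrightarrow> j < n \<Longrightarrow> isCont (\<lambda>s. P s $$ (i, j)) s"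
    and p: "poly p z \<noteq> 0" and k: "k > 0" and Pz: "P z \<noteq> 0\<^sub>m n n"
    and PS: "\<And>s. P s * pencil A s = ((s - z) ^ k * poly p s) \<cdot>\<^sub>m 1\<^sub>m n"
    and SP: "\<And>s. pencil A s * P s = ((s - z) ^ k * poly p s) \<cdot>\<^sub>m 1\<^sub>m n"
    using leading_coefficient_of_resolvent[OF A z] by metis
  have "cmat C * P z * cmat B = 0\<^sub>m m m"
  proof (rule eq_matI)
    fix i j assume "i < dim_row (0\<^sub>m m m :: complex mat)" "j < dim_col (0\<^sub>m m m :: complex mat)"
    hence ij: "i < m" "j < m" by auto
    define N where "N = (\<lambda>s. (cmat C * P s * cmat B) $$ (i, j))"
    define h where "h = (\<lambda>s. (s - z) ^ k * poly p s)"
    have Nsum: "N = (\<lambda>s. \<Sum>b<n. (\<Sum>a<n. cmat C $$ (i, a) * P s $$ (a, b)) * cmat B $$ (b, j))"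
    proof
      fix s show "N s = (\<Sum>b<n. (\<Sum>a<n. cmat C $$ (i, a) * P s $$ (a, b)) * cmat B $$ (b, j))"
        using A B C P[of s] ij unfolding N_def
        by (auto simp: scalar_prod_def lessThan_atLeast0 intro!: sum.cong simp del: assoc_mult_mat)
    qed
    have contN: "isCont N z" unfolding Nsum by (intro continuous_intros cont) auto
    have "N z = 0"
    proof (rule ccontr)
      assume "N z \<noteq> 0"
      have "is_pole (\<lambda>s. (N s + complex_of_real (D $$ (i, j)) * h s) / h s) z"
      proof (rule is_pole_divide)
        show "isCont (\<lambda>s. N s + complex_of_real (D $$ (i, j)) * h s) z"
          unfolding h_def by (intro continuous_intros contN)
        show "N z + complex_of_real (D $$ (i, j)) * h z \<noteq> 0" using \<open>N z \<noteq> 0\<close> by (simp add: h_def zero_power[OF k])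
        have "isCont h z" unfolding h_def by (intro continuous_intros)
        hence "h \<midarrow>z\<rightarrow> 0" by (simp add: isCont_def h_def zero_power[OF k])
        moreover have "\<forall>\<^sub>F s in at z. h s \<noteq> 0"
        proof -
          have "isCont (poly p) z" by (intro continuous_intros)
          hence "\<forall>\<^sub>F s in at z. poly p s \<noteq> 0" using p tendsto_imp_eventually_ne unfolding isCont_def by blast
          moreover have "\<forall>\<^sub>F s in at z. s \<noteq> z" by (simp add: eventually_at_filter)
          ultimately show ?thesis by eventually_elim (simp add: h_def)
        qed
        ultimately show "filterlim h (at 0) (at z)" by (simp add: filterlim_at)
      qed
      note pole = this
      have ev: "\<forall>\<^sub>F s in at z. (N s + complex_of_real (D $$ (i, j)) * h s) / h s
        = transfer_function A B C D s $$ (i, j)"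
      proof -
        have "isCont (poly p) z" by (intro continuous_intros)
        hence "\<forall>\<^sub>F s in at z. poly p s \<noteq> 0" using p tendsto_imp_eventually_ne unfolding isCont_def by blast
        moreover have "\<forall>\<^sub>F s in at z. s \<noteq> z" by (simp add: eventually_at_filter)
        moreover have "\<forall>\<^sub>F s in at z. \<not> eigenvalue (cmat A) s"
          by (rule eventually_cofinite_at[OF eventually_not_eigenvalue[OF A]])
        ultimately show ?thesis
        proof eventually_elim
          case (elim s)
          define R where "R = mat_inv (pencil A s)"
          have R: "R \<in> carrier_mat n n"
            using mat_inv_inverse[OF pencil_carrier[OF A], of s] elim by (auto simp: eigenvalue_iff_det_pencil[OF A] R_def)
          have "P s = h s \<cdot>\<^sub>m R"
            unfolding h_def R_def by (rule mat_inv_eq_of_multiple[OF A P PS]) (rule elim)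
          hence "cmat C * P s * cmat B = h s \<cdot>\<^sub>m (cmat C * R * cmat B)"
            using mult_smult_mult_mat[of "cmat C" m n R n "cmat B" m] C B R by (simp del: assoc_mult_mat)
          hence "N s = (h s \<cdot>\<^sub>m (cmat C * R * cmat B)) $$ (i, j)" by (simp only: N_def)
          hence "N s = h s * (cmat C * R * cmat B) $$ (i, j)" using C B R ij by simp
          moreover have "h s \<noteq> 0" using elim by (simp add: h_def)
          ultimately show ?case using C B R D ij
            by (simp add: transfer_function_pencil R_def[symmetric] add_divide_distrib)
        qed
      qed
      have "is_pole (\<lambda>s. transfer_function A B C D s $$ (i, j)) z"
        by (rule iffD1[OF is_pole_cong[OF ev refl] pole])
      thus False using np ij by (auto simp: tf_pole_def)
    qed
    thus "(cmat C * P z * cmat B) $$ (i, j) = 0\<^sub>m m m $$ (i, j)" using ij by (simp add: N_def)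
  qed (use B C P in auto)
  hence CPB: "cmat C * (P z * cmat B) = 0\<^sub>m m m" using B C P[of z] by (simp add: assoc_mult_mat[of _ m n _ n _ m])
  have SP0: "pencil A z * P z = 0\<^sub>m n n" "P z * pencil A z = 0\<^sub>m n n" using SP[of z] PS[of z] k by auto
  have eig: "cmat A *\<^sub>v v = z \<cdot>\<^sub>v v" if "v \<in> carrier_vec n" "pencil A z *\<^sub>v v = 0\<^sub>v n" for v
    using that A pencil_mult_vec[OF A that(1), of z]
      minus_vec_eq_zero_iff[of "z \<cdot>\<^sub>v v" n "cmat A *\<^sub>v v"] by simp
  have PB: "P z * cmat B = 0\<^sub>m n m"
  proof (rule mat_col_eqI)
    fix j assume "j < dim_col (0\<^sub>m n m :: complex mat)"
    hence j: "j < m" by simp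
    let ?v = "P z *\<^sub>v col (cmat B) j"
    have Bj: "col (cmat B) j \<in> carrier_vec n" using B j by auto
    have v: "?v \<in> carrier_vec n" using P[of z] Bj by simp
    have c: "?v = col (P z * cmat B) j" using col_mult2[OF P, of "cmat B" m j z] B j by simp
    have "pencil A z *\<^sub>v ?v = (pencil A z * P z) *\<^sub>v col (cmat B) j"
      using A P[of z] Bj by (simp add: assoc_mult_mat_vec[of _ n n _ n])
    also have "\<dots> = 0\<^sub>v n" unfolding SP0 using Bj by simp
    finally have "cmat A *\<^sub>v ?v = z \<cdot>\<^sub>v ?v" by (rule eig[OF v])
    moreover have "cmat C *\<^sub>v ?v = col (cmat C * (P z * cmat B)) j"
      unfolding c using col_mult2[of "cmat C" m n "P z * cmat B" m j] C B P[of z] j by simp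
    hence "cmat C *\<^sub>v ?v = 0\<^sub>v m" unfolding CPB using j by simp
    ultimately have "?v = 0\<^sub>v n" by (rule minimal_realization_observable[OF min v])
    thus "col (P z * cmat B) j = col (0\<^sub>m n m) j" using c j by simp
  qed (use B P in auto)
  have "P z = 0\<^sub>m n n"
  proof (rule eq_rowI)
    fix i assume "i < dim_row (0\<^sub>m n n :: complex mat)"
    hence i: "i < n" by simp
    let ?w = "transpose_mat (P z) *\<^sub>v unit_vec n i"
    have w: "?w \<in> carrier_vec n" using P[of z] by simp
    have r: "?w = row (P z) i" using P[of z] i by (intro eq_vecI) auto
    have "transpose_mat (pencil A z) *\<^sub>v ?w = transpose_mat (P z * pencil A z) *\<^sub>v unit_vec n i"
      using A P[of z] by (simp add: transpose_mult[of _ n n _ n] assoc_mult_mat_vec[of _ n n _ n])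
    hence "transpose_mat (pencil A z) *\<^sub>v ?w = 0\<^sub>v n" unfolding SP0 by simp
    moreover have "transpose_mat (pencil A z) *\<^sub>v ?w = z \<cdot>\<^sub>v ?w - transpose_mat (cmat A) *\<^sub>v ?w"
    proof -
      have "transpose_mat (cmat A) = cmat (transpose_mat A)" by (intro eq_matI) auto
      thus ?thesis using A w pencil_mult_vec[of "transpose_mat A" n ?w z] by (simp add: transpose_pencil)
    qed
    ultimately have "transpose_mat (cmat A) *\<^sub>v ?w = z \<cdot>\<^sub>v ?w"
      using A w minus_vec_eq_zero_iff[of "z \<cdot>\<^sub>v ?w" n "transpose_mat (cmat A) *\<^sub>v ?w"] by simp
    moreover have "transpose_mat (cmat B) *\<^sub>v ?w = transpose_mat (P z * cmat B) *\<^sub>v unit_vec n i"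
      using B P[of z] by (simp add: transpose_mult[of _ n n _ m] assoc_mult_mat_vec[of _ m n _ n])
    hence "transpose_mat (cmat B) *\<^sub>v ?w = 0\<^sub>v m" unfolding PB by simp
    ultimately have "?w = 0\<^sub>v n" by (rule minimal_realization_controllable[OF min w])
    thus "row (P z) i = row (0\<^sub>m n n) i" using r i by simp
  qed (use P[of z] in auto)
  thus False using Pz by simp
qed

section \<open>Functions with nonnegative real part on the right half-plane\<close>

lemma open_right_halfplane: "open {s::complex. Re s > 0}"
  by (rule open_halfspace_Re_gt)

lemma right_halfplane_limit_point:
  assumes "Re w = 0" shows "at w within {s. Re s > 0} \<noteq> bot"
proof -
  have "w islimpt {s. Re s > 0}"
    unfolding islimpt_approachable
  proof (intro allI impI)
    fix e :: real assume "e > 0"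
    thus "\<exists>x\<in>{s. Re s > 0}. x \<noteq> w \<and> dist x w < e"
      using assms by (intro bexI[of _ "w + of_real (e / 2)"]) (auto simp: dist_norm)
  qed
  thus ?thesis by (simp add: trivial_limit_within)
qed

text \<open>The modulus of \<open>exp (- f)\<close> is \<open>exp (- Re f)\<close>, so this is the maximum modulus principle for
  \<open>exp (- f)\<close>.\<close>

lemma Re_minimum_imp_constant:
  assumes f: "f holomorphic_on S" and "open S" "connected S" "\<xi> \<in> S" "s \<in> S"
    and min: "\<And>z. z \<in> S \<Longrightarrow> Re (f \<xi>) \<le> Re (f z)"
  shows "Re (f s) = Re (f \<xi>)"
proof -
  have "(\<lambda>z. exp (- f z)) constant_on S"
  proof (rule maximum_modulus_principle[where U = S and \<xi> = \<xi>])
    show "(\<lambda>z. exp (- f z)) holomorphic_on S" using f by (intro holomorphic_intros)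
  qed (use assms in auto)
  then obtain c where "\<And>z. z \<in> S \<Longrightarrow> exp (- f z) = c" unfolding constant_on_def by blast
  hence "norm (exp (- f s)) = norm (exp (- f \<xi>))" using assms by simp
  thus ?thesis by simp
qed

text \<open>If \<open>Re (f s0) = c < 0\<close>, then the boundary conditions keep the set where \<open>Re f \<le> c\<close> away from
  the axis and from infinity. It is compact, \<open>Re f\<close> attains its minimum there, and hence \<open>Re f\<close> is
  a negative constant, which the condition at the boundary point \<open>0\<close> excludes.\<close>

lemma Re_nonneg_from_boundary:
  assumes f: "f holomorphic_on {s. Re s > 0}"
    and bdry: "\<And>w \<epsilon>. Re w = 0 \<Longrightarrow> \<epsilon> > 0 \<Longrightarrow> \<forall>\<^sub>F s in at w within {s. Re s > 0}. Re (f s) > - \<epsilon>"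
    and inf: "\<And>\<epsilon>. \<epsilon> > 0 \<Longrightarrow> \<forall>\<^sub>F s in at_infinity. Re s > 0 \<longrightarrow> Re (f s) > - \<epsilon>"
    and s0: "Re s0 > 0"
  shows "Re (f s0) \<ge> 0"
proof (rule ccontr)
  assume neg: "\<not> Re (f s0) \<ge> 0"
  define H where "H = {s::complex. Re s > 0}"
  have H: "open H" "connected H" unfolding H_def
    by (rule open_right_halfplane, rule convex_connected[OF convex_halfspace_Re_gt])
  define c where "c = Re (f s0)"
  have c: "- c > 0" using neg by (simp add: c_def)
  define K where "K = {s \<in> H. Re (f s) \<le> c}"
  have contf: "isCont f s" if "s \<in> H" for s
    using f that H unfolding H_def
    by (metis continuous_on_eq_continuous_at holomorphic_on_imp_continuous_on open_right_halfplane)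
  have "closed K"
    unfolding closed_sequential_limits
  proof (intro allI impI, elim conjE)
    fix x l assume x: "\<forall>n. x n \<in> K" and xl: "x \<longlonglongrightarrow> l"
    have "(\<lambda>n. Re (x n)) \<longlonglongrightarrow> Re l" by (intro tendsto_intros xl)
    hence "Re l \<ge> 0" by (rule LIMSEQ_le_const) (use x in \<open>auto simp: K_def H_def intro: less_imp_le\<close>)
    show "l \<in> K"
    proof (cases "Re l = 0")
      case True
      have "x n \<noteq> l" for n
        using x[rule_format, of n] True unfolding K_def H_def by (metis (no_types, lifting) mem_Collect_eq less_irrefl)
      hence "filterlim x (at l within H) sequentially"
        using xl x unfolding filterlim_at K_def by (intro conjI always_eventually allI) simp_all
      hence "\<forall>\<^sub>F n in sequentially. Re (f (x n)) > - (- c)"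
        using bdry[OF True c, folded H_def] by (auto simp: filterlim_iff)
      then obtain n where "Re (f (x n)) > c" using eventually_happens by force
      thus ?thesis using x[rule_format, of n] by (auto simp: K_def)
    next
      case False
      hence l: "l \<in> H" using \<open>Re l \<ge> 0\<close> by (simp add: H_def)
      have "(\<lambda>n. Re (f (x n))) \<longlonglongrightarrow> Re (f l)"
        by (intro tendsto_intros isCont_tendsto_compose[OF contf[OF l]] xl)
      hence "Re (f l) \<le> c" by (rule LIMSEQ_le_const2) (use x in \<open>auto simp: K_def\<close>)
      thus ?thesis using l by (simp add: K_def)
    qed
  qed
  moreover have "bounded K"
  proof -
    obtain b where "\<And>s. norm s \<ge> b \<Longrightarrow> Re s > 0 \<longrightarrow> Re (f s) > - (- c)"
      using inf[OF c] by (auto simp: eventually_at_infinity)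
    hence "norm s \<le> b" if "s \<in> K" for s using that by (force simp: K_def H_def)
    thus ?thesis by (auto simp: bounded_iff)
  qed
  ultimately have "compact K" by (simp add: compact_eq_bounded_closed)
  moreover have "K \<noteq> {}" using s0 by (auto simp: K_def H_def c_def)
  moreover have "continuous_on K (\<lambda>s. Re (f s))"
    using contf by (intro continuous_at_imp_continuous_on) (auto simp: K_def intro!: continuous_intros)
  ultimately have "\<exists>\<xi>\<in>K. \<forall>s\<in>K. Re (f \<xi>) \<le> Re (f s)"
    by (rule continuous_attains_inf)
  then obtain \<xi> where \<xi>: "\<xi> \<in> K" "\<And>s. s \<in> K \<Longrightarrow> Re (f \<xi>) \<le> Re (f s)" by blast
  have min: "Re (f \<xi>) \<le> Re (f s)" if "s \<in> H" for s
    using \<xi> that by (cases "s \<in> K") (auto simp: K_def)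
  have const: "Re (f s) = Re (f \<xi>)" if "s \<in> H" for s
    using Re_minimum_imp_constant[of f H \<xi> s] f H \<xi> min that by (auto simp: K_def H_def)
  have "\<forall>\<^sub>F s in at 0 within H. s \<in> H" by (simp add: eventually_at_filter)
  moreover have "\<forall>\<^sub>F s in at 0 within H. Re (f s) > - (- c)"
    using bdry[of 0, OF _ c] by (simp add: H_def)
  ultimately have "\<forall>\<^sub>F s in at 0 within H. False"
    by eventually_elim (use const \<xi> in \<open>auto simp: K_def\<close>)
  thus False using right_halfplane_limit_point[of 0] by (simp add: H_def trivial_limit_def)
qed

text \<open>The polar part \<open>r / (s - w)\<close> has nonnegative real part on the half-plane and is purely imaginary
  on the axis. So the remaining analytic part inherits \<open>Re \<ge> 0\<close> from the axis at \<open>w\<close>, and near \<open>w\<close>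
  the real part of \<open>f\<close> is bounded below by that of the analytic part. The regular case is
  \<open>r = 0\<close>. Data on one side of \<open>w\<close> suffice, which allows \<open>w = 0\<close>.\<close>

lemma Re_liminf_nonneg_at_axis_point:
  assumes w: "Re w = 0" and sing: "isolated_singularity_at f w"
    and lim: "((\<lambda>s. (s - w) * f s) \<longlongrightarrow> of_real r) (at w)" and r: "r \<ge> 0"
    and axis: "\<forall>\<^sub>F t in at_right (Im w). Re (f (\<i> * of_real t)) \<ge> 0" and \<epsilon>: "\<epsilon> > 0"
  shows "\<forall>\<^sub>F s in at w within {s. Re s > 0}. Re (f s) > - \<epsilon>"
proof -
  obtain d where d: "d > 0" "f analytic_on ball w d - {w}"
    using sing by (auto simp: isolated_singularity_at_def)
  define g where "g = (\<lambda>y. if y = w then of_real r else (y - w) * f y)"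
  have "g holomorphic_on ball w d" unfolding g_def
  proof (rule removable_singularity)
    show "(\<lambda>y. (y - w) * f y) holomorphic_on ball w d - {w}"
      using analytic_imp_holomorphic[OF d(2)] by (intro holomorphic_intros)
  qed (use lim in auto)
  hence "(g has_field_derivative deriv g w) (at w)"
    using d by (intro holomorphic_derivI[of g "ball w d"]) auto
  hence "((\<lambda>s. (g s - g w) / (s - w)) \<longlongrightarrow> deriv g w) (at w)"
    by (simp add: has_field_derivative_iff)
  moreover have "\<forall>\<^sub>F s in at w. (g s - g w) / (s - w) = f s - of_real r / (s - w)"
    by (auto simp: eventually_at_filter g_def diff_divide_distrib)
  ultimately have h: "((\<lambda>s. f s - of_real r / (s - w)) \<longlongrightarrow> deriv g w) (at w)"
    by (rule Lim_transform_eventually)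
  have "filterlim (\<lambda>t. \<i> * of_real t) (at w) (at_right (Im w))"
  proof -
    have "((\<lambda>t. \<i> * of_real t) \<longlongrightarrow> \<i> * of_real (Im w)) (at_right (Im w))" by (intro tendsto_intros)
    moreover have "\<i> * of_real (Im w) = w" using w by (simp add: complex_eq_iff)
    moreover have "\<forall>\<^sub>F t in at_right (Im w). \<i> * of_real t \<noteq> w"
      by (auto simp: eventually_at_filter complex_eq_iff)
    ultimately show ?thesis by (simp add: filterlim_at)
  qed
  from filterlim_compose[OF h this]
  have "((\<lambda>t. Re (f (\<i> * of_real t) - of_real r / (\<i> * of_real t - w))) \<longlongrightarrow> Re (deriv g w)) (at_right (Im w))"
    by (intro tendsto_intros)
  moreover have "\<forall>\<^sub>F t in at_right (Im w). Re (f (\<i> * of_real t) - of_real r / (\<i> * of_real t - w)) \<ge> 0"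
    using axis by eventually_elim (use w in \<open>simp add: Re_divide\<close>)
  ultimately have L: "Re (deriv g w) \<ge> 0" by (rule tendsto_lowerbound) simp
  have "((\<lambda>s. Re (f s - of_real r / (s - w))) \<longlongrightarrow> Re (deriv g w)) (at w within {s. Re s > 0})"
    by (intro tendsto_Re tendsto_within_subset[OF h]) auto
  hence "\<forall>\<^sub>F s in at w within {s. Re s > 0}. Re (f s - of_real r / (s - w)) > - \<epsilon>"
    by (rule order_tendstoD) (use L \<epsilon> in simp)
  moreover have "\<forall>\<^sub>F s in at w within {s. Re s > 0}. Re s > 0" by (simp add: eventually_at_filter)
  ultimately show ?thesis
  proof eventually_elim
    case (elim s)
    have "Re (of_real r / (s - w)) \<ge> 0" using elim w r by (simp add: Re_divide)
    thus ?case using elim by simp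
  qed
qed

lemma finite_imp_eventually_not:
  assumes "finite {t::real. t > 0 \<and> P t}" and "x \<ge> 0"
  shows "\<forall>\<^sub>F t in at_right x. \<not> P t" "\<forall>\<^sub>F t in at_top. \<not> P t"
proof -
  let ?S = "{t::real. t > 0 \<and> P t}"
  have "open (- (?S - {x}))" using assms(1) by (intro open_Compl finite_imp_closed) simp
  hence "\<forall>\<^sub>F t in nhds x. t \<in> - (?S - {x})" by (intro eventually_nhds_in_open) auto
  thus "\<forall>\<^sub>F t in at_right x. \<not> P t"
    unfolding eventually_at_filter by eventually_elim (use \<open>x \<ge> 0\<close> in auto)
  obtain b where "\<And>t. t \<in> ?S \<Longrightarrow> t \<le> b" using assms(1) bdd_above_finite[of ?S] by (auto simp: bdd_above_def)
  hence "\<not> P t" if "t > max b 0" for t using that by force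
  thus "\<forall>\<^sub>F t in at_top. \<not> P t" by (meson eventually_at_top_dense)
qed

text \<open>The function \<open>g\<close> is the mirror image of \<open>f\<close> in the real axis. It transports the behaviour of \<open>f\<close>
  at the lower half of the imaginary axis to the upper half, where negative imaginary systems are
  defined. Finitely many exceptions on the axis leave room for the points where the value of a
  transfer function is unspecified.\<close>

lemma Re_nonneg_from_imaginary_axis:
  assumes f: "f holomorphic_on {s. Re s > 0}"
    and mirror: "\<And>s. Re s > 0 \<Longrightarrow> g (cnj s) = cnj (f s)"
    and sing: "\<And>h w. h \<in> {f, g} \<Longrightarrow> isolated_singularity_at h w"
    and res: "\<And>h w. h \<in> {f, g} \<Longrightarrow> Re w = 0 \<Longrightarrow> Im w \<ge> 0 \<Longrightarrow>
      \<exists>r\<ge>0. ((\<lambda>s. (s - w) * h s) \<longlongrightarrow> of_real r) (at w)"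
    and axis: "\<And>h. h \<in> {f, g} \<Longrightarrow> finite {t. t > 0 \<and> Re (h (\<i> * of_real t)) < 0}"
    and lim: "(f \<longlongrightarrow> L) at_infinity"
    and s0: "Re s0 > 0"
  shows "Re (f s0) \<ge> 0"
proof (rule Re_nonneg_from_boundary[OF f _ _ s0])
  have upper: "\<forall>\<^sub>F s in at w within {s. Re s > 0}. Re (h s) > - \<epsilon>"
    if h: "h \<in> {f, g}" "Re w = 0" "Im w \<ge> 0" "\<epsilon> > 0" for h w \<epsilon>
  proof -
    obtain r where r: "r \<ge> 0" "((\<lambda>s. (s - w) * h s) \<longlongrightarrow> of_real r) (at w)"
      using res[OF h(1-3)] by blast
    have "\<forall>\<^sub>F t in at_right (Im w). Re (h (\<i> * of_real t)) \<ge> 0"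
      using finite_imp_eventually_not(1)[OF axis[OF h(1)] h(3)] by (simp add: not_less)
    from Re_liminf_nonneg_at_axis_point[OF h(2) sing[OF h(1)] r(2,1) this h(4)]
    show ?thesis .
  qed
  fix w :: complex and \<epsilon> :: real assume w: "Re w = 0" and \<epsilon>: "\<epsilon> > 0"
  show "\<forall>\<^sub>F s in at w within {s. Re s > 0}. Re (f s) > - \<epsilon>"
  proof (cases "Im w \<ge> 0")
    case True
    thus ?thesis using upper w \<epsilon> by simp
  next
    case False
    have "\<forall>\<^sub>F s in at (cnj w) within {s. Re s > 0}. Re (g s) > - \<epsilon>"
      using upper[of g "cnj w" \<epsilon>] False w \<epsilon> by simp
    then obtain d where d: "d > 0"
      "\<And>s. Re s > 0 \<Longrightarrow> s \<noteq> cnj w \<Longrightarrow> dist s (cnj w) < d \<Longrightarrow> Re (g s) > - \<epsilon>"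
      by (auto simp: eventually_at)
    have "Re (f s) > - \<epsilon>" if "Re s > 0" "s \<noteq> w" "dist s w < d" for s
    proof -
      have "dist (cnj s) (cnj w) = dist s w"
        by (metis complex_cnj_diff complex_mod_cnj dist_norm)
      thus ?thesis using d(2)[of "cnj s"] that mirror[of s] by simp
    qed
    thus ?thesis using d(1) by (auto simp: eventually_at)
  qed
next
  fix \<epsilon> :: real assume \<epsilon>: "\<epsilon> > 0"
  have "filterlim (\<lambda>t::real. \<i> * of_real t) at_infinity at_top"
  proof -
    have "(\<lambda>t::real. norm (\<i> * of_real t)) = abs" by (auto simp: norm_mult)
    thus ?thesis unfolding filterlim_at_infinity_conv_norm_at_top by (simp only: filterlim_abs_real)
  qed
  from filterlim_compose[OF lim this]
  have "((\<lambda>t. Re (f (\<i> * of_real t))) \<longlongrightarrow> Re L) at_top" by (intro tendsto_Re)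
  moreover have "\<forall>\<^sub>F t in at_top. Re (f (\<i> * of_real t)) \<ge> 0"
    using finite_imp_eventually_not(2)[OF axis, of f 0] by (simp add: not_less)
  ultimately have "Re L \<ge> 0" by (rule tendsto_lowerbound) simp
  moreover have "((\<lambda>s. Re (f s)) \<longlongrightarrow> Re L) at_infinity" by (intro tendsto_Re lim)
  ultimately have "\<forall>\<^sub>F s in at_infinity. Re (f s) > - \<epsilon>"
    using \<epsilon> by (intro order_tendstoD[of _ "Re L"]) auto
  thus "\<forall>\<^sub>F s in at_infinity. Re s > 0 \<longrightarrow> Re (f s) > - \<epsilon>" by eventually_elim simp
qed

section \<open>Behaviour of resolvents at infinity\<close>

text \<open>If \<open>R s\<close> is the resolvent, then \<open>s R(s) = 1 + M R(s)\<close>. This forces \<open>R s\<close> to tend to \<open>0\<close>, and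
  then the same identity shows that \<open>s R(s)\<close> tends to the identity matrix. The matrix is complex
  because the lemma also serves in \<open>input_state_approximation\<close>.\<close>

lemma resolvent_at_infinity:
  fixes M :: "complex mat"
  assumes M: "M \<in> carrier_mat n n"
  shows "\<forall>\<^sub>F s in at_infinity. det (s \<cdot>\<^sub>m 1\<^sub>m n - M) \<noteq> 0"
    and "\<And>i j. i < n \<Longrightarrow> j < n \<Longrightarrow>
      ((\<lambda>s. s * mat_inv (s \<cdot>\<^sub>m 1\<^sub>m n - M) $$ (i, j)) \<longlongrightarrow> (if i = j then 1 else 0)) at_infinity"
proof -
  have "finite {s. det (s \<cdot>\<^sub>m 1\<^sub>m n - M) = 0}"
  proof -
    have "det (s \<cdot>\<^sub>m 1\<^sub>m n - M) = poly (char_poly M) s" for s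
      unfolding char_poly_def
      by (rule poly_det_cong[symmetric, of _ n]) (use M in \<open>auto simp: char_poly_matrix_def\<close>)
    moreover have "char_poly M \<noteq> 0" using degree_monic_char_poly[OF M] by auto
    ultimately show ?thesis by (simp add: poly_roots_finite)
  qed
  hence "bounded {s. det (s \<cdot>\<^sub>m 1\<^sub>m n - M) = 0}" by (rule finite_imp_bounded)
  then obtain b where "\<And>s. det (s \<cdot>\<^sub>m 1\<^sub>m n - M) = 0 \<Longrightarrow> norm s \<le> b" by (auto simp: bounded_iff)
  hence "\<And>s. norm s \<ge> b + 1 \<Longrightarrow> det (s \<cdot>\<^sub>m 1\<^sub>m n - M) \<noteq> 0" by force
  thus ev: "\<forall>\<^sub>F s in at_infinity. det (s \<cdot>\<^sub>m 1\<^sub>m n - M) \<noteq> 0"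
    unfolding eventually_at_infinity by blast
  define R where "R = (\<lambda>s. mat_inv (s \<cdot>\<^sub>m 1\<^sub>m n - M))"
  have eq: "s * R s $$ (i, j) = (if i = j then 1 else 0) + (\<Sum>k<n. M $$ (i, k) * R s $$ (k, j))"
    if s: "det (s \<cdot>\<^sub>m 1\<^sub>m n - M) \<noteq> 0" and ij: "i < n" "j < n" for s i j
  proof -
    have "s \<cdot>\<^sub>m 1\<^sub>m n - M \<in> carrier_mat n n" using M by auto
    from mat_inv_inverse[OF this s]
    have R: "R s \<in> carrier_mat n n" "(s \<cdot>\<^sub>m 1\<^sub>m n - M) * R s = 1\<^sub>m n" by (auto simp: R_def)
    have "(s \<cdot>\<^sub>m 1\<^sub>m n - M) * R s = s \<cdot>\<^sub>m R s - M * R s"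
      using R(1) M by (simp add: minus_mult_distrib_mat[of _ n n] mult_smult_assoc_mat[of _ n n _ n])
    hence "(s \<cdot>\<^sub>m R s - M * R s) $$ (i, j) = 1\<^sub>m n $$ (i, j)" using R(2) by simp
    moreover have "(M * R s) $$ (i, j) = (\<Sum>k<n. M $$ (i, k) * R s $$ (k, j))"
      using M R(1) ij by (auto simp: scalar_prod_def lessThan_atLeast0 intro!: sum.cong)
    ultimately show ?thesis using R(1) M ij by (auto simp: algebra_simps split: if_splits)
  qed
  \<comment> \<open>Summing the norms of the identity \<open>eq\<close> over all entries bounds the entrywise norm \<open>a s\<close> of
    the resolvent by \<open>n\<^sup>2 / (norm s - n K)\<close>.\<close>
  define a where "a = (\<lambda>s. \<Sum>i<n. \<Sum>j<n. norm (R s $$ (i, j)))"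
  define K where "K = (\<Sum>i<n. \<Sum>k<n. norm (M $$ (i, k)))"
  have a0: "a s \<ge> 0" for s unfolding a_def by (intro sum_nonneg) auto
  have entry: "norm (R s $$ (i, j)) \<le> a s" if "i < n" "j < n" for s i j
  proof -
    have "norm (R s $$ (i, j)) \<le> (\<Sum>j<n. norm (R s $$ (i, j)))"
      by (rule member_le_sum) (use that in auto)
    also have "\<dots> \<le> a s" unfolding a_def
      by (rule member_le_sum[of i _ "\<lambda>i. \<Sum>j<n. norm (R s $$ (i, j))"]) (use that in \<open>auto intro: sum_nonneg\<close>)
    finally show ?thesis .
  qed
  have bound: "norm s * a s \<le> n * n + n * K * a s" if s: "det (s \<cdot>\<^sub>m 1\<^sub>m n - M) \<noteq> 0" for s
  proof -
    have "norm s * norm (R s $$ (i, j)) \<le> 1 + (\<Sum>k<n. norm (M $$ (i, k))) * a s" if ij: "i < n" "j < n" for i j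
    proof -
      have "norm s * norm (R s $$ (i, j)) = norm ((if i = j then 1 else 0) + (\<Sum>k<n. M $$ (i, k) * R s $$ (k, j)))"
        by (simp only: eq[OF s ij, symmetric] norm_mult)
      also have "\<dots> \<le> norm (if i = j then 1 else 0 :: complex) + norm (\<Sum>k<n. M $$ (i, k) * R s $$ (k, j))"
        by (rule norm_triangle_ineq)
      also have "norm (\<Sum>k<n. M $$ (i, k) * R s $$ (k, j)) \<le> (\<Sum>k<n. norm (M $$ (i, k)) * a s)"
        by (rule sum_norm_le) (use ij entry in \<open>auto simp: norm_mult intro!: mult_left_mono\<close>)
      finally show ?thesis by (auto simp: sum_distrib_right split: if_splits)
    qed
    hence "(\<Sum>i<n. \<Sum>j<n. norm s * norm (R s $$ (i, j))) \<le> (\<Sum>i<n. \<Sum>j<n. 1 + (\<Sum>k<n. norm (M $$ (i, k))) * a s)"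
      by (intro sum_mono) auto
    also have "\<dots> = n * n + n * K * a s"
      by (simp add: K_def sum.distrib distrib_left sum_distrib_right sum_distrib_left mult.assoc)
    finally show ?thesis by (simp add: a_def sum_distrib_left)
  qed
  have "(a \<longlongrightarrow> 0) at_infinity"
  proof (rule tendsto_sandwich[of "\<lambda>_. 0" _ _ "\<lambda>s. (real n * n) / (norm s - n * K)"])
    have "\<forall>\<^sub>F s in at_infinity. norm s > (real n * K :: real)" for n and K :: real
      unfolding eventually_at_infinity by (rule exI[of _ "n * K + 1"]) auto
    from ev this[of n K] show "\<forall>\<^sub>F s in at_infinity. a s \<le> (real n * n) / (norm s - n * K)"
    proof eventually_elim
      case (elim s)
      thus ?case using bound[of s] by (simp add: field_simps)
    qed
    have "filterlim (\<lambda>s :: complex. norm s - n * K) at_top at_infinity"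
      using filterlim_tendsto_add_at_top[OF tendsto_const[of "- (real n * K)"] filterlim_norm_at_top] by simp
    thus "((\<lambda>s :: complex. (real n * n) / (norm s - n * K)) \<longlongrightarrow> 0) at_infinity"
      by (rule real_tendsto_divide_at_top[OF tendsto_const])
  qed (use a0 in auto)
  hence R0: "((\<lambda>s. R s $$ (i, j)) \<longlongrightarrow> 0) at_infinity" if "i < n" "j < n" for i j
    by (rule Lim_null_comparison[rotated]) (use entry that in auto)
  fix i j assume ij: "i < n" "j < n"
  have "((\<lambda>s. (if i = j then 1 else 0) + (\<Sum>k<n. M $$ (i, k) * R s $$ (k, j))) \<longlongrightarrow>
      (if i = j then 1 else 0) + (\<Sum>k<n. M $$ (i, k) * 0)) at_infinity"
    by (intro tendsto_intros R0) (use ij in auto)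
  moreover have "\<forall>\<^sub>F s in at_infinity. (if i = j then 1 else 0) + (\<Sum>k<n. M $$ (i, k) * R s $$ (k, j))
      = s * mat_inv (s \<cdot>\<^sub>m 1\<^sub>m n - M) $$ (i, j)"
    using ev by eventually_elim (use eq ij in \<open>simp add: R_def\<close>)
  ultimately show "((\<lambda>s. s * mat_inv (s \<cdot>\<^sub>m 1\<^sub>m n - M) $$ (i, j)) \<longlongrightarrow> (if i = j then 1 else 0)) at_infinity"
    using Lim_transform_eventually by fastforce
qed

lemma transfer_function_entry:
  assumes R: "realization n m A B C D" and s: "\<not> eigenvalue (cmat A) s" and ik: "i < m" "k < m"
  shows "transfer_function A B C D s $$ (i, k) =
    (\<Sum>b<n. \<Sum>a<n. C $$ (i, a) * mat_inv (pencil A s) $$ (a, b) * B $$ (b, k)) + D $$ (i, k)"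
proof -
  have A: "A \<in> carrier_mat n n" and B: "B \<in> carrier_mat n m" and C: "C \<in> carrier_mat m n"
    and D: "D \<in> carrier_mat m m"
    using R by (auto simp: realization_def)
  define R where "R = mat_inv (pencil A s)"
  have I: "R \<in> carrier_mat n n"
    using mat_inv_inverse[OF pencil_carrier[OF A], of s, folded R_def] s
    by (auto simp: eigenvalue_iff_det_pencil[OF A])
  have "(cmat C * R * cmat B) $$ (i, k) = (\<Sum>b<n. \<Sum>a<n. C $$ (i, a) * R $$ (a, b) * B $$ (b, k))"
    using A B C I ik
    by (auto simp: scalar_prod_def lessThan_atLeast0 sum_distrib_right intro!: sum.cong simp del: assoc_mult_mat)
  moreover have "cmat C * R * cmat B \<in> carrier_mat m m" using B C I by (auto simp del: assoc_mult_mat)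
  ultimately show ?thesis using D ik
    by (simp add: transfer_function_pencil R_def[symmetric] del: assoc_mult_mat)
qed

lemma eventually_not_eigenvalue_at_infinity:
  assumes "A \<in> carrier_mat n n"
  shows "\<forall>\<^sub>F s in at_infinity. \<not> eigenvalue (cmat A) s"
proof -
  have "cmat A \<in> carrier_mat n n" using assms by simp
  from resolvent_at_infinity(1)[OF this] show ?thesis
    by eventually_elim (use assms in \<open>auto simp: eigenvalue_iff_det_pencil[OF assms] pencil_def\<close>)
qed

lemma transfer_function_at_infinity:
  assumes R: "realization n m A B C D" and ik: "i < m" "k < m"
  shows "((\<lambda>s. s * (transfer_function A B C D s $$ (i, k) - D $$ (i, k))) \<longlongrightarrow> of_real ((C * B) $$ (i, k))) at_infinity"
    and "((\<lambda>s. transfer_function A B C D s $$ (i, k)) \<longlongrightarrow> of_real (D $$ (i, k))) at_infinity"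
proof -
  have A: "A \<in> carrier_mat n n" and B: "B \<in> carrier_mat n m" and C: "C \<in> carrier_mat m n"
    using R by (auto simp: realization_def)
  note lim = resolvent_at_infinity(2)[of "cmat A" n]
  define r where "r = (\<lambda>s a b. s * mat_inv (pencil A s) $$ (a, b))"
  have r: "((\<lambda>s. r s a b) \<longlongrightarrow> (if a = b then 1 else 0)) at_infinity" if "a < n" "b < n" for a b
    using lim[of a b] A that by (simp add: r_def pencil_def)
  have "((\<lambda>s. \<Sum>b<n. \<Sum>a<n. C $$ (i, a) * r s a b * B $$ (b, k)) \<longlongrightarrow>
      (\<Sum>b<n. \<Sum>a<n. complex_of_real (C $$ (i, a)) * (if a = b then 1 else 0) * complex_of_real (B $$ (b, k)))) at_infinity"
    by (intro tendsto_intros r) auto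
  also have "(\<Sum>b<n. \<Sum>a<n. complex_of_real (C $$ (i, a)) * (if a = b then 1 else 0) * complex_of_real (B $$ (b, k)))
      = (\<Sum>b<n. \<Sum>a<n. if a = b then complex_of_real (C $$ (i, b) * B $$ (b, k)) else 0)"
    by (intro sum.cong) auto
  also have "\<dots> = of_real ((C * B) $$ (i, k))"
    using B C ik by (auto simp: scalar_prod_def lessThan_atLeast0 intro!: sum.cong)
  finally have lim': "((\<lambda>s. \<Sum>b<n. \<Sum>a<n. C $$ (i, a) * r s a b * B $$ (b, k)) \<longlongrightarrow> of_real ((C * B) $$ (i, k))) at_infinity" .
  have "\<forall>\<^sub>F s in at_infinity. (\<Sum>b<n. \<Sum>a<n. C $$ (i, a) * r s a b * B $$ (b, k))
      = s * (transfer_function A B C D s $$ (i, k) - D $$ (i, k))"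
    using eventually_not_eigenvalue_at_infinity[OF A]
    by eventually_elim (simp add: transfer_function_entry[OF R _ ik] r_def sum_distrib_left mult_ac)
  from Lim_transform_eventually[OF lim' this]
  show 1: "((\<lambda>s. s * (transfer_function A B C D s $$ (i, k) - D $$ (i, k))) \<longlongrightarrow> of_real ((C * B) $$ (i, k))) at_infinity" .
  have "((\<lambda>s. inverse s * (s * (transfer_function A B C D s $$ (i, k) - D $$ (i, k))) + D $$ (i, k)) \<longlongrightarrow>
      0 * of_real ((C * B) $$ (i, k)) + of_real (D $$ (i, k))) at_infinity"
    by (intro tendsto_intros 1 tendsto_inverse_0)
  moreover have "\<forall>\<^sub>F s in at_infinity. inverse s * (s * (transfer_function A B C D s $$ (i, k) - D $$ (i, k))) + D $$ (i, k)
      = transfer_function A B C D s $$ (i, k)"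
    using eventually_not_equal_at_infinity[of 0] by eventually_elim (simp add: mult.assoc[symmetric])
  ultimately show "((\<lambda>s. transfer_function A B C D s $$ (i, k)) \<longlongrightarrow> of_real (D $$ (i, k))) at_infinity"
    using Lim_transform_eventually by fastforce
qed

lemma strictly_proper_imp_zero_feedthrough:
  assumes R: "realization n m A B C D" and "strictly_proper m (transfer_function A B C D)"
  shows "D = 0\<^sub>m m m"
proof (rule eq_matI)
  fix i k assume "i < dim_row (0\<^sub>m m m :: real mat)" "k < dim_col (0\<^sub>m m m :: real mat)"
  hence ik: "i < m" "k < m" by auto
  have "((\<lambda>s. transfer_function A B C D s $$ (i, k)) \<longlongrightarrow> 0) at_infinity"
    using assms ik by (auto simp: strictly_proper_def)
  from tendsto_unique[OF trivial_limit_at_infinity transfer_function_at_infinity(2)[OF R ik] this] show "D $$ (i, k) = 0\<^sub>m m m $$ (i, k)"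
    using ik by (simp add: trivial_limit_at_infinity)
qed (use R in \<open>auto simp: realization_def\<close>)

section \<open>Quadratic forms\<close>

lemma quadratic_form_sum:
  assumes "X \<in> carrier_mat m m" "v \<in> carrier_vec m"
  shows "(X *\<^sub>v v) \<bullet>c v = (\<Sum>i<m. \<Sum>k<m. X $$ (i, k) * v $ k * cnj (v $ i))"
  using assms by (auto simp: scalar_prod_def lessThan_atLeast0 sum_distrib_right mult.assoc intro!: sum.cong)

lemma mat_adjoint_carrier: "X \<in> carrier_mat a b \<Longrightarrow> mat_adjoint X \<in> carrier_mat b a"
  by (auto simp: mat_adjoint_def)

lemma mat_adjoint_index:
  "X \<in> carrier_mat a b \<Longrightarrow> i < b \<Longrightarrow> j < a \<Longrightarrow> mat_adjoint X $$ (i, j) = conjugate (X $$ (j, i))"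
  by (auto simp: mat_adjoint_def mat_of_rows_index)

lemma quadratic_form_adjoint:
  assumes X: "X \<in> carrier_mat m m" and v: "v \<in> carrier_vec m"
  shows "(mat_adjoint X *\<^sub>v v) \<bullet>c v = cnj ((X *\<^sub>v v) \<bullet>c v)"
proof -
  have "(mat_adjoint X *\<^sub>v v) \<bullet>c v = (\<Sum>i<m. \<Sum>k<m. cnj (X $$ (k, i)) * v $ k * cnj (v $ i))"
    unfolding quadratic_form_sum[OF mat_adjoint_carrier[OF X] v]
    by (intro sum.cong) (auto simp: mat_adjoint_index[OF X])
  also have "\<dots> = (\<Sum>k<m. \<Sum>i<m. cnj (X $$ (k, i)) * v $ k * cnj (v $ i))" by (rule sum.swap)
  also have "\<dots> = cnj ((X *\<^sub>v v) \<bullet>c v)"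
    unfolding quadratic_form_sum[OF X v] by (simp add: mult_ac)
  finally show ?thesis .
qed

lemma hermitian_form_real:
  assumes "hermitian_mat m X" "v \<in> carrier_vec m"
  shows "(X *\<^sub>v v) \<bullet>c v = of_real (Re ((X *\<^sub>v v) \<bullet>c v))"
proof -
  have "(X *\<^sub>v v) \<bullet>c v = cnj ((X *\<^sub>v v) \<bullet>c v)"
    using quadratic_form_adjoint[of X m v] assms by (simp add: hermitian_mat_def)
  thus ?thesis by (simp add: complex_eq_iff)
qed

lemma Re_form_imaginary_part:
  assumes X: "X \<in> carrier_mat m m" and v: "v \<in> carrier_vec m"
  shows "Re ((\<i> \<cdot>\<^sub>m (X - mat_adjoint X) *\<^sub>v v) \<bullet>c v) = - 2 * Im ((X *\<^sub>v v) \<bullet>c v)"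
proof -
  note [simp] = mat_adjoint_carrier[OF X]
  have "(\<i> \<cdot>\<^sub>m (X - mat_adjoint X) *\<^sub>v v) \<bullet>c v
      = (\<Sum>i<m. \<Sum>k<m. (\<i> \<cdot>\<^sub>m (X - mat_adjoint X)) $$ (i, k) * v $ k * cnj (v $ i))"
    using X v by (intro quadratic_form_sum smult_carrier_mat minus_carrier_mat mat_adjoint_carrier)
  also have "\<dots> = (\<Sum>i<m. \<Sum>k<m. \<i> * (X $$ (i, k) * v $ k * cnj (v $ i) - mat_adjoint X $$ (i, k) * v $ k * cnj (v $ i)))"
    using X carrier_matD[OF mat_adjoint_carrier[OF X]] by (intro sum.cong) (auto simp: algebra_simps)
  also have "\<dots> = \<i> * ((X *\<^sub>v v) \<bullet>c v - (mat_adjoint X *\<^sub>v v) \<bullet>c v)"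
    unfolding quadratic_form_sum[OF X v] quadratic_form_sum[OF mat_adjoint_carrier[OF X] v]
    by (simp add: sum_distrib_left sum_subtractf right_diff_distrib)
  finally show ?thesis by (simp add: quadratic_form_adjoint[OF X v])
qed

lemma quadratic_form_cnj:
  assumes X: "X \<in> carrier_mat m m" and v: "v \<in> carrier_vec m"
  shows "(map_mat cnj X *\<^sub>v conjugate v) \<bullet>c conjugate v = cnj ((X *\<^sub>v v) \<bullet>c v)"
proof -
  have "(map_mat cnj X *\<^sub>v conjugate v) \<bullet>c conjugate v
      = (\<Sum>i<m. \<Sum>k<m. map_mat cnj X $$ (i, k) * conjugate v $ k * cnj (conjugate v $ i))"
    using X v by (intro quadratic_form_sum) auto
  also have "\<dots> = cnj ((X *\<^sub>v v) \<bullet>c v)"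
    unfolding quadratic_form_sum[OF X v] cnj_sum using X v by (intro sum.cong) auto
  finally show ?thesis .
qed

section \<open>Conjugation symmetry and analyticity of transfer functions\<close>

lemma cnj_semiring_hom: "semiring_hom cnj" by unfold_locales auto

lemma transfer_function_carrier:
  assumes "realization n m A B C D" "\<not> eigenvalue (cmat A) s"
  shows "transfer_function A B C D s \<in> carrier_mat m m"
proof -
  have A: "A \<in> carrier_mat n n" and B: "B \<in> carrier_mat n m" and C: "C \<in> carrier_mat m n"
    and D: "D \<in> carrier_mat m m"
    using assms by (auto simp: realization_def)
  have "cmat D \<in> carrier_mat m m" using D by simp
  thus ?thesis unfolding transfer_function_pencil by (rule add_carrier_mat)
qed

lemma transfer_function_cnj:
  assumes R: "realization n m A B C D" and s: "\<not> eigenvalue (cmat A) s"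
  shows "\<not> eigenvalue (cmat A) (cnj s)"
    and "transfer_function A B C D (cnj s) = map_mat cnj (transfer_function A B C D s)"
proof -
  have A: "A \<in> carrier_mat n n" and B: "B \<in> carrier_mat n m" and C: "C \<in> carrier_mat m n"
    and D: "D \<in> carrier_mat m m"
    using R by (auto simp: realization_def)
  note hom = semiring_hom.mat_hom_mult[OF cnj_semiring_hom]
  define R where "R = mat_inv (pencil A s)"
  have I: "R \<in> carrier_mat n n" "R * pencil A s = 1\<^sub>m n"
    using mat_inv_inverse[OF pencil_carrier[OF A], of s, folded R_def] s
    by (auto simp: eigenvalue_iff_det_pencil[OF A])
  have real: "map_mat cnj (cmat X) = cmat X" for X by (intro eq_matI) auto
  have P: "map_mat cnj (pencil A s) = pencil A (cnj s)"
    using A by (intro eq_matI) (auto simp: pencil_def)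
  have "map_mat cnj (R * pencil A s) = map_mat cnj R * pencil A (cnj s)"
    by (simp only: hom[OF I(1) pencil_carrier[OF A]] P)
  moreover have "map_mat cnj (1\<^sub>m n) = 1\<^sub>m n" by (intro eq_matI) auto
  ultimately have RP: "map_mat cnj R * pencil A (cnj s) = 1\<^sub>m n" using I by simp
  have cR: "map_mat cnj R \<in> carrier_mat n n" using I by simp
  show "\<not> eigenvalue (cmat A) (cnj s)"
    using left_inverse_imp_det_nonzero[OF pencil_carrier[OF A] cR RP] by (simp add: eigenvalue_iff_det_pencil[OF A])
  have inv: "mat_inv (pencil A (cnj s)) = map_mat cnj R"
    by (rule mat_inv_unique[OF pencil_carrier[OF A] cR RP])
  have CR: "cmat C * R \<in> carrier_mat m n" "cmat C \<in> carrier_mat m n" "cmat B \<in> carrier_mat n m"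
    using C I B by auto
  have "map_mat cnj (cmat C * R * cmat B + cmat D) = map_mat cnj (cmat C * R * cmat B) + map_mat cnj (cmat D)"
    using CR D by (intro eq_matI) (auto simp del: assoc_mult_mat)
  also have "\<dots> = cmat C * map_mat cnj R * cmat B + cmat D"
    by (simp only: hom[OF CR(1,3)] hom[OF CR(2) I(1)] real)
  finally show "transfer_function A B C D (cnj s) = map_mat cnj (transfer_function A B C D s)"
    by (simp add: transfer_function_pencil inv R_def)
qed

lemma transfer_function_holomorphic:
  assumes R: "realization n m A B C D" and ik: "i < m" "k < m"
  shows "(\<lambda>s. transfer_function A B C D s $$ (i, k)) holomorphic_on {s. \<not> eigenvalue (cmat A) s}"
proof -
  have A: "A \<in> carrier_mat n n" using R by (auto simp: realization_def)
  obtain q where q: "\<And>s i k. \<not> eigenvalue (cmat A) s \<Longrightarrow> i < m \<Longrightarrow> k < m \<Longrightarrow>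
    transfer_function A B C D s $$ (i, k) = poly (q i k) s / poly (char_poly (cmat A)) s"
    using transfer_function_as_ratio[OF R] by metis
  have "(\<lambda>s. poly (q i k) s / poly (char_poly (cmat A)) s) holomorphic_on {s. \<not> eigenvalue (cmat A) s}"
    using eigenvalue_root_char_poly[of "cmat A" n] A by (intro holomorphic_intros) auto
  thus ?thesis by (rule holomorphic_transform) (use q ik in auto)
qed

lemma open_non_eigenvalues:
  assumes "A \<in> carrier_mat n n" shows "open {s. \<not> eigenvalue (cmat A) s}"
proof -
  have "{s. \<not> eigenvalue (cmat A) s} = - {s. eigenvalue (cmat A) s}" by auto
  thus ?thesis using finite_eigenvalues[OF assms] by (simp only: open_Compl finite_imp_closed)
qed

lemma isolated_singularity_off_finite:
  assumes f: "f holomorphic_on - K" and K: "finite K"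
  shows "isolated_singularity_at f w"
proof -
  have "open (- (K - {w}))" using K by (intro open_Compl finite_imp_closed) simp
  then obtain d where d: "d > 0" "ball w d \<subseteq> - (K - {w})" by (force simp: open_contains_ball)
  hence "f holomorphic_on ball w d - {w}" by (intro holomorphic_on_subset[OF f]) auto
  hence "f analytic_on ball w d - {w}" by (simp add: analytic_on_open open_delete)
  thus ?thesis using d by (auto simp: isolated_singularity_at_def)
qed

lemma tf_pole_imp_eigenvalue:
  assumes R: "realization n m A B C D" and p: "tf_pole m (transfer_function A B C D) s"
  shows "eigenvalue (cmat A) s"
proof (rule ccontr)
  assume s: "\<not> eigenvalue (cmat A) s"
  have A: "A \<in> carrier_mat n n" using R by (auto simp: realization_def)
  show False
    using p not_is_pole_holomorphic[OF open_non_eigenvalues[OF A] _ transfer_function_holomorphic[OF R], of s] s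
    by (auto simp: tf_pole_def)
qed

section \<open>Negative imaginary systems and positive real functions\<close>

lemma form_holomorphic:
  assumes R: "realization n m A B C D" and u: "u \<in> carrier_vec m"
  shows "(\<lambda>s. (transfer_function A B C D s *\<^sub>v u) \<bullet>c u) holomorphic_on {s. \<not> eigenvalue (cmat A) s}"
proof -
  have "(\<lambda>s. \<Sum>i<m. \<Sum>k<m. transfer_function A B C D s $$ (i, k) * u $ k * cnj (u $ i))
      holomorphic_on {s. \<not> eigenvalue (cmat A) s}"
    by (intro holomorphic_intros transfer_function_holomorphic[OF R]) auto
  thus ?thesis
    by (rule holomorphic_transform) (simp add: quadratic_form_sum[OF transfer_function_carrier[OF R] u])
qed

lemma form_tendsto:
  assumes R: "realization n m A B C D" and u: "u \<in> carrier_vec m" and X: "X \<in> carrier_mat m m"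
    and ev: "\<forall>\<^sub>F s in F. \<not> eigenvalue (cmat A) s"
    and lim: "\<And>i k. i < m \<Longrightarrow> k < m \<Longrightarrow> ((\<lambda>s. c s * transfer_function A B C D s $$ (i, k)) \<longlongrightarrow> X $$ (i, k)) F"
  shows "((\<lambda>s. c s * ((transfer_function A B C D s *\<^sub>v u) \<bullet>c u)) \<longlongrightarrow> (X *\<^sub>v u) \<bullet>c u) F"
proof -
  have "((\<lambda>s. \<Sum>i<m. \<Sum>k<m. (c s * transfer_function A B C D s $$ (i, k)) * u $ k * cnj (u $ i)) \<longlongrightarrow>
      (X *\<^sub>v u) \<bullet>c u) F"
    unfolding quadratic_form_sum[OF X u] by (intro tendsto_intros lim) auto
  moreover have "\<forall>\<^sub>F s in F. (\<Sum>i<m. \<Sum>k<m. (c s * transfer_function A B C D s $$ (i, k)) * u $ k * cnj (u $ i))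
      = c s * ((transfer_function A B C D s *\<^sub>v u) \<bullet>c u)"
    using ev by eventually_elim
      (simp add: quadratic_form_sum[OF transfer_function_carrier[OF R] u] sum_distrib_left mult.assoc)
  ultimately show ?thesis by (rule Lim_transform_eventually)
qed

lemma form_isCont:
  assumes R: "realization n m A B C D" and u: "u \<in> carrier_vec m" and s: "\<not> eigenvalue (cmat A) s"
  shows "isCont (\<lambda>s. (transfer_function A B C D s *\<^sub>v u) \<bullet>c u) s"
proof -
  have A: "A \<in> carrier_mat n n" using R by (simp add: realization_def)
  show ?thesis
    using holomorphic_on_imp_continuous_on[OF form_holomorphic[OF R u]] open_non_eigenvalues[OF A] s
    by (simp add: continuous_on_eq_continuous_at)
qed

lemma form_cnj:
  assumes R: "realization n m A B C D" and u: "u \<in> carrier_vec m" and s: "\<not> eigenvalue (cmat A) s"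
  shows "(transfer_function A B C D (cnj s) *\<^sub>v conjugate u) \<bullet>c conjugate u
    = cnj ((transfer_function A B C D s *\<^sub>v u) \<bullet>c u)"
  using quadratic_form_cnj[OF transfer_function_carrier[OF R s] u] transfer_function_cnj(2)[OF R s] by simp

lemma finite_axis_eigenvalues:
  assumes "A \<in> carrier_mat n n"
  shows "finite {t::real. eigenvalue (cmat A) (\<i> * of_real t)}"
proof -
  have "inj (\<lambda>t::real. \<i> * complex_of_real t)" by (auto intro: injI)
  from finite_vimageI[OF finite_eigenvalues[OF assms] this] show ?thesis by (simp add: vimage_def)
qed

text \<open>At the origin the two factors come from the multiplier \<open>s\<close> that makes a negative imaginary system
  positive real and from the definition of a residue; the result is the residue \<open>0\<close> there.\<close>

lemma simple_pole_mult_square: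
  assumes f: "isolated_singularity_at f z" and pole: "is_pole f z" "zorder f z = - 1"
  shows "((\<lambda>s. (s - z) ^ 2 * f s) \<longlongrightarrow> 0) (at z)"
proof -
  obtain d where d: "d > 0" "f analytic_on ball z d - {z}" using f by (auto simp: isolated_singularity_at_def)
  have "f holomorphic_on ball z d - {z}" by (rule analytic_imp_holomorphic[OF d(2)])
  from zorder_exist_pole[OF this open_ball _ pole(1)] d(1) obtain g r where
    r: "r > 0" "g holomorphic_on cball z r" "\<And>w. w \<in> cball z r - {z} \<Longrightarrow> f w = g w / (w - z)"
    by (auto simp: pole(2))
  have "isCont g z"
    using holomorphic_on_imp_continuous_on[OF holomorphic_on_subset[OF r(2) ball_subset_cball]] r(1)
    by (simp add: continuous_on_eq_continuous_at)
  hence "((\<lambda>s. (s - z) * g s) \<longlongrightarrow> (z - z) * g z) (at z)" by (intro tendsto_intros) (simp add: isCont_def)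
  moreover have "\<forall>\<^sub>F s in at z. (s - z) * g s = (s - z) ^ 2 * f s"
    unfolding eventually_at
    by (intro exI[of _ r]) (use r in \<open>auto simp: power2_eq_square dist_commute\<close>)
  ultimately show ?thesis using Lim_transform_eventually by fastforce
qed

lemma negative_imaginary_at_axis:
  assumes R: "realization n m A B C D" and NI: "negative_imaginary m (transfer_function A B C D)"
    and u: "u \<in> carrier_vec m" and t: "t \<ge> 0" "\<not> eigenvalue (cmat A) (\<i> * of_real t)"
  shows "Im ((transfer_function A B C D (\<i> * of_real t) *\<^sub>v u) \<bullet>c u) \<le> 0"
proof -
  let ?G = "transfer_function A B C D (\<i> * of_real t)"
  have "\<not> tf_pole m (transfer_function A B C D) (\<i> * of_real t)"
    using tf_pole_imp_eigenvalue[OF R] t by blast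
  hence "pos_semidef m (\<i> \<cdot>\<^sub>m (?G - mat_adjoint ?G))"
    using NI t by (simp add: negative_imaginary_def)
  hence "Re ((\<i> \<cdot>\<^sub>m (?G - mat_adjoint ?G) *\<^sub>v u) \<bullet>c u) \<ge> 0" using u by (simp add: pos_semidef_def)
  thus ?thesis using Re_form_imaginary_part[OF transfer_function_carrier[OF R t(2)] u] by simp
qed

text \<open>At a pole \<open>w\<close> with \<open>Im w > 0\<close> the factor \<open>s\<close> turns the matrix \<open>K\<close> of the definition, which is
  the residue of \<open>\<i> G\<close>, into \<open>Im w * K\<close>. At the origin it cancels the simple pole. Elsewhere
  minimality makes \<open>w\<close> a point of continuity.\<close>

lemma negative_imaginary_residue:
  assumes min: "minimal_realization n m A B C D" and NI: "negative_imaginary m (transfer_function A B C D)"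
    and u: "u \<in> carrier_vec m" and w: "Re w = 0" "Im w \<ge> 0"
  shows "\<exists>r\<ge>0. ((\<lambda>s. (s - w) * (s * ((transfer_function A B C D s *\<^sub>v u) \<bullet>c u))) \<longlongrightarrow> of_real r) (at w)"
proof -
  let ?G = "transfer_function A B C D"
  define q where "q = (\<lambda>s. (?G s *\<^sub>v u) \<bullet>c u)"
  have R: "realization n m A B C D" using min by (simp add: minimal_realization_def)
  have A: "A \<in> carrier_mat n n" using R by (simp add: realization_def)
  have wi: "w = \<i> * of_real (Im w)" using w by (simp add: complex_eq_iff)
  have ev: "\<forall>\<^sub>F s in at w. \<not> eigenvalue (cmat A) s"
    by (rule eventually_cofinite_at[OF eventually_not_eigenvalue[OF A]])
  consider "\<not> eigenvalue (cmat A) w" | "tf_pole m ?G w" "w = 0" | "tf_pole m ?G w" "Im w > 0"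
    using minimal_realization_eigenvalue_is_pole[OF min, of w] w by (metis complex_eq_iff order_le_less zero_complex.simps)
  then show ?thesis
  proof cases
    case 1
    have "(q \<longlongrightarrow> q w) (at w)" using form_isCont[OF R u 1] by (simp add: isCont_def q_def)
    hence "((\<lambda>s. (s - w) * (s * q s)) \<longlongrightarrow> (w - w) * (w * q w)) (at w)" by (intro tendsto_intros)
    thus ?thesis by (intro exI[of _ 0]) (simp add: q_def)
  next
    case 2
    have "((\<lambda>s. s ^ 2 * q s) \<longlongrightarrow> (0\<^sub>m m m *\<^sub>v u) \<bullet>c u) (at 0)"
      unfolding q_def
    proof (rule form_tendsto[OF R u])
      show "\<forall>\<^sub>F s in at 0. \<not> eigenvalue (cmat A) s" using ev 2 by simp
      fix i k assume ik: "i < m" "k < m"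
      let ?g = "\<lambda>s. ?G s $$ (i, k)"
      have sing: "isolated_singularity_at ?g 0"
      proof (rule isolated_singularity_off_finite[OF _ finite_eigenvalues[OF A]])
        have "- {s. eigenvalue (cmat A) s} = {s. \<not> eigenvalue (cmat A) s}" by auto
        thus "?g holomorphic_on - {s. eigenvalue (cmat A) s}" using transfer_function_holomorphic[OF R ik] by simp
      qed
      have "((\<lambda>s. s ^ 2 * ?g s) \<longlongrightarrow> 0) (at 0)"
      proof (cases "is_pole ?g 0")
        case True
        have "tf_pole m ?G (\<i> * of_real 0)" using 2 by simp
        hence "tf_simple_pole m ?G (\<i> * of_real 0)" using NI unfolding negative_imaginary_def by blast
        hence "zorder ?g 0 = - 1" using True ik by (simp add: tf_simple_pole_def)
        thus ?thesis using simple_pole_mult_square[OF sing True] by simp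
      next
        case False
        \<comment> \<open>The origin may be an eigenvalue without being a pole of this particular entry.\<close>
        obtain p where p: "\<And>s i k. \<not> eigenvalue (cmat A) s \<Longrightarrow> i < m \<Longrightarrow> k < m \<Longrightarrow>
          ?G s $$ (i, k) = poly (p i k) s / poly (char_poly (cmat A)) s"
          using transfer_function_as_ratio[OF R] by metis
        have ne: "not_essential (\<lambda>s. poly (p i k) s / poly (char_poly (cmat A)) s) 0"
          by (intro not_essential_divide not_essential_holomorphic[of _ UNIV] isolated_singularity_at_holomorphic[of _ UNIV] holomorphic_intros) auto
        have cong: "\<forall>\<^sub>F s in at 0. poly (p i k) s / poly (char_poly (cmat A)) s = ?g s"
          using ev unfolding \<open>w = 0\<close> by eventually_elim (use p ik in simp)
        have "not_essential ?g 0" by (rule iffD1[OF not_essential_cong[OF cong refl] ne])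
        then obtain c where "(?g \<longlongrightarrow> c) (at 0)" using False by (auto simp: not_essential_def)
        hence "((\<lambda>s. s ^ 2 * ?g s) \<longlongrightarrow> 0 ^ 2 * c) (at 0)" by (intro tendsto_intros)
        thus ?thesis by simp
      qed
      thus "((\<lambda>s. s ^ 2 * ?g s) \<longlongrightarrow> 0\<^sub>m m m $$ (i, k)) (at 0)" using ik by simp
    qed simp
    thus ?thesis using 2 u by (intro exI[of _ 0]) (simp add: q_def power2_eq_square mult.assoc)
  next
    case 3
    have "tf_pole m ?G (\<i> * of_real (Im w))" using 3 wi by simp
    hence "\<exists>K. pos_semidef m K \<and> (\<forall>i<m. \<forall>k<m.
        ((\<lambda>s. (s - \<i> * of_real (Im w)) * (\<i> * ?G s $$ (i, k))) \<longlongrightarrow> K $$ (i, k)) (at (\<i> * of_real (Im w))))"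
      using NI 3(2) unfolding negative_imaginary_def by blast
    then obtain K where K: "pos_semidef m K" "\<And>i k. i < m \<Longrightarrow> k < m \<Longrightarrow>
        ((\<lambda>s. (s - w) * (\<i> * ?G s $$ (i, k))) \<longlongrightarrow> K $$ (i, k)) (at w)"
      unfolding wi[symmetric] by blast
    have herm: "hermitian_mat m K" "Re ((K *\<^sub>v u) \<bullet>c u) \<ge> 0" using K u by (auto simp: pos_semidef_def)
    have "((\<lambda>s. ((s - w) * \<i>) * q s) \<longlongrightarrow> (K *\<^sub>v u) \<bullet>c u) (at w)"
      unfolding q_def
      by (rule form_tendsto[OF R u _ ev]) (use herm K in \<open>auto simp: hermitian_mat_def mult.assoc\<close>)
    hence "((\<lambda>s. - \<i> * s * (((s - w) * \<i>) * q s)) \<longlongrightarrow> - \<i> * w * ((K *\<^sub>v u) \<bullet>c u)) (at w)"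
      by (intro tendsto_intros)
    moreover have "- \<i> * w * ((K *\<^sub>v u) \<bullet>c u) = of_real (Im w * Re ((K *\<^sub>v u) \<bullet>c u))"
      using w by (subst hermitian_form_real[OF herm(1) u]) (simp add: complex_eq_iff)
    moreover have "(\<lambda>s. - \<i> * s * (((s - w) * \<i>) * q s)) = (\<lambda>s. (s - w) * (s * q s))"
      by (auto simp: algebra_simps)
    ultimately have "((\<lambda>s. (s - w) * (s * q s)) \<longlongrightarrow> of_real (Im w * Re ((K *\<^sub>v u) \<bullet>c u))) (at w)" by simp
    thus ?thesis using w herm by (intro exI[of _ "Im w * Re ((K *\<^sub>v u) \<bullet>c u)"]) (simp add: q_def)
  qed
qed

text \<open>For \<open>s = \<i> t\<close> the real part of \<open>s u\<^sup>* G(s) u\<close> is \<open>- t * Im (u\<^sup>* G(s) u)\<close>, which is nonnegative by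
  \<open>negative_imaginary_at_axis\<close>. Strict properness bounds the function at infinity, where it
  tends to the form of the matrix \<open>C * B\<close>.\<close>

lemma negative_imaginary_imp_positive_real:
  assumes min: "minimal_realization n m A B C D" and SP: "strictly_proper m (transfer_function A B C D)"
    and NI: "negative_imaginary m (transfer_function A B C D)"
    and u: "u \<in> carrier_vec m" and s0: "Re s0 > 0"
  shows "Re (s0 * ((transfer_function A B C D s0 *\<^sub>v u) \<bullet>c u)) \<ge> 0"
proof -
  let ?G = "transfer_function A B C D"
  define f where "f = (\<lambda>u s. s * ((?G s *\<^sub>v u) \<bullet>c u))"
  have R: "realization n m A B C D" using min by (simp add: minimal_realization_def)
  have A: "A \<in> carrier_mat n n" and BC: "B \<in> carrier_mat n m" "C \<in> carrier_mat m n"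
    using R by (auto simp: realization_def)
  have cu: "conjugate u \<in> carrier_vec m" using u by simp
  have no_eig: "\<not> eigenvalue (cmat A) s" if "Re s > 0" for s
    using NI that minimal_realization_eigenvalue_is_pole[OF min, of s] by (auto simp: negative_imaginary_def)
  have hol: "f v holomorphic_on {s. \<not> eigenvalue (cmat A) s}" if "v \<in> carrier_vec m" for v
    unfolding f_def by (intro holomorphic_intros form_holomorphic[OF R that])
  have "Re (f u s0) \<ge> 0"
  proof (rule Re_nonneg_from_imaginary_axis[where f = "f u" and g = "f (conjugate u)" and L = "(cmat (C * B) *\<^sub>v u) \<bullet>c u"])
    show "f u holomorphic_on {s. Re s > 0}"
      by (rule holomorphic_on_subset[OF hol[OF u]]) (use no_eig in auto)
    show "f (conjugate u) (cnj s) = cnj (f u s)" if "Re s > 0" for s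
      using form_cnj[OF R u no_eig[OF that]] by (simp add: f_def)
    show "isolated_singularity_at h w" if "h \<in> {f u, f (conjugate u)}" for h w
    proof (rule isolated_singularity_off_finite[OF _ finite_eigenvalues[OF A]])
      have "- {s. eigenvalue (cmat A) s} = {s. \<not> eigenvalue (cmat A) s}" by auto
      thus "h holomorphic_on - {s. eigenvalue (cmat A) s}" using that hol[OF u] hol[OF cu] by auto
    qed
    show "\<exists>r\<ge>0. ((\<lambda>s. (s - w) * h s) \<longlongrightarrow> of_real r) (at w)"
      if "h \<in> {f u, f (conjugate u)}" "Re w = 0" "Im w \<ge> 0" for h w
      using that negative_imaginary_residue[OF min NI u that(2,3)] negative_imaginary_residue[OF min NI cu that(2,3)]
      by (auto simp: f_def)
    show "finite {t. t > 0 \<and> Re (h (\<i> * of_real t)) < 0}" if h: "h \<in> {f u, f (conjugate u)}" for h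
    proof (rule finite_subset[OF _ finite_axis_eigenvalues[OF A]])
      have "Re (f v (\<i> * of_real t)) \<ge> 0"
        if "v \<in> carrier_vec m" "t > 0" "\<not> eigenvalue (cmat A) (\<i> * of_real t)" for v t
        using negative_imaginary_at_axis[OF R NI that(1) _ that(3)] that(2) by (simp add: f_def mult_nonneg_nonpos)
      moreover obtain v where "v \<in> carrier_vec m" "h = f v" using h u cu by blast
      ultimately show "{t. t > 0 \<and> Re (h (\<i> * of_real t)) < 0} \<subseteq> {t. eigenvalue (cmat A) (\<i> * of_real t)}"
        by (auto simp flip: not_le)
    qed
    show "(f u \<longlongrightarrow> (cmat (C * B) *\<^sub>v u) \<bullet>c u) at_infinity"
      unfolding f_def
    proof (rule form_tendsto[OF R u _ eventually_not_eigenvalue_at_infinity[OF A]])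
      fix i k assume ik: "i < m" "k < m"
      show "((\<lambda>s. s * ?G s $$ (i, k)) \<longlongrightarrow> cmat (C * B) $$ (i, k)) at_infinity"
        using transfer_function_at_infinity(1)[OF R ik] ik BC strictly_proper_imp_zero_feedthrough[OF R SP] by simp
    qed (use BC in auto)
  qed (rule s0)
  thus ?thesis by (simp add: f_def)
qed

lemma strictly_negative_imaginary_stable:
  assumes min: "minimal_realization n m A B C D"
    and SNI: "strictly_negative_imaginary m (transfer_function A B C D)" and s: "Re s \<ge> 0"
  shows "\<not> eigenvalue (cmat A) s"
  using SNI s minimal_realization_eigenvalue_is_pole[OF min, of s]
  by (auto simp: strictly_negative_imaginary_def)

lemma strictly_negative_imaginary_at_axis:
  assumes min: "minimal_realization n m A B C D"
    and SNI: "strictly_negative_imaginary m (transfer_function A B C D)"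
    and u: "u \<in> carrier_vec m" "u \<noteq> 0\<^sub>v m" and t: "t > 0"
  shows "Im ((transfer_function A B C D (\<i> * of_real t) *\<^sub>v u) \<bullet>c u) < 0"
proof -
  let ?G = "transfer_function A B C D (\<i> * of_real t)"
  have R: "realization n m A B C D" using min by (simp add: minimal_realization_def)
  have "pos_def m (\<i> \<cdot>\<^sub>m (?G - mat_adjoint ?G))"
    using SNI t by (simp add: strictly_negative_imaginary_def)
  hence "Re ((\<i> \<cdot>\<^sub>m (?G - mat_adjoint ?G) *\<^sub>v u) \<bullet>c u) > 0" using u by (simp add: pos_def_def)
  moreover have "\<not> eigenvalue (cmat A) (\<i> * of_real t)"
    by (rule strictly_negative_imaginary_stable[OF min SNI]) simp
  ultimately show ?thesis using Re_form_imaginary_part[OF transfer_function_carrier[OF R] u(1)] by simp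
qed

text \<open>The scalar function \<open>- u\<^sup>* G(s) u / s\<close> has nonnegative real part on the half-plane, for the same
  reasons as in \<open>negative_imaginary_imp_positive_real\<close>. If its real part vanished at one point of
  the half-plane, it would vanish everywhere by the minimum principle, whereas the pole at the
  origin with its positive residue makes it large along the positive real axis.\<close>

lemma strictly_negative_imaginary_imp_strictly_positive_real:
  assumes min: "minimal_realization n m A B C D"
    and SNI: "strictly_negative_imaginary m (transfer_function A B C D)"
    and G0: "neg_def m (transfer_function A B C D 0)"
    and u: "u \<in> carrier_vec m" "u \<noteq> 0\<^sub>v m" and s0: "Re s0 > 0"
  shows "Re (((transfer_function A B C D s0 *\<^sub>v u) \<bullet>c u) / s0) < 0"
proof -
  let ?G = "transfer_function A B C D"
  define f where "f = (\<lambda>u s. - ((?G s *\<^sub>v u) \<bullet>c u) / s)"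
  define H where "H = {s::complex. Re s > 0}"
  have R: "realization n m A B C D" using min by (simp add: minimal_realization_def)
  have A: "A \<in> carrier_mat n n" and D: "D \<in> carrier_mat m m"
    using R by (auto simp: realization_def)
  have cu: "conjugate u \<in> carrier_vec m" "conjugate u \<noteq> 0\<^sub>v m" using u by auto
  note no_eig = strictly_negative_imaginary_stable[OF min SNI]
  define K where "K = insert 0 {s. eigenvalue (cmat A) s}"
  have K: "finite K" using finite_eigenvalues[OF A] by (simp add: K_def)
  have hol: "f v holomorphic_on - K" if "v \<in> carrier_vec m" for v
    unfolding f_def
    by (intro holomorphic_intros holomorphic_on_subset[OF form_holomorphic[OF R that]]) (auto simp: K_def)
  \<comment> \<open>The only singularity on the closed half-plane is the pole at the origin, whose residue is
    the positive number given by the negative definite matrix \<open>G 0\<close>.\<close>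
  have res0: "((\<lambda>s. s * f v s) \<longlongrightarrow> of_real (- Re ((?G 0 *\<^sub>v v) \<bullet>c v))) (at 0)"
    if "v \<in> carrier_vec m" for v
  proof -
    have "((\<lambda>s. - ((?G s *\<^sub>v v) \<bullet>c v)) \<longlongrightarrow> - ((?G 0 *\<^sub>v v) \<bullet>c v)) (at 0)"
      using form_isCont[OF R that no_eig[of 0]] by (intro tendsto_intros) (simp add: isCont_def)
    moreover have "\<forall>\<^sub>F s in at 0. - ((?G s *\<^sub>v v) \<bullet>c v) = s * f v s"
      by (auto simp: eventually_at_filter f_def)
    ultimately have "((\<lambda>s. s * f v s) \<longlongrightarrow> - ((?G 0 *\<^sub>v v) \<bullet>c v)) (at 0)" by (rule Lim_transform_eventually)
    thus ?thesis using hermitian_form_real[of m "?G 0" v] G0 that by (simp add: neg_def_def)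
  qed
  have neg: "Re ((?G 0 *\<^sub>v v) \<bullet>c v) < 0" if "v \<in> carrier_vec m" "v \<noteq> 0\<^sub>v m" for v
    using G0 that by (simp add: neg_def_def)
  have holH: "f u holomorphic_on H"
    by (rule holomorphic_on_subset[OF hol[OF u(1)]]) (use no_eig in \<open>auto simp: H_def K_def less_imp_le\<close>)
  have nonneg: "Re (f u s) \<ge> 0" if s: "Re s > 0" for s
  proof (rule Re_nonneg_from_imaginary_axis[where f = "f u" and g = "f (conjugate u)" and L = 0])
    show "f u holomorphic_on {s. Re s > 0}" using holH by (simp add: H_def)
    show "f (conjugate u) (cnj s) = cnj (f u s)" if "Re s > 0" for s
      using form_cnj[OF R u(1) no_eig[of s]] that by (simp add: f_def)
    show "isolated_singularity_at h w" if "h \<in> {f u, f (conjugate u)}" for h w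
      by (rule isolated_singularity_off_finite[OF _ K]) (use that hol u cu in auto)
    show "\<exists>r\<ge>0. ((\<lambda>s. (s - w) * h s) \<longlongrightarrow> of_real r) (at w)"
      if h: "h \<in> {f u, f (conjugate u)}" and w: "Re w = 0" "Im w \<ge> 0" for h w
    proof -
      obtain v where v: "v \<in> carrier_vec m" "v \<noteq> 0\<^sub>v m" "h = f v" using h u cu by blast
      show ?thesis
      proof (cases "w = 0")
        case True
        thus ?thesis using res0[OF v(1)] neg[OF v(1,2)] v(3)
          by (intro exI[of _ "- Re ((?G 0 *\<^sub>v v) \<bullet>c v)"]) auto
      next
        case False
        have "isCont (f v) w" unfolding f_def
          using False w by (intro continuous_intros form_isCont[OF R v(1)] no_eig) auto
        hence "((\<lambda>s. (s - w) * f v s) \<longlongrightarrow> (w - w) * f v w) (at w)"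
          by (intro tendsto_intros) (simp add: isCont_def)
        thus ?thesis using v(3) by (intro exI[of _ 0]) simp
      qed
    qed
    show "finite {t. t > 0 \<and> Re (h (\<i> * of_real t)) < 0}" if h: "h \<in> {f u, f (conjugate u)}" for h
    proof -
      obtain v where v: "v \<in> carrier_vec m" "v \<noteq> 0\<^sub>v m" "h = f v" using h u cu by blast
      have *: "Re (h (\<i> * of_real t)) \<ge> 0" if "t > 0" for t
        using strictly_negative_imaginary_at_axis[OF min SNI v(1,2) that] that v(3)
        by (simp add: f_def Re_divide divide_nonpos_pos power2_eq_square mult_nonpos_nonneg)
      have "{t. t > 0 \<and> Re (h (\<i> * of_real t)) < 0} = {}" by (auto dest: *)
      thus ?thesis by (simp only: finite.emptyI)
    qed
    have "((\<lambda>s. 1 * ((?G s *\<^sub>v u) \<bullet>c u)) \<longlongrightarrow> (cmat D *\<^sub>v u) \<bullet>c u) at_infinity"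
      by (rule form_tendsto[OF R u(1) _ eventually_not_eigenvalue_at_infinity[OF A]])
        (use D transfer_function_at_infinity(2)[OF R] in auto)
    from tendsto_mult[OF tendsto_minus[OF this] tendsto_inverse_0]
    show "(f u \<longlongrightarrow> 0) at_infinity" by (simp add: f_def divide_inverse)
  qed (rule s)
  have "Re (f u s0) \<noteq> 0"
  proof
    assume 0: "Re (f u s0) = 0"
    have const: "Re (f u s) = 0" if "s \<in> H" for s
      using Re_minimum_imp_constant[OF holH, of s0 s] nonneg 0 s0 that
      by (auto simp: H_def open_right_halfplane convex_connected[OF convex_halfspace_Re_gt])
    have "filterlim (\<lambda>t. complex_of_real t) (at 0) (at_right 0)"
    proof -
      have "((\<lambda>t. complex_of_real t) \<longlongrightarrow> of_real 0) (at_right 0)" by (intro tendsto_intros)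
      thus ?thesis by (auto simp: filterlim_at eventually_at_filter)
    qed
    from filterlim_compose[OF res0[OF u(1)] this]
    have "((\<lambda>t. Re (of_real t * f u (of_real t))) \<longlongrightarrow> - Re ((?G 0 *\<^sub>v u) \<bullet>c u)) (at_right 0)"
      by (auto dest: tendsto_Re)
    moreover have "\<forall>\<^sub>F t in at_right 0. Re (of_real t * f u (of_real t)) = 0"
      using const by (auto simp: eventually_at_filter H_def)
    ultimately have "((\<lambda>t :: real. 0) \<longlongrightarrow> - Re ((?G 0 *\<^sub>v u) \<bullet>c u)) (at_right 0)"
      by (rule Lim_transform_eventually)
    hence "- Re ((?G 0 *\<^sub>v u) \<bullet>c u) = 0" using tendsto_unique[OF _ _ tendsto_const] by force
    thus False using neg[OF u] by simp
  qed
  with nonneg[OF s0] have "Re (f u s0) > 0" by simp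
  thus ?thesis by (simp add: f_def)
qed

section \<open>Input-state pairs and passivity up to the axis\<close>

text \<open>Off the spectrum of \<open>A\<close>, a solution of \<open>(s - A) x = B u\<close> is determined by \<open>u\<close>.\<close>

lemma output_of_state:
  assumes R: "realization n m A B C D" and s: "\<not> eigenvalue (cmat A) s"
    and x: "x \<in> carrier_vec n" and u: "u \<in> carrier_vec m"
    and eq: "pencil A s *\<^sub>v x = cmat B *\<^sub>v u"
  shows "transfer_function A B C D s *\<^sub>v u = cmat C *\<^sub>v x + cmat D *\<^sub>v u"
proof -
  have A: "A \<in> carrier_mat n n" and B: "B \<in> carrier_mat n m" and C: "C \<in> carrier_mat m n"
    and D: "D \<in> carrier_mat m m"
    using R by (auto simp: realization_def)
  define R where "R = mat_inv (pencil A s)"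
  have I: "R \<in> carrier_mat n n" "R * pencil A s = 1\<^sub>m n"
    using mat_inv_inverse[OF pencil_carrier[OF A], of s, folded R_def] s
    by (auto simp: eigenvalue_iff_det_pencil[OF A])
  have "x = (R * pencil A s) *\<^sub>v x" using I x by simp
  also have "\<dots> = R *\<^sub>v (pencil A s *\<^sub>v x)" using I(1) A x by (intro assoc_mult_mat_vec[of _ n n _ n]) auto
  finally have xR: "x = R *\<^sub>v (cmat B *\<^sub>v u)" by (simp only: eq)
  have "cmat C * R * cmat B *\<^sub>v u = cmat C *\<^sub>v (R *\<^sub>v (cmat B *\<^sub>v u))"
    using C I(1) B u by (simp add: assoc_mult_mat_vec[of _ m n _ m] assoc_mult_mat_vec[of _ n n _ m])
  moreover have "cmat C * R * cmat B \<in> carrier_mat m m" using B C I by (auto simp del: assoc_mult_mat)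
  ultimately show ?thesis
    using D u xR[symmetric] by (simp add: transfer_function_pencil R_def[symmetric] add_mult_distrib_mat_vec[of _ m m] del: assoc_mult_mat)
qed

text \<open>The matrices \<open>Ad\<close> and \<open>Bd\<close> are the conjugate transposes of \<open>s - A\<close> and \<open>B\<close>, so this is the Gram
  matrix of the rows of \<open>[s - A, B]\<close>. A null vector is annihilated by both \<open>Ad\<close> and \<open>Bd\<close>, hence a
  left eigenvector of \<open>A\<close> annihilated by \<open>B\<close>, which controllability excludes.\<close>

lemma gram_pencil_nonsingular:
  fixes s :: complex
  assumes min: "minimal_realization n m A B C D"
  defines "Ad \<equiv> pencil (transpose_mat A) (cnj s)" and "Bd \<equiv> transpose_mat (cmat B)"
  shows "det (pencil A s * Ad + cmat B * Bd) \<noteq> 0"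
proof
  assume "det (pencil A s * Ad + cmat B * Bd) = 0"
  have A: "A \<in> carrier_mat n n" and B: "B \<in> carrier_mat n m"
    using min by (auto simp: minimal_realization_def realization_def)
  have [simp]: "Ad \<in> carrier_mat n n" "Bd \<in> carrier_mat m n" "pencil A s \<in> carrier_mat n n"
    "cmat B \<in> carrier_mat n m" using A B by (auto simp: Ad_def Bd_def)
  have [simp]: "dim_row Ad = n" "dim_row Bd = m" using A B by (auto simp: Ad_def Bd_def)
  have sum: "pencil A s * Ad + cmat B * Bd \<in> carrier_mat n n" using A B by auto
  then obtain w where w: "w \<in> carrier_vec n" "w \<noteq> 0\<^sub>v n" "(pencil A s * Ad + cmat B * Bd) *\<^sub>v w = 0\<^sub>v n"
    using \<open>det _ = 0\<close> det_0_iff_vec_prod_zero[OF sum] by blast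
  have cw: "conjugate w \<in> carrier_vec n" using w by simp
  have v: "Ad *\<^sub>v w \<in> carrier_vec n" "Bd *\<^sub>v w \<in> carrier_vec m"
    using w(1) by (simp_all add: mult_mat_vec_carrier[of _ n n] mult_mat_vec_carrier[of _ m n])
  have conjA: "transpose_mat (pencil A s) *\<^sub>v conjugate w = conjugate (Ad *\<^sub>v w)"
  proof (rule eq_vecI)
    fix i assume "i < dim_vec (conjugate (Ad *\<^sub>v w))"
    hence i: "i < n" using carrier_vecD[OF v(1)] by (simp only: dim_vec_conjugate)
    show "(transpose_mat (pencil A s) *\<^sub>v conjugate w) $ i = conjugate (Ad *\<^sub>v w) $ i"
      using i w(1) A by (auto simp: Ad_def pencil_def scalar_prod_def algebra_simps intro!: sum.cong)
  qed (use A v in auto)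
  have conjB: "transpose_mat (cmat B) *\<^sub>v conjugate w = conjugate (Bd *\<^sub>v w)"
    using w(1) B by (intro eq_vecI) (auto simp: Bd_def scalar_prod_def intro!: sum.cong)
  have split: "(pencil A s * Ad + cmat B * Bd) *\<^sub>v w = pencil A s *\<^sub>v (Ad *\<^sub>v w) + cmat B *\<^sub>v (Bd *\<^sub>v w)"
    by (rule mult_sum_mat_vec[of _ n n _ n _ m]) (simp_all add: B w)
  have "((pencil A s * Ad + cmat B * Bd) *\<^sub>v w) \<bullet>c w = (pencil A s *\<^sub>v (Ad *\<^sub>v w)) \<bullet>c w + (cmat B *\<^sub>v (Bd *\<^sub>v w)) \<bullet>c w"
    unfolding split
    by (rule add_scalar_prod_distrib[OF mult_mat_vec_carrier[of _ n n] mult_mat_vec_carrier[of _ n m] cw])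
      (use v B in simp_all)
  also have "(pencil A s *\<^sub>v (Ad *\<^sub>v w)) \<bullet>c w = (Ad *\<^sub>v w) \<bullet>c (Ad *\<^sub>v w)"
    using transpose_vec_mult_scalar[of "transpose_mat (pencil A s)" n n "conjugate w" "Ad *\<^sub>v w"] cw v A conjA by simp
  also have "(cmat B *\<^sub>v (Bd *\<^sub>v w)) \<bullet>c w = (Bd *\<^sub>v w) \<bullet>c (Bd *\<^sub>v w)"
    using transpose_vec_mult_scalar[of "transpose_mat (cmat B)" m n "conjugate w" "Bd *\<^sub>v w"] cw v B conjB by simp
  finally have "(Ad *\<^sub>v w) \<bullet>c (Ad *\<^sub>v w) + (Bd *\<^sub>v w) \<bullet>c (Bd *\<^sub>v w) = 0" using w by simp
  moreover have "(Ad *\<^sub>v w) \<bullet>c (Ad *\<^sub>v w) \<ge> 0" "(Bd *\<^sub>v w) \<bullet>c (Bd *\<^sub>v w) \<ge> 0" by (rule conjugate_square_ge_0_vec)+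
  ultimately have "(Ad *\<^sub>v w) \<bullet>c (Ad *\<^sub>v w) = 0" "(Bd *\<^sub>v w) \<bullet>c (Bd *\<^sub>v w) = 0"
    by (simp_all add: add_nonneg_eq_0_iff)
  hence 0: "Ad *\<^sub>v w = 0\<^sub>v n" "Bd *\<^sub>v w = 0\<^sub>v m" using v by auto
  have cT: "cmat (transpose_mat A) = transpose_mat (cmat A)" by (intro eq_matI) auto
  have "cnj s \<cdot>\<^sub>v w - transpose_mat (cmat A) *\<^sub>v w = 0\<^sub>v n"
    using 0(1) pencil_mult_vec[of "transpose_mat A" n w "cnj s"] A w(1) by (simp add: Ad_def cT)
  hence "transpose_mat (cmat A) *\<^sub>v w = cnj s \<cdot>\<^sub>v w"
    using minus_vec_eq_zero_iff[of "cnj s \<cdot>\<^sub>v w" n "transpose_mat (cmat A) *\<^sub>v w"] w(1) A by simp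
  hence "w = 0\<^sub>v n" by (rule minimal_realization_controllable[OF min w(1)]) (use 0(2) in \<open>simp add: Bd_def\<close>)
  thus False using w by simp
qed

text \<open>The Moore--Penrose right inverse of \<open>[s - A, B]\<close>, built from the Gram matrix above.\<close>

lemma right_inverse_of_input_pencil:
  assumes min: "minimal_realization n m A B C D"
  obtains X U where "X \<in> carrier_mat n n" "U \<in> carrier_mat m n"
    "\<And>v. v \<in> carrier_vec n \<Longrightarrow> pencil A s *\<^sub>v (X *\<^sub>v v) + cmat B *\<^sub>v (U *\<^sub>v v) = v"
proof -
  have A: "A \<in> carrier_mat n n" and B: "B \<in> carrier_mat n m"
    using min by (auto simp: minimal_realization_def realization_def)
  define Ad where "Ad = pencil (transpose_mat A) (cnj s)"
  define Bd where "Bd = transpose_mat (cmat B)"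
  have [simp]: "Ad \<in> carrier_mat n n" "Bd \<in> carrier_mat m n" "pencil A s \<in> carrier_mat n n"
    "cmat B \<in> carrier_mat n m" using A B by (auto simp: Ad_def Bd_def)
  define M where "M = pencil A s * Ad + cmat B * Bd"
  have M: "M \<in> carrier_mat n n"
    unfolding M_def by (intro add_carrier_mat mult_carrier_mat[of "cmat B" n m]) (simp_all add: B)
  note I = mat_inv_inverse[OF M gram_pencil_nonsingular[OF min, of s, folded Ad_def Bd_def, folded M_def]]
  show ?thesis
  proof
    show "Ad * mat_inv M \<in> carrier_mat n n" "Bd * mat_inv M \<in> carrier_mat m n"
      by (rule mult_carrier_mat[of _ _ n]; simp add: I)+
    fix v :: "complex vec" assume v: "v \<in> carrier_vec n"
    define w where "w = mat_inv M *\<^sub>v v"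
    have w: "w \<in> carrier_vec n" using I(1) v by (simp add: w_def)
    have "pencil A s *\<^sub>v (Ad *\<^sub>v w) + cmat B *\<^sub>v (Bd *\<^sub>v w) = M *\<^sub>v w"
      unfolding M_def by (rule mult_sum_mat_vec[of _ n n _ n _ m, symmetric]) (simp_all add: B w)
    also have "\<dots> = (M * mat_inv M) *\<^sub>v v" unfolding w_def using M I(1) v by (simp add: assoc_mult_mat_vec[of _ n n _ n])
    also have "\<dots> = v" using I(2) v by simp
    finally show "pencil A s *\<^sub>v (Ad * mat_inv M *\<^sub>v v) + cmat B *\<^sub>v (Bd * mat_inv M *\<^sub>v v) = v"
      using I(1) v by (simp add: w_def assoc_mult_mat_vec[of _ n n _ n] assoc_mult_mat_vec[of _ m n _ n])
  qed
qed

text \<open>Put \<open>e = 1 / t\<close> and let \<open>X\<close> and \<open>U\<close> be the blocks of a right inverse of \<open>[s - A, B]\<close>. With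
  \<open>x' = x - e X z\<close> and \<open>u' = u + e U z\<close>, the residual \<open>(s + e - A) x' - B u'\<close> equals
  \<open>e (x - (1 + e X) z)\<close>. It vanishes for \<open>z = t * inverse (t + X) x\<close>, and this \<open>z\<close> tends to \<open>x\<close> by the
  behaviour of the resolvent of \<open>- X\<close> at infinity.\<close>

lemma input_state_approximation:
  assumes min: "minimal_realization n m A B C D"
    and x: "x \<in> carrier_vec n" and u: "u \<in> carrier_vec m" and eq: "pencil A s *\<^sub>v x = cmat B *\<^sub>v u"
  obtains x' u' where
    "\<And>t. x' t \<in> carrier_vec n" "\<And>t. u' t \<in> carrier_vec m"
    "\<forall>\<^sub>F t :: real in at_top. pencil A (s + of_real (1 / t)) *\<^sub>v x' t = cmat B *\<^sub>v u' t"
    "\<And>i. i < n \<Longrightarrow> ((\<lambda>t. x' t $ i) \<longlongrightarrow> x $ i) at_top"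
    "\<And>i. i < m \<Longrightarrow> ((\<lambda>t. u' t $ i) \<longlongrightarrow> u $ i) at_top"
proof -
  have A: "A \<in> carrier_mat n n" and B: "B \<in> carrier_mat n m"
    using min by (auto simp: minimal_realization_def realization_def)
  obtain X U where X: "X \<in> carrier_mat n n" and U: "U \<in> carrier_mat m n"
    and XU: "\<And>v. v \<in> carrier_vec n \<Longrightarrow> pencil A s *\<^sub>v (X *\<^sub>v v) + cmat B *\<^sub>v (U *\<^sub>v v) = v"
    using right_inverse_of_input_pencil[OF min, of s] by metis
  define R where "R = (\<lambda>c. mat_inv (c \<cdot>\<^sub>m 1\<^sub>m n - (- X)))"
  define z where "z = (\<lambda>t. vec n (\<lambda>i. \<Sum>k<n. (of_real t * R (of_real t) $$ (i, k)) * x $ k))"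
  have z: "z t \<in> carrier_vec n" for t by (simp add: z_def)
  have mX: "- X \<in> carrier_mat n n" using X by simp
  have inf: "filterlim (\<lambda>t::real. complex_of_real t) at_infinity at_top"
    by (simp add: filterlim_of_real_at_infinity)
  have zlim: "((\<lambda>t. z t $ i) \<longlongrightarrow> x $ i) at_top" if i: "i < n" for i
  proof -
    have "((\<lambda>t. \<Sum>k<n. (of_real t * R (of_real t) $$ (i, k)) * x $ k) \<longlongrightarrow>
        (\<Sum>k<n. (if i = k then 1 else 0) * x $ k)) at_top"
      unfolding R_def using i
      by (intro tendsto_intros filterlim_compose[OF resolvent_at_infinity(2)[OF mX] inf]) auto
    also have "(\<Sum>k<n. (if i = k then 1 else 0) * x $ k) = (\<Sum>k<n. if i = k then x $ k else 0)"
      by (intro sum.cong) auto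
    also have "\<dots> = x $ i" using i by simp
    finally show ?thesis using i by (simp add: z_def)
  qed
  define x' where "x' = (\<lambda>t. x - of_real (1 / t) \<cdot>\<^sub>v (X *\<^sub>v z t))"
  define u' where "u' = (\<lambda>t. u + of_real (1 / t) \<cdot>\<^sub>v (U *\<^sub>v z t))"
  have x': "x' t \<in> carrier_vec n" and u': "u' t \<in> carrier_vec m" for t
    using x u X U z[of t] by (auto simp: x'_def u'_def)
  have small: "((\<lambda>t::real. complex_of_real (1 / t)) \<longlongrightarrow> 0) at_top"
    using tendsto_of_real[OF tendsto_inverse_0_at_top[OF filterlim_ident], where 'a = complex]
    by (simp add: inverse_eq_divide)
  have "\<forall>\<^sub>F t :: real in at_top. pencil A (s + of_real (1 / t)) *\<^sub>v x' t = cmat B *\<^sub>v u' t"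
    using filterlim_iff[THEN iffD1, OF inf, rule_format, OF resolvent_at_infinity(1)[OF mX]] eventually_gt_at_top[of 0]
  proof eventually_elim
    case (elim t)
    define e where "e = complex_of_real (1 / t)"
    have et: "of_real t * e = 1" using elim by (simp add: e_def)
    define S where "S = complex_of_real t \<cdot>\<^sub>m 1\<^sub>m n - (- X)"
    have S: "S \<in> carrier_mat n n" using X by (auto simp: S_def)
    have I: "R (of_real t) \<in> carrier_mat n n" "S * R (of_real t) = 1\<^sub>m n"
      using mat_inv_inverse[OF S] elim by (auto simp: R_def S_def)
    have zR: "z t = of_real t \<cdot>\<^sub>v (R (of_real t) *\<^sub>v x)"
      using I(1) x by (intro eq_vecI) (auto simp: z_def mult_mat_vec_index_sum[of _ n n] sum_distrib_left mult.assoc simp del: index_mult_mat_vec)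
    have "S *\<^sub>v z t = of_real t \<cdot>\<^sub>v ((S * R (of_real t)) *\<^sub>v x)"
      unfolding zR using S I(1) x by (simp add: mult_mat_vec[of _ n n] assoc_mult_mat_vec[of _ n n _ n])
    hence Sz: "S *\<^sub>v z t = of_real t \<cdot>\<^sub>v x" using I(2) x by simp
    have comp: "of_real t * z t $ i + (X *\<^sub>v z t) $ i = of_real t * x $ i" if i: "i < n" for i
    proof -
      have "S *\<^sub>v z t = of_real t \<cdot>\<^sub>v z t + X *\<^sub>v z t"
        unfolding S_def using X z[of t] by (auto simp: minus_mult_distrib_mat_vec[of _ n n])
      thus ?thesis using arg_cong[OF Sz, of "\<lambda>v. vec_index v i"] i x X z[of t] by simp
    qed
    show "pencil A (s + of_real (1 / t)) *\<^sub>v x' t = cmat B *\<^sub>v u' t"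
    proof (rule eq_vecI)
      fix i assume "i < dim_vec (cmat B *\<^sub>v u' t)"
      hence i: "i < n" using B by simp
      have Xz: "X *\<^sub>v z t \<in> carrier_vec n" and Uz: "U *\<^sub>v z t \<in> carrier_vec m" using X U z[of t] by auto
      have "pencil A (s + e) *\<^sub>v y = pencil A s *\<^sub>v y + e \<cdot>\<^sub>v y" if "y \<in> carrier_vec n" for y
        using that A by (auto simp: pencil_mult_vec[OF A] algebra_simps vec_eq_iff simp del: index_mult_mat_vec)
      hence "(pencil A (s + e) *\<^sub>v x' t) $ i = (pencil A s *\<^sub>v x' t) $ i + e * x' t $ i"
        using x'[of t] A i by (simp del: index_mult_mat_vec add: pencil_carrier[OF A, THEN carrier_matD(1)])
      also have "pencil A s *\<^sub>v x' t = pencil A s *\<^sub>v x - e \<cdot>\<^sub>v (pencil A s *\<^sub>v (X *\<^sub>v z t))"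
        unfolding x'_def e_def[symmetric] using A x Xz
        by (simp add: mult_minus_distrib_mat_vec[of _ n n] mult_mat_vec[of _ n n])
      finally have L: "(pencil A (s + e) *\<^sub>v x' t) $ i
          = (cmat B *\<^sub>v u) $ i - e * (pencil A s *\<^sub>v (X *\<^sub>v z t)) $ i + e * (x $ i - e * (X *\<^sub>v z t) $ i)"
        unfolding eq using A B i x Xz X by (simp add: x'_def e_def del: index_mult_mat_vec)
      have "cmat B *\<^sub>v u' t = cmat B *\<^sub>v u + e \<cdot>\<^sub>v (cmat B *\<^sub>v (U *\<^sub>v z t))"
        unfolding u'_def e_def[symmetric] using B u Uz
        by (simp add: mult_add_distrib_mat_vec[of _ n m] mult_mat_vec[of _ n m])
      hence Rt: "(cmat B *\<^sub>v u' t) $ i = (cmat B *\<^sub>v u) $ i + e * (cmat B *\<^sub>v (U *\<^sub>v z t)) $ i"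
        using B i by (simp del: index_mult_mat_vec)
      define p where "p = (pencil A s *\<^sub>v (X *\<^sub>v z t)) $ i"
      define b where "b = (cmat B *\<^sub>v (U *\<^sub>v z t)) $ i"
      define y where "y = (X *\<^sub>v z t) $ i"
      have pb: "p + b = z t $ i"
        using arg_cong[OF XU[OF z[of t]], of "\<lambda>v. vec_index v i"] A B i
        by (simp add: p_def b_def del: index_mult_mat_vec)
      have "e * (of_real t * z t $ i + y) = e * (of_real t * x $ i)" by (simp only: y_def comp[OF i])
      hence "(of_real t * e) * z t $ i + e * y = (of_real t * e) * x $ i" by (simp only: algebra_simps)
      hence "z t $ i + e * y = x $ i" by (simp only: et mult_1)
      hence h: "x $ i - e * y = p + b" unfolding pb by (metis add_diff_cancel_right')
      have "(pencil A (s + e) *\<^sub>v x' t) $ i = (cmat B *\<^sub>v u' t) $ i"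
        unfolding L Rt p_def[symmetric] b_def[symmetric] y_def[symmetric] h by (simp add: distrib_left)
      thus "(pencil A (s + of_real (1 / t)) *\<^sub>v x' t) $ i = (cmat B *\<^sub>v u' t) $ i" by (simp only: e_def)
    qed (use A B in simp)
  qed
  moreover have "((\<lambda>t. x' t $ i) \<longlongrightarrow> x $ i) at_top" if i: "i < n" for i
  proof -
    have "((\<lambda>t. x $ i - of_real (1 / t) * (\<Sum>k<n. X $$ (i, k) * z t $ k)) \<longlongrightarrow>
        x $ i - 0 * (\<Sum>k<n. X $$ (i, k) * x $ k)) at_top"
      by (intro tendsto_intros small zlim) auto
    moreover have "x' t $ i = x $ i - of_real (1 / t) * (\<Sum>k<n. X $$ (i, k) * z t $ k)" for t
      using x X z[of t] i mult_mat_vec_index_sum[OF X z[of t] i] by (simp add: x'_def del: index_mult_mat_vec)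
    ultimately show ?thesis by simp
  qed
  moreover have "((\<lambda>t. u' t $ i) \<longlongrightarrow> u $ i) at_top" if i: "i < m" for i
  proof -
    have "((\<lambda>t. u $ i + of_real (1 / t) * (\<Sum>k<n. U $$ (i, k) * z t $ k)) \<longlongrightarrow>
        u $ i + 0 * (\<Sum>k<n. U $$ (i, k) * x $ k)) at_top"
      by (intro tendsto_intros small zlim) auto
    moreover have "u' t $ i = u $ i + of_real (1 / t) * (\<Sum>k<n. U $$ (i, k) * z t $ k)" for t
      using u U z[of t] i mult_mat_vec_index_sum[OF U z[of t] i] by (simp add: u'_def del: index_mult_mat_vec)
    ultimately show ?thesis by simp
  qed
  ultimately show ?thesis by (rule that[of x' u', OF x' u'])
qed

text \<open>In the open half-plane this is positive realness. A pair on the axis is a limit of pairs in the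
  open half-plane, and the inequality is closed. No value of the transfer function occurs, so \<open>s\<close>
  may be a pole.\<close>

lemma negative_imaginary_passive_on_closed_halfplane:
  assumes min: "minimal_realization n m A B C D" and SP: "strictly_proper m (transfer_function A B C D)"
    and NI: "negative_imaginary m (transfer_function A B C D)"
    and x: "x \<in> carrier_vec n" and u: "u \<in> carrier_vec m" and s: "Re s \<ge> 0"
    and eq: "pencil A s *\<^sub>v x = cmat B *\<^sub>v u"
  shows "Re (s * ((cmat C *\<^sub>v x) \<bullet>c u)) \<ge> 0"
proof -
  let ?G = "transfer_function A B C D"
  have R: "realization n m A B C D" using min by (simp add: minimal_realization_def)
  have A: "A \<in> carrier_mat n n" and B: "B \<in> carrier_mat n m" and C: "C \<in> carrier_mat m n"
    using R by (auto simp: realization_def)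
  have D: "D = 0\<^sub>m m m" by (rule strictly_proper_imp_zero_feedthrough[OF R SP])
  have open_halfplane: "Re (s * ((cmat C *\<^sub>v x) \<bullet>c u)) \<ge> 0"
    if "x \<in> carrier_vec n" "u \<in> carrier_vec m" "Re s > 0" "pencil A s *\<^sub>v x = cmat B *\<^sub>v u" for x u s
  proof -
    have s: "\<not> eigenvalue (cmat A) s"
      using NI that(3) minimal_realization_eigenvalue_is_pole[OF min, of s] by (auto simp: negative_imaginary_def)
    have "cmat D = 0\<^sub>m m m" unfolding D by (intro eq_matI) auto
    hence "cmat D *\<^sub>v u = 0\<^sub>v m" using that(2) by simp
    moreover have "cmat C *\<^sub>v x \<in> carrier_vec m" using C that(1) by (intro mult_mat_vec_carrier[of _ m n]) auto
    ultimately have "?G s *\<^sub>v u = cmat C *\<^sub>v x"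
      using output_of_state[OF R s that(1,2,4)] by simp
    thus ?thesis using negative_imaginary_imp_positive_real[OF min SP NI that(2,3)] by simp
  qed
  obtain x' u' where x': "\<And>t. x' t \<in> carrier_vec n" and u': "\<And>t. u' t \<in> carrier_vec m"
    and eq': "\<forall>\<^sub>F t :: real in at_top. pencil A (s + of_real (1 / t)) *\<^sub>v x' t = cmat B *\<^sub>v u' t"
    and lim: "\<And>i. i < n \<Longrightarrow> ((\<lambda>t. x' t $ i) \<longlongrightarrow> x $ i) at_top" "\<And>i. i < m \<Longrightarrow> ((\<lambda>t. u' t $ i) \<longlongrightarrow> u $ i) at_top"
    by (rule input_state_approximation[OF min x u eq]) (rule that)
  have form: "(cmat C *\<^sub>v y) \<bullet>c v = (\<Sum>i<m. (\<Sum>k<n. cmat C $$ (i, k) * y $ k) * cnj (v $ i))"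
    if "y \<in> carrier_vec n" "v \<in> carrier_vec m" for y v
    using that C by (auto simp: scalar_prod_def lessThan_atLeast0 intro!: sum.cong)
  have small: "((\<lambda>t::real. complex_of_real (1 / t)) \<longlongrightarrow> 0) at_top"
    using tendsto_of_real[OF tendsto_inverse_0_at_top[OF filterlim_ident], where 'a = complex]
    by (simp add: inverse_eq_divide)
  have "((\<lambda>t. Re ((s + of_real (1 / t)) * ((cmat C *\<^sub>v x' t) \<bullet>c u' t))) \<longlongrightarrow>
      Re ((s + 0) * ((cmat C *\<^sub>v x) \<bullet>c u))) at_top"
    unfolding form[OF x u] form[OF x' u'] by (intro tendsto_intros lim small) auto
  moreover have "\<forall>\<^sub>F t in at_top. Re ((s + of_real (1 / t)) * ((cmat C *\<^sub>v x' t) \<bullet>c u' t)) \<ge> 0"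
    using eq' eventually_gt_at_top[of 0]
  proof eventually_elim
    case (elim t)
    have "Re (s + of_real (1 / t)) > 0" using s elim(2) by (simp add: add_nonneg_pos)
    thus ?case using open_halfplane[OF x' u' _ elim(1)] by blast
  qed
  ultimately show ?thesis using tendsto_lowerbound[OF _ _ trivial_limit_at_top_linorder] by fastforce
qed

section \<open>The closed loop\<close>

lemma closed_loop_matrix_strictly_proper:
  assumes R1: "realization n\<^sub>1 m A\<^sub>1 B\<^sub>1 C\<^sub>1 (0\<^sub>m m m)" and R2: "realization n\<^sub>2 m A\<^sub>2 B\<^sub>2 C\<^sub>2 D\<^sub>2"
  shows "closed_loop_matrix A\<^sub>1 B\<^sub>1 C\<^sub>1 (0\<^sub>m m m) A\<^sub>2 B\<^sub>2 C\<^sub>2 D\<^sub>2 =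
    four_block_mat (A\<^sub>1 + B\<^sub>1 * D\<^sub>2 * C\<^sub>1) (B\<^sub>1 * C\<^sub>2) (B\<^sub>2 * C\<^sub>1) A\<^sub>2"
proof -
  have c: "A\<^sub>1 \<in> carrier_mat n\<^sub>1 n\<^sub>1" "B\<^sub>1 \<in> carrier_mat n\<^sub>1 m" "C\<^sub>1 \<in> carrier_mat m n\<^sub>1"
    "A\<^sub>2 \<in> carrier_mat n\<^sub>2 n\<^sub>2" "B\<^sub>2 \<in> carrier_mat n\<^sub>2 m" "C\<^sub>2 \<in> carrier_mat m n\<^sub>2" "D\<^sub>2 \<in> carrier_mat m m"
    using R1 R2 by (auto simp: realization_def)
  have BD: "B\<^sub>1 * D\<^sub>2 \<in> carrier_mat n\<^sub>1 m" and BDC: "B\<^sub>1 * D\<^sub>2 * C\<^sub>1 \<in> carrier_mat n\<^sub>1 n\<^sub>1"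
    and BC1: "B\<^sub>1 * C\<^sub>2 \<in> carrier_mat n\<^sub>1 n\<^sub>2" and BC2: "B\<^sub>2 * C\<^sub>1 \<in> carrier_mat n\<^sub>2 n\<^sub>1"
    by (rule mult_carrier_mat[OF c(2,7)], rule mult_carrier_mat[OF mult_carrier_mat[OF c(2,7)] c(3)],
        rule mult_carrier_mat[OF c(2,6)], rule mult_carrier_mat[OF c(5,3)])
  have dims: "dim_row A\<^sub>2 = n\<^sub>2" "dim_col A\<^sub>1 = n\<^sub>1" "dim_row (0\<^sub>m m m :: real mat) = m"
    "0\<^sub>m m m * D\<^sub>2 = 0\<^sub>m m m" "0\<^sub>m m m * C\<^sub>2 = 0\<^sub>m m n\<^sub>2" "dim_col C\<^sub>1 = n\<^sub>1"
    "dim_row (B\<^sub>1 * D\<^sub>2) = n\<^sub>1" "dim_row B\<^sub>2 = n\<^sub>2" using c by auto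
  have inv: "mat_inv (1\<^sub>m m - 0\<^sub>m m m :: real mat) = 1\<^sub>m m" by (rule mat_inv_unique[of _ m]) auto
  have L: "(B\<^sub>1 * D\<^sub>2) @\<^sub>r B\<^sub>2 = four_block_mat (B\<^sub>1 * D\<^sub>2) (0\<^sub>m n\<^sub>1 0) B\<^sub>2 (0\<^sub>m n\<^sub>2 0)"
    by (simp only: append_rows_def dims)
  have "(B\<^sub>1 * D\<^sub>2) @\<^sub>r B\<^sub>2 \<in> carrier_mat (n\<^sub>1 + n\<^sub>2) m" using BD c(5) by simp
  hence one: "((B\<^sub>1 * D\<^sub>2) @\<^sub>r B\<^sub>2) * 1\<^sub>m m = (B\<^sub>1 * D\<^sub>2) @\<^sub>r B\<^sub>2" by (rule right_mult_one_mat)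
  have "((B\<^sub>1 * D\<^sub>2) @\<^sub>r B\<^sub>2) * 1\<^sub>m m * append_cols C\<^sub>1 (0\<^sub>m m n\<^sub>2)
      = four_block_mat (B\<^sub>1 * D\<^sub>2) (0\<^sub>m n\<^sub>1 0) B\<^sub>2 (0\<^sub>m n\<^sub>2 0) * four_block_mat C\<^sub>1 (0\<^sub>m m n\<^sub>2) (0\<^sub>m 0 n\<^sub>1) (0\<^sub>m 0 n\<^sub>2)"
    by (simp only: one) (simp add: append_cols_def dims L)
  also have "\<dots> = four_block_mat (B\<^sub>1 * D\<^sub>2 * C\<^sub>1 + 0\<^sub>m n\<^sub>1 0 * 0\<^sub>m 0 n\<^sub>1) (B\<^sub>1 * D\<^sub>2 * 0\<^sub>m m n\<^sub>2 + 0\<^sub>m n\<^sub>1 0 * 0\<^sub>m 0 n\<^sub>2)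
      (B\<^sub>2 * C\<^sub>1 + 0\<^sub>m n\<^sub>2 0 * 0\<^sub>m 0 n\<^sub>1) (B\<^sub>2 * 0\<^sub>m m n\<^sub>2 + 0\<^sub>m n\<^sub>2 0 * 0\<^sub>m 0 n\<^sub>2)"
    by (rule mult_four_block_mat[OF BD _ c(5) _ c(3)]) auto
  also have "\<dots> = four_block_mat (B\<^sub>1 * D\<^sub>2 * C\<^sub>1) (0\<^sub>m n\<^sub>1 n\<^sub>2) (B\<^sub>2 * C\<^sub>1) (0\<^sub>m n\<^sub>2 n\<^sub>2)"
    using BDC BC2 BD c(5) by (simp add: right_mult_zero_mat[OF BD] del: assoc_mult_mat)
  finally have P: "((B\<^sub>1 * D\<^sub>2) @\<^sub>r B\<^sub>2) * 1\<^sub>m m * append_cols C\<^sub>1 (0\<^sub>m m n\<^sub>2)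
      = four_block_mat (B\<^sub>1 * D\<^sub>2 * C\<^sub>1) (0\<^sub>m n\<^sub>1 n\<^sub>2) (B\<^sub>2 * C\<^sub>1) (0\<^sub>m n\<^sub>2 n\<^sub>2)" .
  have "closed_loop_matrix A\<^sub>1 B\<^sub>1 C\<^sub>1 (0\<^sub>m m m) A\<^sub>2 B\<^sub>2 C\<^sub>2 D\<^sub>2 =
      four_block_mat A\<^sub>1 (B\<^sub>1 * C\<^sub>2) (0\<^sub>m n\<^sub>2 n\<^sub>1) A\<^sub>2
      + four_block_mat (B\<^sub>1 * D\<^sub>2 * C\<^sub>1) (0\<^sub>m n\<^sub>1 n\<^sub>2) (B\<^sub>2 * C\<^sub>1) (0\<^sub>m n\<^sub>2 n\<^sub>2)"
    by (simp only: closed_loop_matrix_def dims inv P)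
  also have "\<dots> = four_block_mat (A\<^sub>1 + B\<^sub>1 * D\<^sub>2 * C\<^sub>1) (B\<^sub>1 * C\<^sub>2 + 0\<^sub>m n\<^sub>1 n\<^sub>2) (0\<^sub>m n\<^sub>2 n\<^sub>1 + B\<^sub>2 * C\<^sub>1) (A\<^sub>2 + 0\<^sub>m n\<^sub>2 n\<^sub>2)"
    by (rule add_four_block_mat[OF c(1) BC1 _ c(4) BDC _ BC2]) auto
  finally show ?thesis using BC1 BC2 c(4) by simp
qed

text \<open>The blocks of the eigenvector equation say that the two systems exchange the signals \<open>u\<close> and
  \<open>y\<close>: the output \<open>y\<close> of the first drives the second, whose output \<open>u\<close> drives the first.\<close>

lemma closed_loop_eigenvector:
  assumes R1: "realization n\<^sub>1 m A\<^sub>1 B\<^sub>1 C\<^sub>1 (0\<^sub>m m m)" and R2: "realization n\<^sub>2 m A\<^sub>2 B\<^sub>2 C\<^sub>2 D\<^sub>2"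
    and ev: "eigenvalue (cmat (closed_loop_matrix A\<^sub>1 B\<^sub>1 C\<^sub>1 (0\<^sub>m m m) A\<^sub>2 B\<^sub>2 C\<^sub>2 D\<^sub>2)) s"
  obtains x\<^sub>1 x\<^sub>2 u y where "x\<^sub>1 \<in> carrier_vec n\<^sub>1" "x\<^sub>2 \<in> carrier_vec n\<^sub>2" "x\<^sub>1 \<noteq> 0\<^sub>v n\<^sub>1 \<or> x\<^sub>2 \<noteq> 0\<^sub>v n\<^sub>2"
    "y \<in> carrier_vec m" "u \<in> carrier_vec m"
    "y = cmat C\<^sub>1 *\<^sub>v x\<^sub>1" "u = cmat C\<^sub>2 *\<^sub>v x\<^sub>2 + cmat D\<^sub>2 *\<^sub>v y"
    "pencil A\<^sub>1 s *\<^sub>v x\<^sub>1 = cmat B\<^sub>1 *\<^sub>v u" "pencil A\<^sub>2 s *\<^sub>v x\<^sub>2 = cmat B\<^sub>2 *\<^sub>v y"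
proof -
  have c: "A\<^sub>1 \<in> carrier_mat n\<^sub>1 n\<^sub>1" "B\<^sub>1 \<in> carrier_mat n\<^sub>1 m" "C\<^sub>1 \<in> carrier_mat m n\<^sub>1"
    "A\<^sub>2 \<in> carrier_mat n\<^sub>2 n\<^sub>2" "B\<^sub>2 \<in> carrier_mat n\<^sub>2 m" "C\<^sub>2 \<in> carrier_mat m n\<^sub>2" "D\<^sub>2 \<in> carrier_mat m m"
    using R1 R2 by (auto simp: realization_def)
  have cc: "cmat A\<^sub>1 \<in> carrier_mat n\<^sub>1 n\<^sub>1" "cmat B\<^sub>1 \<in> carrier_mat n\<^sub>1 m" "cmat C\<^sub>1 \<in> carrier_mat m n\<^sub>1"
    "cmat A\<^sub>2 \<in> carrier_mat n\<^sub>2 n\<^sub>2" "cmat B\<^sub>2 \<in> carrier_mat n\<^sub>2 m" "cmat C\<^sub>2 \<in> carrier_mat m n\<^sub>2" "cmat D\<^sub>2 \<in> carrier_mat m m"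
    using c by auto
  have BD: "B\<^sub>1 * D\<^sub>2 \<in> carrier_mat n\<^sub>1 m" and BDC: "B\<^sub>1 * D\<^sub>2 * C\<^sub>1 \<in> carrier_mat n\<^sub>1 n\<^sub>1"
    and BC1: "B\<^sub>1 * C\<^sub>2 \<in> carrier_mat n\<^sub>1 n\<^sub>2" and BC2: "B\<^sub>2 * C\<^sub>1 \<in> carrier_mat n\<^sub>2 n\<^sub>1"
    by (rule mult_carrier_mat[OF c(2,7)], rule mult_carrier_mat[OF mult_carrier_mat[OF c(2,7)] c(3)],
        rule mult_carrier_mat[OF c(2,6)], rule mult_carrier_mat[OF c(5,3)])
  have sum: "A\<^sub>1 + B\<^sub>1 * D\<^sub>2 * C\<^sub>1 \<in> carrier_mat n\<^sub>1 n\<^sub>1" by (rule add_carrier_mat[OF BDC])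
  define F where "F = closed_loop_matrix A\<^sub>1 B\<^sub>1 C\<^sub>1 (0\<^sub>m m m) A\<^sub>2 B\<^sub>2 C\<^sub>2 D\<^sub>2"
  have F: "cmat F = four_block_mat (cmat (A\<^sub>1 + B\<^sub>1 * D\<^sub>2 * C\<^sub>1)) (cmat (B\<^sub>1 * C\<^sub>2)) (cmat (B\<^sub>2 * C\<^sub>1)) (cmat A\<^sub>2)"
    unfolding F_def closed_loop_matrix_strictly_proper[OF R1 R2]
    by (rule map_four_block_mat[OF sum BC1 BC2 c(4)])
  have dF: "dim_row (cmat F) = n\<^sub>1 + n\<^sub>2" using sum c by (simp add: F)
  obtain v where v: "v \<in> carrier_vec (n\<^sub>1 + n\<^sub>2)" "v \<noteq> 0\<^sub>v (n\<^sub>1 + n\<^sub>2)" "cmat F *\<^sub>v v = s \<cdot>\<^sub>v v"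
    using ev dF unfolding F_def[symmetric] eigenvalue_def eigenvector_def by auto
  define x1 where "x1 = vec_first v n\<^sub>1"
  define x2 where "x2 = vec_last v n\<^sub>2"
  have x: "x1 \<in> carrier_vec n\<^sub>1" "x2 \<in> carrier_vec n\<^sub>2" "v = x1 @\<^sub>v x2"
    using v(1) by (simp_all add: x1_def x2_def)
  define y where "y = cmat C\<^sub>1 *\<^sub>v x1"
  define u where "u = cmat C\<^sub>2 *\<^sub>v x2 + cmat D\<^sub>2 *\<^sub>v y"
  have y: "y \<in> carrier_vec m" unfolding y_def by (rule mult_mat_vec_carrier[OF cc(3) x(1)])
  have Dy: "cmat D\<^sub>2 *\<^sub>v y \<in> carrier_vec m" by (rule mult_mat_vec_carrier[OF cc(7) y])
  have Cx: "cmat C\<^sub>2 *\<^sub>v x2 \<in> carrier_vec m" by (rule mult_mat_vec_carrier[OF cc(6) x(2)])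
  have u: "u \<in> carrier_vec m" unfolding u_def using Cx Dy by simp
  have "(cmat (A\<^sub>1 + B\<^sub>1 * D\<^sub>2 * C\<^sub>1) *\<^sub>v x1 + cmat (B\<^sub>1 * C\<^sub>2) *\<^sub>v x2) @\<^sub>v (cmat (B\<^sub>2 * C\<^sub>1) *\<^sub>v x1 + cmat A\<^sub>2 *\<^sub>v x2)
      = s \<cdot>\<^sub>v (x1 @\<^sub>v x2)"
    using v(3) sum BC1 BC2 c(4) x(1,2) unfolding F x(3)
    by (subst (asm) four_block_mat_mult_vec[of _ n\<^sub>1 n\<^sub>1 _ n\<^sub>2 _ n\<^sub>2]) auto
  also have "s \<cdot>\<^sub>v (x1 @\<^sub>v x2) = (s \<cdot>\<^sub>v x1) @\<^sub>v (s \<cdot>\<^sub>v x2)" by (intro eq_vecI) auto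
  finally have append: "(cmat (A\<^sub>1 + B\<^sub>1 * D\<^sub>2 * C\<^sub>1) *\<^sub>v x1 + cmat (B\<^sub>1 * C\<^sub>2) *\<^sub>v x2) @\<^sub>v (cmat (B\<^sub>2 * C\<^sub>1) *\<^sub>v x1 + cmat A\<^sub>2 *\<^sub>v x2)
      = (s \<cdot>\<^sub>v x1) @\<^sub>v (s \<cdot>\<^sub>v x2)" .
  have carr: "cmat (A\<^sub>1 + B\<^sub>1 * D\<^sub>2 * C\<^sub>1) *\<^sub>v x1 + cmat (B\<^sub>1 * C\<^sub>2) *\<^sub>v x2 \<in> carrier_vec n\<^sub>1"
    using sum BC1 x by (intro add_carrier_vec mult_mat_vec_carrier[of _ n\<^sub>1 n\<^sub>1] mult_mat_vec_carrier[of _ n\<^sub>1 n\<^sub>2]) auto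
  have eqs: "cmat (A\<^sub>1 + B\<^sub>1 * D\<^sub>2 * C\<^sub>1) *\<^sub>v x1 + cmat (B\<^sub>1 * C\<^sub>2) *\<^sub>v x2 = s \<cdot>\<^sub>v x1"
      "cmat (B\<^sub>2 * C\<^sub>1) *\<^sub>v x1 + cmat A\<^sub>2 *\<^sub>v x2 = s \<cdot>\<^sub>v x2"
    using append append_vec_eq[OF carr smult_carrier_vec[THEN iffD2, OF x(1)]] by blast+
  have e1: "cmat (A\<^sub>1 + B\<^sub>1 * D\<^sub>2 * C\<^sub>1) *\<^sub>v x1 = cmat A\<^sub>1 *\<^sub>v x1 + cmat B\<^sub>1 *\<^sub>v (cmat D\<^sub>2 *\<^sub>v y)"
  proof -
    have "cmat (A\<^sub>1 + B\<^sub>1 * D\<^sub>2 * C\<^sub>1) = cmat A\<^sub>1 + cmat (B\<^sub>1 * D\<^sub>2 * C\<^sub>1)"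
      using c BDC by (intro eq_matI) (auto simp del: assoc_mult_mat)
    also have "cmat (B\<^sub>1 * D\<^sub>2 * C\<^sub>1) = cmat B\<^sub>1 * cmat D\<^sub>2 * cmat C\<^sub>1"
      by (simp only: of_real_hom.mat_hom_mult[OF BD c(3)] of_real_hom.mat_hom_mult[OF c(2,7)])
    finally have "cmat (A\<^sub>1 + B\<^sub>1 * D\<^sub>2 * C\<^sub>1) *\<^sub>v x1 = cmat A\<^sub>1 *\<^sub>v x1 + (cmat B\<^sub>1 * cmat D\<^sub>2 * cmat C\<^sub>1) *\<^sub>v x1"
      using add_mult_distrib_mat_vec[OF cc(1) mult_carrier_mat[OF mult_carrier_mat[OF cc(2,7)] cc(3)] x(1)] by simp
    also have "(cmat B\<^sub>1 * cmat D\<^sub>2 * cmat C\<^sub>1) *\<^sub>v x1 = cmat B\<^sub>1 *\<^sub>v (cmat D\<^sub>2 *\<^sub>v y)"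
      unfolding y_def by (simp only: assoc_mult_mat_vec[OF mult_carrier_mat[OF cc(2,7)] cc(3) x(1)]
          assoc_mult_mat_vec[OF cc(2,7) mult_mat_vec_carrier[OF cc(3) x(1)]])
    finally show ?thesis .
  qed
  have e2: "cmat (B\<^sub>1 * C\<^sub>2) *\<^sub>v x2 = cmat B\<^sub>1 *\<^sub>v (cmat C\<^sub>2 *\<^sub>v x2)"
    by (simp only: of_real_hom.mat_hom_mult[OF c(2,6)] assoc_mult_mat_vec[OF cc(2,6) x(2)])
  have e3: "cmat (B\<^sub>2 * C\<^sub>1) *\<^sub>v x1 = cmat B\<^sub>2 *\<^sub>v y"
    by (simp only: of_real_hom.mat_hom_mult[OF c(5,3)] assoc_mult_mat_vec[OF cc(5,3) x(1)] y_def)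
  have Bu: "cmat B\<^sub>1 *\<^sub>v u = cmat B\<^sub>1 *\<^sub>v (cmat C\<^sub>2 *\<^sub>v x2) + cmat B\<^sub>1 *\<^sub>v (cmat D\<^sub>2 *\<^sub>v y)"
    unfolding u_def by (rule mult_add_distrib_mat_vec[OF cc(2) Cx Dy])
  show ?thesis
  proof (rule that[OF x(1,2) _ y u y_def u_def])
    show "x1 \<noteq> 0\<^sub>v n\<^sub>1 \<or> x2 \<noteq> 0\<^sub>v n\<^sub>2" using v(2) x(3) by auto
    have w: "cmat A\<^sub>1 *\<^sub>v x1 \<in> carrier_vec n\<^sub>1" "cmat B\<^sub>1 *\<^sub>v (cmat C\<^sub>2 *\<^sub>v x2) \<in> carrier_vec n\<^sub>1"
      "cmat B\<^sub>1 *\<^sub>v (cmat D\<^sub>2 *\<^sub>v y) \<in> carrier_vec n\<^sub>1" "cmat A\<^sub>2 *\<^sub>v x2 \<in> carrier_vec n\<^sub>2" "cmat B\<^sub>2 *\<^sub>v y \<in> carrier_vec n\<^sub>2"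
      using mult_mat_vec_carrier cc Cx Dy x y by blast+
    have diff: "d - a = b" if "a + b = d" "a \<in> carrier_vec k" "b \<in> carrier_vec k" for a b d :: "complex vec" and k
      using that by (intro eq_vecI) auto
    have rearrange: "a + (b + d) = (a + d) + b"
      if "a \<in> carrier_vec k" "b \<in> carrier_vec k" "d \<in> carrier_vec k" for a b d :: "complex vec" and k
      using that by (intro eq_vecI) auto
    show "pencil A\<^sub>1 s *\<^sub>v x1 = cmat B\<^sub>1 *\<^sub>v u"
      unfolding pencil_mult_vec[OF c(1) x(1)]
    proof (rule diff[of _ _ _ n\<^sub>1])
      show "cmat A\<^sub>1 *\<^sub>v x1 + cmat B\<^sub>1 *\<^sub>v u = s \<cdot>\<^sub>v x1"
        using eqs(1) rearrange[OF w(1-3)] by (simp only: e1 e2 Bu)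
    qed (use w mult_mat_vec_carrier[OF cc(2) u] in auto)
    show "pencil A\<^sub>2 s *\<^sub>v x2 = cmat B\<^sub>2 *\<^sub>v y"
      unfolding pencil_mult_vec[OF c(4) x(2)]
      by (rule diff[of _ _ _ n\<^sub>2]) (use eqs(2) w comm_add_vec[OF w(4,5)] in \<open>simp_all add: e3\<close>)
  qed
qed

lemma eigenvalue_cnj:
  assumes "A \<in> carrier_mat n n" shows "eigenvalue (cmat A) (cnj s) \<longleftrightarrow> eigenvalue (cmat A) s"
proof -
  \<comment> \<open>A system without inputs and outputs turns this into a statement about transfer functions.\<close>
  have "realization n 0 A (0\<^sub>m n 0) (0\<^sub>m 0 n) (0\<^sub>m 0 0)" using assms by (simp add: realization_def)
  from transfer_function_cnj(1)[OF this, of s] transfer_function_cnj(1)[OF this, of "cnj s"] show ?thesis by auto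
qed

theorem theorem1:
  fixes n\<^sub>1 n\<^sub>2 m :: nat
    and A\<^sub>1 B\<^sub>1 C\<^sub>1 D\<^sub>1 A\<^sub>2 B\<^sub>2 C\<^sub>2 D\<^sub>2 :: "real mat"
    and G\<^sub>1 G\<^sub>2 :: "complex \<Rightarrow> complex mat"
  assumes "minimal_realization n\<^sub>1 m A\<^sub>1 B\<^sub>1 C\<^sub>1 D\<^sub>1"
    and "minimal_realization n\<^sub>2 m A\<^sub>2 B\<^sub>2 C\<^sub>2 D\<^sub>2"
    and "G\<^sub>1 = transfer_function A\<^sub>1 B\<^sub>1 C\<^sub>1 D\<^sub>1"
    and "G\<^sub>2 = transfer_function A\<^sub>2 B\<^sub>2 C\<^sub>2 D\<^sub>2"
    and "strictly_proper m G\<^sub>1"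
    and "negative_imaginary m G\<^sub>1"
    and "strictly_negative_imaginary m G\<^sub>2"
    and "neg_def m (G\<^sub>2 0)"
    and "invertible_mat (cmat A\<^sub>1 + cmat B\<^sub>1 * G\<^sub>2 0 * cmat C\<^sub>1)"
  shows "internally_stable A\<^sub>1 B\<^sub>1 C\<^sub>1 D\<^sub>1 A\<^sub>2 B\<^sub>2 C\<^sub>2 D\<^sub>2"
proof -
  note min1 = assms(1) and min2 = assms(2)
  note G1 = assms(3) and G2 = assms(4)
  note SP = assms(5)[unfolded G1] and NI = assms(6)[unfolded G1] and SNI = assms(7)[unfolded G2]
    and G20 = assms(8)[unfolded G2] and reg = assms(9)[unfolded G2]
  have R1: "realization n\<^sub>1 m A\<^sub>1 B\<^sub>1 C\<^sub>1 D\<^sub>1" and R2: "realization n\<^sub>2 m A\<^sub>2 B\<^sub>2 C\<^sub>2 D\<^sub>2"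
    using min1 min2 by (auto simp: minimal_realization_def)
  have D1: "D\<^sub>1 = 0\<^sub>m m m" by (rule strictly_proper_imp_zero_feedthrough[OF R1 SP])
  have c: "A\<^sub>1 \<in> carrier_mat n\<^sub>1 n\<^sub>1" "B\<^sub>1 \<in> carrier_mat n\<^sub>1 m" "C\<^sub>1 \<in> carrier_mat m n\<^sub>1"
    "A\<^sub>2 \<in> carrier_mat n\<^sub>2 n\<^sub>2" "B\<^sub>2 \<in> carrier_mat n\<^sub>2 m" "C\<^sub>2 \<in> carrier_mat m n\<^sub>2" "D\<^sub>2 \<in> carrier_mat m m"
    using R1 R2 by (auto simp: realization_def)
  define F where "F = closed_loop_matrix A\<^sub>1 B\<^sub>1 C\<^sub>1 D\<^sub>1 A\<^sub>2 B\<^sub>2 C\<^sub>2 D\<^sub>2"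
  have F: "F \<in> carrier_mat (n\<^sub>1 + n\<^sub>2) (n\<^sub>1 + n\<^sub>2)"
    unfolding F_def D1 closed_loop_matrix_strictly_proper[OF R1[unfolded D1] R2]
    using c by (intro four_block_carrier_mat add_carrier_mat mult_carrier_mat[of _ _ m]) auto
  \<comment> \<open>Eigenvalues come in conjugate pairs, so the upper half-plane suffices.\<close>
  have stable: False if ev: "eigenvalue (cmat F) s" and s: "Re s \<ge> 0" "Im s \<ge> 0" for s
  proof -
    obtain x\<^sub>1 x\<^sub>2 u y where x: "x\<^sub>1 \<in> carrier_vec n\<^sub>1" "x\<^sub>2 \<in> carrier_vec n\<^sub>2" "x\<^sub>1 \<noteq> 0\<^sub>v n\<^sub>1 \<or> x\<^sub>2 \<noteq> 0\<^sub>v n\<^sub>2"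
      and yu: "y \<in> carrier_vec m" "u \<in> carrier_vec m"
      and y: "y = cmat C\<^sub>1 *\<^sub>v x\<^sub>1" and u: "u = cmat C\<^sub>2 *\<^sub>v x\<^sub>2 + cmat D\<^sub>2 *\<^sub>v y"
      and eq1: "pencil A\<^sub>1 s *\<^sub>v x\<^sub>1 = cmat B\<^sub>1 *\<^sub>v u" and eq2: "pencil A\<^sub>2 s *\<^sub>v x\<^sub>2 = cmat B\<^sub>2 *\<^sub>v y"
      using closed_loop_eigenvector[OF R1[unfolded D1] R2] ev unfolding F_def D1 by metis
    have s2: "\<not> eigenvalue (cmat A\<^sub>2) s" by (rule strictly_negative_imaginary_stable[OF min2 SNI s(1)])
    have uG: "u = transfer_function A\<^sub>2 B\<^sub>2 C\<^sub>2 D\<^sub>2 s *\<^sub>v y"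
      unfolding u by (rule output_of_state[OF R2 s2 x(2) yu(1) eq2, symmetric])
    \<comment> \<open>With \<open>y = 0\<close> both systems would be undriven; the second one has no mode at \<open>s\<close>, and a
      mode of the first one would be unobservable.\<close>
    have "y \<noteq> 0\<^sub>v m"
    proof
      assume y0: "y = 0\<^sub>v m"
      have zero: "M *\<^sub>v 0\<^sub>v m = 0\<^sub>v k" if "M \<in> carrier_mat k m" for M :: "complex mat" and k
        using that by (intro eq_vecI) auto
      have u0: "u = 0\<^sub>v m" unfolding uG y0 by (rule zero[OF transfer_function_carrier[OF R2 s2]])
      have "pencil A\<^sub>2 s *\<^sub>v x\<^sub>2 = 0\<^sub>v n\<^sub>2" unfolding eq2 y0 using c by (intro zero) auto
      hence "x\<^sub>2 = 0\<^sub>v n\<^sub>2"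
        using s2 x(2) det_0_iff_vec_prod_zero[OF pencil_carrier[OF c(4)], of s]
        unfolding eigenvalue_iff_det_pencil[OF c(4)] by blast
      have "pencil A\<^sub>1 s *\<^sub>v x\<^sub>1 = 0\<^sub>v n\<^sub>1" unfolding eq1 u0 using c by (intro zero) auto
      hence "cmat A\<^sub>1 *\<^sub>v x\<^sub>1 = s \<cdot>\<^sub>v x\<^sub>1"
        using minus_vec_eq_zero_iff[of "s \<cdot>\<^sub>v x\<^sub>1" n\<^sub>1 "cmat A\<^sub>1 *\<^sub>v x\<^sub>1"] c(1) x(1) by (simp add: pencil_mult_vec[OF c(1)])
      hence "x\<^sub>1 = 0\<^sub>v n\<^sub>1" using minimal_realization_observable[OF min1 x(1)] y y0 by metis
      with \<open>x\<^sub>2 = 0\<^sub>v n\<^sub>2\<close> x(3) show False by simp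
    qed
    define g where "g = u \<bullet>c y"
    have yg: "y \<bullet>c u = cnj g"
      unfolding g_def using yu by (auto simp: scalar_prod_def mult.commute intro!: sum.cong)
    have passive1: "Re (s * cnj g) \<ge> 0"
      using negative_imaginary_passive_on_closed_halfplane[OF min1 SP NI x(1) yu(2) s(1) eq1] yg y by simp
    consider "Re s > 0" | "Re s = 0" "Im s > 0" | "s = 0"
      using s by (metis complex_eq_iff order_le_less zero_complex.simps)
    thus False
    proof cases
      case 1
      have "Re (g / s) < 0"
        using strictly_negative_imaginary_imp_strictly_positive_real[OF min2 SNI G20 yu(1) \<open>y \<noteq> 0\<^sub>v m\<close> 1]
        by (simp add: g_def uG)
      \<comment> \<open>This is \<open>Re (cnj s * g) < 0\<close>, because \<open>g / s = cnj s * g / (norm s)\<^sup>2\<close>.\<close>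
      hence "Re g * Re s + Im g * Im s < 0" using 1
        by (simp add: Re_divide divide_less_0_iff not_sum_power2_lt_zero)
      thus False using passive1 by (simp add: algebra_simps)
    next
      case 2
      have "s = \<i> * of_real (Im s)" using 2 by (simp add: complex_eq_iff)
      hence "Im g < 0"
        using strictly_negative_imaginary_at_axis[OF min2 SNI yu(1) \<open>y \<noteq> 0\<^sub>v m\<close> 2(2)] by (simp add: g_def uG)
      hence "Im s * Im g < 0" using 2(2) by (simp add: mult_pos_neg)
      thus False using passive1 2(1) by simp
    next
      case 3
      let ?M = "cmat B\<^sub>1 * transfer_function A\<^sub>2 B\<^sub>2 C\<^sub>2 D\<^sub>2 0 * cmat C\<^sub>1"
      have G0: "transfer_function A\<^sub>2 B\<^sub>2 C\<^sub>2 D\<^sub>2 0 \<in> carrier_mat m m" using G20 by (simp add: neg_def_def hermitian_mat_def)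
      have cc: "cmat A\<^sub>1 \<in> carrier_mat n\<^sub>1 n\<^sub>1" "cmat B\<^sub>1 \<in> carrier_mat n\<^sub>1 m" "cmat C\<^sub>1 \<in> carrier_mat m n\<^sub>1" using c by auto
      have M: "?M \<in> carrier_mat n\<^sub>1 n\<^sub>1" by (rule mult_carrier_mat[OF mult_carrier_mat[OF cc(2) G0] cc(3)])
      have "?M *\<^sub>v x\<^sub>1 = cmat B\<^sub>1 *\<^sub>v u"
        unfolding uG y 3 by (simp only: assoc_mult_mat_vec[OF mult_carrier_mat[OF cc(2) G0] cc(3) x(1)]
          assoc_mult_mat_vec[OF cc(2) G0 mult_mat_vec_carrier[OF cc(3) x(1)]])
      also have "\<dots> = - (cmat A\<^sub>1 *\<^sub>v x\<^sub>1)"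
        using eq1 cc(1) x(1) unfolding 3 pencil_mult_vec[OF c(1) x(1)] by (auto simp: vec_eq_iff)
      finally have "?M *\<^sub>v x\<^sub>1 = - (cmat A\<^sub>1 *\<^sub>v x\<^sub>1)" .
      hence null: "(cmat A\<^sub>1 + ?M) *\<^sub>v x\<^sub>1 = 0\<^sub>v n\<^sub>1"
        using mult_mat_vec_carrier[OF cc(1) x(1)] by (simp add: add_mult_distrib_mat_vec[OF cc(1) M x(1)])
      obtain Q where Q: "Q * (cmat A\<^sub>1 + ?M) = 1\<^sub>m (dim_row Q)" "(cmat A\<^sub>1 + ?M) * Q = 1\<^sub>m n\<^sub>1"
        using reg M by (auto simp: invertible_mat_def inverts_mat_def)
      have dQ: "dim_col Q = n\<^sub>1" using arg_cong[OF Q(2), of dim_col] by simp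
      have "dim_row Q = n\<^sub>1" using arg_cong[OF Q(1), of dim_col] c by simp
      with dQ have Qc: "Q \<in> carrier_mat n\<^sub>1 n\<^sub>1" by auto
      have "x\<^sub>1 = (Q * (cmat A\<^sub>1 + ?M)) *\<^sub>v x\<^sub>1" using Q(1) Qc x(1) by simp
      also have "\<dots> = Q *\<^sub>v 0\<^sub>v n\<^sub>1"
        by (simp only: assoc_mult_mat_vec[OF Qc add_carrier_mat[OF M] x(1)] null)
      also have "\<dots> = 0\<^sub>v n\<^sub>1" using Qc by (intro eq_vecI) auto
      finally have "x\<^sub>1 = 0\<^sub>v n\<^sub>1" .
      hence "y = 0\<^sub>v m" unfolding y using cc by (intro eq_vecI) auto
      with \<open>y \<noteq> 0\<^sub>v m\<close> show False by contradiction
    qed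
  qed
  have "Re s < 0" if "eigenvalue (cmat F) s" for s
    using stable[of s] stable[of "cnj s"] that eigenvalue_cnj[OF F, of s] by (cases "Im s \<ge> 0") force+
  hence "hurwitz F" by (simp add: hurwitz_def)
  moreover have "invertible_mat (1\<^sub>m (dim_row D\<^sub>1) - D\<^sub>1 * D\<^sub>2)"
    using c(7) by (auto simp: D1 invertible_mat_def inverts_mat_def intro!: exI[of _ "1\<^sub>m m"])
  ultimately show ?thesis by (simp add: internally_stable_def F_def)
qed

end
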